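(* Let $G$ be a one-parameter metabelian nilpotent Lie group of dimension $n$ with Lie algebra $\mathfrak g$, and let $\Gamma$ be a discrete uniform subgroup of $G$. Then $\mathfrak g$ admits an abelian ideal of codimension one which is rational (with respect to the rational structure determined by $\Gamma$).
   Context: A one-parameter metabelian nilpotent Lie group is a connected, simply connected nilpotent Lie group $G$ whose Lie algebra $\mathfrak g$ is nonabelian and has an abelian ideal of codimension one. A discrete subgroup $\Gamma\subset G$ is uniform if $G/\Gamma$ is compact. The rational structure determined by $\Gamma$ is $\mathfrak g_{\mathbb Q}=\mathbb Q\text{-span}\{\log\Gamma\}$; a real subspace $\mathfrak h\subset\mathfrak g$ is rational if $\mathfrak h=\mathbb R\text{-span}(\mathfrak h\cap\mathfrak g_{\mathbb Q})$. *)

theory Defs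
  imports "HOL-Analysis.Analysis" "HOL-Algebra.Left_Coset"
begin

section \<open>Smooth maps and smooth manifolds\<close>

text \<open>
  On an open subset of a Euclidean space, \<open>f\<close> is of class \<open>C\<^sup>k\<^sup>+\<^sup>1\<close> iff it is differentiable there
  and all its directional derivatives are of class \<open>C\<^sup>k\<close>. The notion is only used for open \<open>S\<close>.
\<close>

primrec Ck_on :: "nat \<Rightarrow> 'a::euclidean_space set \<Rightarrow> ('a \<Rightarrow> 'b::euclidean_space) \<Rightarrow> bool" where
  "Ck_on 0 S f \<longleftrightarrow> continuous_on S f"
| "Ck_on (Suc k) S f \<longleftrightarrow>
     (\<exists>f'. (\<forall>x\<in>S. (f has_derivative f' x) (at x)) \<and> (\<forall>v. Ck_on k S (\<lambda>x. f' x v)))"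

definition smooth_on :: "'a::euclidean_space set \<Rightarrow> ('a \<Rightarrow> 'b::euclidean_space) \<Rightarrow> bool" where
  "smooth_on S f \<longleftrightarrow> (\<forall>k. Ck_on k S f)"

text \<open>
  A chart is a pair of its domain and its coordinate map (relevant on the domain only). The manifold
  is the whole type \<open>'g\<close>, and its dimension is that of the model space \<open>'e\<close>.
\<close>

type_synonym ('g, 'e) chart = "'g set \<times> ('g \<Rightarrow> 'e)"

definition smooth_atlas :: "('g::topological_space, 'e::euclidean_space) chart set \<Rightarrow> bool" where
  "smooth_atlas A \<longleftrightarrow>
     \<Union> (fst ` A) = UNIV \<and>
     (\<forall>(U, \<phi>)\<in>A. open U \<and> open (\<phi> ` U) \<and> homeomorphism U (\<phi> ` U) \<phi> (inv_into U \<phi>)) \<and>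
     (\<forall>(U, \<phi>)\<in>A. \<forall>(V, \<psi>)\<in>A. smooth_on (\<phi> ` (U \<inter> V)) (\<psi> \<circ> inv_into U \<phi>))"

definition prod_atlas :: "('g, 'e) chart set \<Rightarrow> ('h, 'f) chart set \<Rightarrow> ('g \<times> 'h, 'e \<times> 'f) chart set" where
  "prod_atlas A B = {(U \<times> V, map_prod \<phi> \<psi>) | U \<phi> V \<psi>. (U, \<phi>) \<in> A \<and> (V, \<psi>) \<in> B}"

definition real_atlas :: "(real, real) chart set" where
  "real_atlas = {(UNIV, id)}"

definition smooth_map ::
  "('g::topological_space, 'e::euclidean_space) chart set \<Rightarrow>
   ('h::topological_space, 'f::euclidean_space) chart set \<Rightarrow> ('g \<Rightarrow> 'h) \<Rightarrow> bool" where
  "smooth_map A B f \<longleftrightarrow>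
     continuous_on UNIV f \<and>
     (\<forall>(U, \<phi>)\<in>A. \<forall>(V, \<psi>)\<in>B. smooth_on (\<phi> ` (U \<inter> f -` V)) (\<psi> \<circ> f \<circ> inv_into U \<phi>))"


section \<open>Lie groups\<close>

definition lie_group ::
  "'g::{t2_space, second_countable_topology} monoid \<Rightarrow> ('g, 'e::euclidean_space) chart set \<Rightarrow> bool" where
  "lie_group G A \<longleftrightarrow>
     group G \<and> carrier G = UNIV \<and> smooth_atlas A \<and>
     smooth_map (prod_atlas A A) A (\<lambda>(x, y). x \<otimes>\<^bsub>G\<^esub> y) \<and>
     smooth_map A A (\<lambda>x. inv\<^bsub>G\<^esub> x)"

definition chart_at_identity ::
  "'g monoid \<Rightarrow> ('g, 'e) chart set \<Rightarrow> 'g set \<Rightarrow> ('g \<Rightarrow> 'e) \<Rightarrow> bool" where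
  "chart_at_identity G A U \<phi> \<longleftrightarrow> (U, \<phi>) \<in> A \<and> \<one>\<^bsub>G\<^esub> \<in> U"

text \<open>
  The Lie algebra of \<open>G\<close> is the tangent space at the identity. A chart \<open>(U, \<phi>)\<close> at the identity
  identifies it with \<open>'e\<close> (via the derivative of \<open>\<phi>\<close>), and vector fields on \<open>U\<close> with maps
  \<open>'e \<Rightarrow> 'e\<close> on \<open>\<phi> ` U\<close>. The bracket of \<open>X\<close> and \<open>Y\<close> is the value at the identity of the bracket
  of the left-invariant vector fields through \<open>X\<close> and \<open>Y\<close>; two charts at the identity give
  isomorphic structures, the isomorphism being the derivative of the change of coordinates.
\<close>

definition chart_mult :: "'g monoid \<Rightarrow> 'g set \<Rightarrow> ('g \<Rightarrow> 'e) \<Rightarrow> 'e \<Rightarrow> 'e \<Rightarrow> 'e" where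
  "chart_mult G U \<phi> x y = \<phi> (inv_into U \<phi> x \<otimes>\<^bsub>G\<^esub> inv_into U \<phi> y)"

definition left_invariant_field ::
  "'g monoid \<Rightarrow> 'g set \<Rightarrow> ('g \<Rightarrow> 'e::euclidean_space) \<Rightarrow> 'e \<Rightarrow> 'e \<Rightarrow> 'e" where
  "left_invariant_field G U \<phi> X x = frechet_derivative (chart_mult G U \<phi> x) (at (\<phi> \<one>\<^bsub>G\<^esub>)) X"

definition field_bracket :: "('e::euclidean_space \<Rightarrow> 'e) \<Rightarrow> ('e \<Rightarrow> 'e) \<Rightarrow> 'e \<Rightarrow> 'e" where
  "field_bracket V W p = frechet_derivative W (at p) (V p) - frechet_derivative V (at p) (W p)"

definition lie_bracket ::
  "'g monoid \<Rightarrow> 'g set \<Rightarrow> ('g \<Rightarrow> 'e::euclidean_space) \<Rightarrow> 'e \<Rightarrow> 'e \<Rightarrow> 'e" where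
  "lie_bracket G U \<phi> X Y =
     field_bracket (left_invariant_field G U \<phi> X) (left_invariant_field G U \<phi> Y) (\<phi> \<one>\<^bsub>G\<^esub>)"

definition one_parameter_subgroup ::
  "'g::topological_space monoid \<Rightarrow> ('g, 'e::euclidean_space) chart set \<Rightarrow> ('g \<Rightarrow> 'e) \<Rightarrow> 'e \<Rightarrow>
   (real \<Rightarrow> 'g) \<Rightarrow> bool" where
  "one_parameter_subgroup G A \<phi> X \<gamma> \<longleftrightarrow>
     smooth_map real_atlas A \<gamma> \<and> (\<forall>s t. \<gamma> (s + t) = \<gamma> s \<otimes>\<^bsub>G\<^esub> \<gamma> t) \<and>
     ((\<phi> \<circ> \<gamma>) has_vector_derivative X) (at 0)"

definition lie_exp ::
  "'g::topological_space monoid \<Rightarrow> ('g, 'e::euclidean_space) chart set \<Rightarrow> ('g \<Rightarrow> 'e) \<Rightarrow> 'e \<Rightarrow> 'g" where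
  "lie_exp G A \<phi> X = (THE \<gamma>. one_parameter_subgroup G A \<phi> X \<gamma>) 1"

text \<open>
  For connected, simply connected nilpotent \<open>G\<close> the exponential map is a bijection, so the preimage
  below is the image of \<open>S\<close> under its inverse.
\<close>

definition lie_log_set ::
  "'g::topological_space monoid \<Rightarrow> ('g, 'e::euclidean_space) chart set \<Rightarrow> ('g \<Rightarrow> 'e) \<Rightarrow> 'g set \<Rightarrow> 'e set" where
  "lie_log_set G A \<phi> S = lie_exp G A \<phi> -` S"


section \<open>Lie algebras\<close>

text \<open>Here \<open>b\<close> is the bracket of a Lie algebra with underlying vector space \<open>'e\<close>.\<close>

definition abelian_ideal :: "('e::euclidean_space \<Rightarrow> 'e \<Rightarrow> 'e) \<Rightarrow> 'e set \<Rightarrow> bool" where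
  "abelian_ideal b \<aa> \<longleftrightarrow>
     subspace \<aa> \<and> (\<forall>X. \<forall>Y\<in>\<aa>. b X Y \<in> \<aa>) \<and> (\<forall>X\<in>\<aa>. \<forall>Y\<in>\<aa>. b X Y = 0)"

definition codim_one :: "'e::euclidean_space set \<Rightarrow> bool" where
  "codim_one \<hh> \<longleftrightarrow> dim \<hh> + 1 = DIM('e)"

primrec lower_central :: "('e::euclidean_space \<Rightarrow> 'e \<Rightarrow> 'e) \<Rightarrow> nat \<Rightarrow> 'e set" where
  "lower_central b 0 = UNIV"
| "lower_central b (Suc k) = span {b X Y | X Y. Y \<in> lower_central b k}"

definition nilpotent_bracket :: "('e::euclidean_space \<Rightarrow> 'e \<Rightarrow> 'e) \<Rightarrow> bool" where
  "nilpotent_bracket b \<longleftrightarrow> (\<exists>k. lower_central b k = {0})"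

definition one_parameter_metabelian_nilpotent ::
  "'g::{t2_space, second_countable_topology} monoid \<Rightarrow> ('g, 'e::euclidean_space) chart set \<Rightarrow>
   'g set \<Rightarrow> ('g \<Rightarrow> 'e) \<Rightarrow> bool" where
  "one_parameter_metabelian_nilpotent G A U \<phi> \<longleftrightarrow>
     lie_group G A \<and> chart_at_identity G A U \<phi> \<and>
     connected (UNIV :: 'g set) \<and> simply_connected (UNIV :: 'g set) \<and>
     nilpotent_bracket (lie_bracket G U \<phi>) \<and>
     (\<exists>X Y. lie_bracket G U \<phi> X Y \<noteq> 0) \<and>
     (\<exists>\<aa>. abelian_ideal (lie_bracket G U \<phi>) \<aa> \<and> codim_one \<aa>)"


section \<open>Discrete uniform subgroups and rational subspaces\<close>

definition coset_topology :: "'g::topological_space monoid \<Rightarrow> 'g set \<Rightarrow> 'g set topology" where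
  "coset_topology G \<Gamma> =
     topology (\<lambda>\<U>. \<U> \<subseteq> lcosets\<^bsub>G\<^esub> \<Gamma> \<and> open {g. g <#\<^bsub>G\<^esub> \<Gamma> \<in> \<U>})"

lemma openin_coset_topology:
  "openin (coset_topology G \<Gamma>) \<U> \<longleftrightarrow> \<U> \<subseteq> lcosets\<^bsub>G\<^esub> \<Gamma> \<and> open {g. g <#\<^bsub>G\<^esub> \<Gamma> \<in> \<U>}"
proof -
  have "istopology (\<lambda>\<U>. \<U> \<subseteq> lcosets\<^bsub>G\<^esub> \<Gamma> \<and> open {g. g <#\<^bsub>G\<^esub> \<Gamma> \<in> \<U>})"
    unfolding istopology_def
  proof (intro conjI allI impI)
    fix \<K> assume K: "\<forall>K\<in>\<K>. K \<subseteq> lcosets\<^bsub>G\<^esub> \<Gamma> \<and> open {g. g <#\<^bsub>G\<^esub> \<Gamma> \<in> K}"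
    have "{g. g <#\<^bsub>G\<^esub> \<Gamma> \<in> \<Union> \<K>} = (\<Union>K\<in>\<K>. {g. g <#\<^bsub>G\<^esub> \<Gamma> \<in> K})" by auto
    with K show "open {g. g <#\<^bsub>G\<^esub> \<Gamma> \<in> \<Union> \<K>}" by auto
  qed (auto simp: Collect_conj_eq)
  then show ?thesis by (simp add: coset_topology_def)
qed

lemma quotient_map_coset_topology:
  assumes "carrier G = UNIV"
  shows "quotient_map euclidean (coset_topology G \<Gamma>) (\<lambda>g. g <#\<^bsub>G\<^esub> \<Gamma>)"
proof -
  have range: "lcosets\<^bsub>G\<^esub> \<Gamma> = range (\<lambda>g. g <#\<^bsub>G\<^esub> \<Gamma>)" by (auto simp: LCOSETS_def assms)
  then have "openin (coset_topology G \<Gamma>) (lcosets\<^bsub>G\<^esub> \<Gamma>)" by (simp add: openin_coset_topology)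
  then have "topspace (coset_topology G \<Gamma>) = lcosets\<^bsub>G\<^esub> \<Gamma>"
    by (meson openin_coset_topology openin_subset openin_topspace subset_antisym)
  with range show ?thesis by (auto simp: quotient_map_def openin_coset_topology)
qed

definition discrete_uniform_subgroup :: "'g::topological_space monoid \<Rightarrow> 'g set \<Rightarrow> bool" where
  "discrete_uniform_subgroup G \<Gamma> \<longleftrightarrow>
     subgroup \<Gamma> G \<and> discrete \<Gamma> \<and> compact_space (coset_topology G \<Gamma>)"

definition rat_scale :: "rat \<Rightarrow> 'e::real_vector \<Rightarrow> 'e" where
  "rat_scale q v = of_rat q *\<^sub>R v"

interpretation rat: vector_space rat_scale
  by standard (simp_all add: rat_scale_def algebra_simps of_rat_add of_rat_mult)

definition rational_structure ::
  "'g::topological_space monoid \<Rightarrow> ('g, 'e::euclidean_space) chart set \<Rightarrow> ('g \<Rightarrow> 'e) \<Rightarrow> 'g set \<Rightarrow> 'e set" where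
  "rational_structure G A \<phi> \<Gamma> = rat.span (lie_log_set G A \<phi> \<Gamma>)"

definition rational_subspace :: "'e::euclidean_space set \<Rightarrow> 'e set \<Rightarrow> bool" where
  "rational_subspace \<qq> \<hh> \<longleftrightarrow> subspace \<hh> \<and> \<hh> = span (\<hh> \<inter> \<qq>)"

end

theory Submission
  imports Defs
begin

text \<open>
  Write \<open>\<gg> = \<real>n \<oplus> V\<close> with \<open>V\<close> an abelian ideal, \<open>n\<close> its unit normal, and \<open>T = ad n\<close>. The map
  \<open>(t, v) \<mapsto> exp(tn) exp(v)\<close> is a surjective homomorphism onto \<open>G\<close> from a semidirect product of
  \<open>\<real>\<close> and \<open>V\<close>, injective near \<open>0\<close>, so \<open>\<Gamma>\<close> pulls back to a subgroup \<open>H\<close> that is cocompact and meets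
  \<open>V\<close> in a discrete group \<open>\<Lambda>\<close>. If the projection of \<open>H\<close> to \<open>\<real>\<close> is discrete, \<open>\<Lambda>\<close> spans \<open>V\<close>, and \<open>V\<close> is
  rational. Otherwise conjugation by elements of \<open>H\<close> with small \<open>t\<close> moves points of \<open>\<Lambda>\<close> arbitrarily little,
  whence \<open>T = 0\<close> on \<open>\<Lambda>\<close>; as commutators of \<open>H\<close> lie in \<open>\<Lambda>\<close>, cocompactness gives \<open>T\<^sup>2 = 0\<close>, and the
  commutators become \<open>t Tw - s Tv\<close>. A linear relation between three of them forces \<open>T\<close> to have rank one,
  and then the centralizer of any \<open>log (s, w)\<close> with \<open>(s, w) \<in> H\<close> and \<open>s \<noteq> 0\<close> is a rational abelian
  ideal of codimension one.
\<close>

section \<open>Smooth maps between Euclidean spaces\<close>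

text \<open>The given ideal \<open>V\<close> can be irrational: in the Heisenberg algebra every
  plane through the center is an abelian ideal, and only countably many of these planes are
  rational. So \<open>V\<close> may have to be replaced, and a second such ideal exists only if
  \<open>T\<close> has rank one; a non-discrete projection of \<open>H\<close> forces exactly this.
  The replacement is the kernel of the bracket with log (s, w). On logarithms of \<open>H\<close>
  this bracket takes values in the discrete group \<Lambda>, hence finitely many on bounded pieces,
  and quotients of elements with equal values supply enough lattice logarithms inside the kernel. A
  second obstacle is that \<open>lie_exp\<close> is a definite description and the bracket is one of
  vector fields, so both must be tied to the group law. The bridge is Ad (exp tX) = exp (t ad X); in
  the coordinates exp(tn) exp(v) it determines the whole multiplication, and logarithms with
  \<open>t\<close> different from 0 are computed only where \<open>T\<close> has square
  zero.\<close>

lemma Ck_on_subset: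
  assumes "Ck_on k S f" "T \<subseteq> S" shows "Ck_on k T f"
  using assms
proof (induction k arbitrary: f)
  case 0 then show ?case by (auto intro: continuous_on_subset)
next
  case (Suc k)
  then obtain f' where "\<forall>x\<in>S. (f has_derivative f' x) (at x)" "\<forall>v. Ck_on k S (\<lambda>x. f' x v)" by auto
  with Suc show ?case by (auto intro!: exI[of _ f'])
qed

lemma Ck_on_cong:
  assumes "open S" "\<And>x. x \<in> S \<Longrightarrow> f x = g x" "Ck_on k S f" shows "Ck_on k S g"
proof (cases k)
  case 0 then show ?thesis using assms continuous_on_cong by fastforce
next
  case (Suc m)
  then obtain f' where f': "\<forall>x\<in>S. (f has_derivative f' x) (at x)" "\<forall>v. Ck_on m S (\<lambda>x. f' x v)"
    using assms by auto
  have "\<forall>x\<in>S. (g has_derivative f' x) (at x)"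
    using f'(1) assms(1,2) has_derivative_transform_within_open by blast
  then show ?thesis using Suc f'(2) by auto
qed

text \<open>Derivatives at a point are unique, so the existential witness in \<open>Ck_on\<close>
  can be traded for \<open>frechet_derivative\<close>, a candidate that does not depend on the
  set.\<close>

lemma Ck_on_Suc_frechet:
  assumes "open S"
  shows "Ck_on (Suc k) S f \<longleftrightarrow>
     (\<forall>x\<in>S. f differentiable at x) \<and> (\<forall>v. Ck_on k S (\<lambda>x. frechet_derivative f (at x) v))"
proof
  assume "Ck_on (Suc k) S f"
  then obtain f' where f': "\<forall>x\<in>S. (f has_derivative f' x) (at x)" "\<forall>v. Ck_on k S (\<lambda>x. f' x v)"
    by auto
  have "f' x = frechet_derivative f (at x)" if "x \<in> S" for x
    using f'(1) that frechet_derivative_at by blast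
  then show "(\<forall>x\<in>S. f differentiable at x) \<and> (\<forall>v. Ck_on k S (\<lambda>x. frechet_derivative f (at x) v))"
    using f' assms by (auto simp: differentiable_def intro: Ck_on_cong[of S "\<lambda>x. f' x v" for v])
next
  assume "(\<forall>x\<in>S. f differentiable at x) \<and> (\<forall>v. Ck_on k S (\<lambda>x. frechet_derivative f (at x) v))"
  then show "Ck_on (Suc k) S f"
    by (auto simp: frechet_derivative_works intro!: exI[of _ "\<lambda>x. frechet_derivative f (at x)"])
qed

lemma Ck_on_Suc_D: "Ck_on (Suc k) S f \<Longrightarrow> Ck_on k S f"
proof (induction k arbitrary: f)
  case 0
  then obtain f' where f': "\<forall>x\<in>S. (f has_derivative f' x) (at x)" by auto
  then show ?case
    by (auto intro!: continuous_at_imp_continuous_on dest: has_derivative_continuous)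
next
  case (Suc k)
  then obtain f' where f': "\<forall>x\<in>S. (f has_derivative f' x) (at x)"
      "\<And>v. Ck_on (Suc k) S (\<lambda>x. f' x v)"
    by (metis Ck_on.simps(2))
  with Suc.IH show ?case by auto
qed

text \<open>Witnesses on different neighbourhoods come with no common extension;
  \<open>frechet_derivative\<close> provides one, and the induction applies to its directional
  components.\<close>

lemma Ck_on_local:
  assumes "open S" "\<And>x. x \<in> S \<Longrightarrow> \<exists>T. open T \<and> x \<in> T \<and> Ck_on k T f"
  shows "Ck_on k S f"
  using assms
proof (induction k arbitrary: f)
  case 0
  have "isCont f x" if "x \<in> S" for x
    using 0(2)[OF that] by (auto simp: continuous_on_eq_continuous_at)
  then show ?case by (simp add: continuous_at_imp_continuous_on)
next
  case (Suc k)
  have "f differentiable at x" if "x \<in> S" for x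
    using Suc.prems(2)[OF that] Ck_on_Suc_frechet by blast
  moreover have "Ck_on k S (\<lambda>x. frechet_derivative f (at x) v)" for v
  proof (rule Suc.IH[OF Suc.prems(1)])
    fix x assume "x \<in> S"
    then obtain U where U: "open U" "x \<in> U" "Ck_on (Suc k) U f" using Suc.prems(2) by blast
    then show "\<exists>U. open U \<and> x \<in> U \<and> Ck_on k U (\<lambda>x. frechet_derivative f (at x) v)"
      using Ck_on_Suc_frechet[OF U(1)] by blast
  qed
  ultimately show ?case using Ck_on_Suc_frechet[OF Suc.prems(1)] by blast
qed

lemma Ck_on_const: "Ck_on k S (\<lambda>x. c)"
  by (induction k arbitrary: c) (auto intro!: exI[of _ "\<lambda>_ _. 0"])

lemma Ck_on_bounded_linear:
  assumes "bounded_linear h" shows "Ck_on k S h"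
  by (cases k) (auto intro!: exI[of _ "\<lambda>_. h"] Ck_on_const bounded_linear_imp_has_derivative
      linear_continuous_on assms)

lemma Ck_on_bounded_linear_compose:
  assumes h: "bounded_linear h" and "Ck_on k S f" shows "Ck_on k S (\<lambda>x. h (f x))"
  using assms(2)
proof (induction k arbitrary: f)
  case 0 then show ?case using bounded_linear.continuous_on[OF h] by auto
next
  case (Suc k)
  then obtain f' where f': "\<forall>x\<in>S. (f has_derivative f' x) (at x)" "\<forall>v. Ck_on k S (\<lambda>x. f' x v)"
    by auto
  then show ?case using Suc.IH bounded_linear.has_derivative[OF h, of f "f' x" "at x" for x]
    by (auto intro!: exI[of _ "\<lambda>x v. h (f' x v)"])
qed

lemma Ck_on_add:
  assumes "Ck_on k S f" "Ck_on k S g" shows "Ck_on k S (\<lambda>x. f x + g x)"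
  using assms
proof (induction k arbitrary: f g)
  case 0 then show ?case by (auto intro: continuous_on_add)
next
  case (Suc k)
  then obtain f' g' where "\<forall>x\<in>S. (f has_derivative f' x) (at x)" "\<forall>v. Ck_on k S (\<lambda>x. f' x v)"
    "\<forall>x\<in>S. (g has_derivative g' x) (at x)" "\<forall>v. Ck_on k S (\<lambda>x. g' x v)"
    by auto
  then show ?case using Suc.IH 
    by (auto intro!: exI[of _ "\<lambda>x v. f' x v + g' x v"] has_derivative_add)
qed

lemma Ck_on_sum:
  assumes "\<And>i. i \<in> I \<Longrightarrow> Ck_on k S (f i)" shows "Ck_on k S (\<lambda>x. \<Sum>i\<in>I. f i x)"
  using assms
  by (induction I rule: infinite_finite_induct) (auto intro: Ck_on_const Ck_on_add)

lemma Ck_on_scaleR: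
  assumes "Ck_on k S f" "Ck_on k S g" shows "Ck_on k S (\<lambda>x. f x *\<^sub>R g x)"
  using assms
proof (induction k arbitrary: f g)
  case 0 then show ?case by (auto intro: continuous_on_scaleR)
next
  case (Suc k)
  then obtain f' g' where *: "\<forall>x\<in>S. (f has_derivative f' x) (at x)" "\<forall>v. Ck_on k S (\<lambda>x. f' x v)"
    "\<forall>x\<in>S. (g has_derivative g' x) (at x)" "\<forall>v. Ck_on k S (\<lambda>x. g' x v)"
    by auto
  then show ?case using Suc.IH Suc.prems[THEN Ck_on_Suc_D]
    by (auto intro!: exI[of _ "\<lambda>x v. f x *\<^sub>R g' x v + f' x v *\<^sub>R g x"] has_derivative_scaleR Ck_on_add)
qed

lemma linear_sum_Basis:
  fixes f :: "'a::euclidean_space \<Rightarrow> 'b::real_vector"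
  assumes "linear f" shows "f y = (\<Sum>b\<in>Basis. (y \<bullet> b) *\<^sub>R f b)"
proof -
  have "f y = f (\<Sum>b\<in>Basis. (y \<bullet> b) *\<^sub>R b)" by (simp add: euclidean_representation)
  then show ?thesis by (simp add: linear_sum[OF assms] linear_scale[OF assms])
qed

text \<open>In the chain rule the direction \<open>f' x v\<close> fed to \<open>g'\<close> moves
  with \<open>x\<close>, whereas the induction hypothesis covers fixed directions. Expanding it in
  \<open>Basis\<close> leaves scalar coefficients times derivatives of \<open>g\<close> in fixed
  directions.\<close>

lemma Ck_on_compose:
  assumes "Ck_on k S f" "Ck_on k T g" "f ` S \<subseteq> T" shows "Ck_on k S (\<lambda>x. g (f x))"
  using assms
proof (induction k arbitrary: f g)
  case 0 then show ?case by (auto intro: continuous_on_compose2)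
next
  case (Suc k)
  then obtain f' g' where f': "\<forall>x\<in>S. (f has_derivative f' x) (at x)" "\<forall>v. Ck_on k S (\<lambda>x. f' x v)"
    and g': "\<forall>x\<in>T. (g has_derivative g' x) (at x)" "\<forall>v. Ck_on k T (\<lambda>x. g' x v)"
    by auto
  let ?d = "\<lambda>x v. \<Sum>b\<in>Basis. (f' x v \<bullet> b) *\<^sub>R g' (f x) b"
  have "((\<lambda>x. g (f x)) has_derivative ?d x) (at x)" if x: "x \<in> S" for x
  proof -
    have gx: "(g has_derivative g' (f x)) (at (f x))" using g' Suc.prems(3) x by blast
    have lin: "linear (g' (f x))"
      using gx has_derivative_linear by blast
    note lin' = linear_sum_Basis[OF lin, of "f' x v" for v]
    show ?thesis
      using has_derivative_compose[OF f'(1)[rule_format, OF x] gx] by (subst (asm) lin')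
  qed
  moreover have "Ck_on k S (\<lambda>x. ?d x v)" for v
  proof (intro Ck_on_sum Ck_on_scaleR)
    fix b :: 'b
    show "Ck_on k S (\<lambda>x. f' x v \<bullet> b)"
      using f'(2) by (intro Ck_on_bounded_linear_compose[OF bounded_linear_inner_left]) auto
    show "Ck_on k S (\<lambda>x. g' (f x) b)"
      using Suc.prems(1)[THEN Ck_on_Suc_D] g'(2) Suc.prems(3) by (intro Suc.IH) auto
  qed
  ultimately show ?case by (auto intro!: exI[of _ ?d])
qed

lemma smooth_on_subset: "smooth_on S f \<Longrightarrow> T \<subseteq> S \<Longrightarrow> smooth_on T f"
  using Ck_on_subset unfolding smooth_on_def by blast

lemma smooth_on_cong:
  "open S \<Longrightarrow> (\<And>x. x \<in> S \<Longrightarrow> f x = g x) \<Longrightarrow> smooth_on S f \<Longrightarrow> smooth_on S g"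
  using Ck_on_cong unfolding smooth_on_def by blast

lemma smooth_on_local:
  assumes "open S" "\<And>x. x \<in> S \<Longrightarrow> \<exists>T. open T \<and> x \<in> T \<and> smooth_on T f"
  shows "smooth_on S f"
  using assms Ck_on_local unfolding smooth_on_def by metis

lemma smooth_on_bounded_linear: "bounded_linear h \<Longrightarrow> smooth_on S h"
  using Ck_on_bounded_linear unfolding smooth_on_def by blast

lemma smooth_on_bounded_linear_compose:
  "bounded_linear h \<Longrightarrow> smooth_on S f \<Longrightarrow> smooth_on S (\<lambda>x. h (f x))"
  using Ck_on_bounded_linear_compose unfolding smooth_on_def by blast

lemma smooth_on_const: "smooth_on S (\<lambda>x. c)"
  using Ck_on_const unfolding smooth_on_def by blast

lemma smooth_on_id: "smooth_on S (\<lambda>x. x)"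
  using smooth_on_bounded_linear[OF bounded_linear_ident] .

lemma smooth_on_add: "smooth_on S f \<Longrightarrow> smooth_on S g \<Longrightarrow> smooth_on S (\<lambda>x. f x + g x)"
  using Ck_on_add unfolding smooth_on_def by blast

lemma smooth_on_scaleR: "smooth_on S f \<Longrightarrow> smooth_on S g \<Longrightarrow> smooth_on S (\<lambda>x. f x *\<^sub>R g x)"
  using Ck_on_scaleR unfolding smooth_on_def by blast

lemma smooth_on_compose:
  "smooth_on S f \<Longrightarrow> smooth_on T g \<Longrightarrow> f ` S \<subseteq> T \<Longrightarrow> smooth_on S (\<lambda>x. g (f x))"
  using Ck_on_compose unfolding smooth_on_def by blast

lemma smooth_on_Pair:
  assumes "smooth_on S f" "smooth_on S g" shows "smooth_on S (\<lambda>x. (f x, g x))"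
proof -
  have "smooth_on S (\<lambda>x. (f x, 0) + (0, g x))"
    using smooth_on_bounded_linear_compose[OF
        bounded_linear_Pair[OF bounded_linear_ident bounded_linear_zero] assms(1)]
      smooth_on_bounded_linear_compose[OF
        bounded_linear_Pair[OF bounded_linear_zero bounded_linear_ident] assms(2)]
    by (rule smooth_on_add)
  then show ?thesis by simp
qed

lemma smooth_on_imp_continuous_on: "smooth_on S f \<Longrightarrow> continuous_on S f"
  unfolding smooth_on_def using Ck_on.simps(1) by blast

lemma smooth_on_imp_differentiable: "smooth_on S f \<Longrightarrow> x \<in> S \<Longrightarrow> f differentiable at x"
  unfolding smooth_on_def differentiable_def using Ck_on.simps(2)[of 0 S f] by blast

lemma smooth_on_has_derivative:
  "smooth_on S f \<Longrightarrow> x \<in> S \<Longrightarrow> (f has_derivative frechet_derivative f (at x)) (at x)"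
  using frechet_derivative_works smooth_on_imp_differentiable by blast

lemma smooth_on_frechet_derivative:
  "open S \<Longrightarrow> smooth_on S f \<Longrightarrow> smooth_on S (\<lambda>x. frechet_derivative f (at x) v)"
  unfolding smooth_on_def using Ck_on_Suc_frechet by blast

section \<open>Operator norm and Lipschitz bounds for smooth maps\<close>

lemma onorm_le_sum_Basis:
  fixes f :: "'a::euclidean_space \<Rightarrow> 'b::real_normed_vector"
  assumes "linear f" shows "onorm f \<le> (\<Sum>b\<in>Basis. norm (f b))"
proof (rule onorm_le)
  fix y
  have "norm (f y) \<le> (\<Sum>b\<in>Basis. norm ((y \<bullet> b) *\<^sub>R f b))"
    unfolding linear_sum_Basis[OF assms, of y] by (rule norm_sum)
  also have "\<dots> \<le> (\<Sum>b\<in>Basis. norm y * norm (f b))"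
    by (intro sum_mono) (auto intro: mult_right_mono Basis_le_norm)
  finally show "norm (f y) \<le> (\<Sum>b\<in>Basis. norm (f b)) * norm y"
    by (simp add: sum_distrib_left mult.commute)
qed

text \<open>Control in the finitely many basis directions bounds the operator norm. This is the form
  in which \<open>has_derivative_locally_injective\<close> asks for a continuous derivative.\<close>

lemma smooth_on_frechet_onorm_continuous:
  fixes f :: "'a::euclidean_space \<Rightarrow> 'b::euclidean_space"
  assumes S: "open S" "smooth_on S f" "a \<in> S" "e > 0"
  shows "\<exists>d>0. \<forall>x. dist a x < d \<longrightarrow>
     x \<in> S \<and> onorm (\<lambda>v. frechet_derivative f (at x) v - frechet_derivative f (at a) v) < e"
proof -
  let ?D = "\<lambda>x v. frechet_derivative f (at x) v"
  let ?h = "\<lambda>x. \<Sum>b\<in>Basis. norm (?D x b - ?D a b)"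
  have "continuous_on S ?h"
    using smooth_on_imp_continuous_on[OF smooth_on_frechet_derivative[OF S(1,2)]]
    by (auto intro!: continuous_intros)
  then have "isCont ?h a" using S continuous_on_eq_continuous_at by blast
  then have "(?h \<longlongrightarrow> ?h a) (nhds a)" 
    using tendsto_at_iff_tendsto_nhds[of ?h a] by (simp only: isCont_def)
  from order_tendstoD(2)[OF this, of e] have "\<forall>\<^sub>F x in nhds a. ?h x < e" using S(4) by simp
  moreover have "\<forall>\<^sub>F x in nhds a. x \<in> S" using S eventually_nhds_in_open by blast
  ultimately have "\<forall>\<^sub>F x in nhds a. ?h x < e \<and> x \<in> S" by eventually_elim auto
  then obtain d where d: "d > 0" "\<And>x. dist x a < d \<Longrightarrow> ?h x < e \<and> x \<in> S"
    unfolding eventually_nhds_metric by auto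
  have le: "onorm (\<lambda>v. ?D x v - ?D a v) \<le> ?h x" if "x \<in> S" for x
  proof (rule onorm_le_sum_Basis)
    have "linear (?D x)" "linear (?D a)"
      using S that by (auto intro: linear_frechet_derivative smooth_on_imp_differentiable)
    then show "linear (\<lambda>v. ?D x v - ?D a v)" by (rule linear_compose_sub)
  qed
  have "x \<in> S \<and> onorm (\<lambda>v. ?D x v - ?D a v) < e" if "dist a x < d" for x
    using d(2)[of x] le[of x] that by (simp add: dist_commute)
  with d(1) show ?thesis by blast
qed

lemma smooth_on_lipschitz:
  fixes f :: "'a::euclidean_space \<Rightarrow> 'b::euclidean_space"
  assumes S: "open S" "smooth_on S f" "K \<subseteq> S" "compact K" "convex K"
  shows "\<exists>L>0. \<forall>x\<in>K. \<forall>y\<in>K. norm (f x - f y) \<le> L * norm (x - y)"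
proof -
  let ?D = "\<lambda>x v. frechet_derivative f (at x) v"
  let ?h = "\<lambda>x. \<Sum>b\<in>Basis. norm (?D x b)"
  have "continuous_on S ?h"
    using smooth_on_imp_continuous_on[OF smooth_on_frechet_derivative[OF S(1,2)]]
    by (auto intro!: continuous_intros)
  then have "compact (?h ` K)" using S compact_continuous_image continuous_on_subset by blast
  then obtain L where "\<forall>y\<in>?h ` K. \<bar>y\<bar> \<le> L" using compact_imp_bounded bounded_real by blast
  then have L: "?h x \<le> L" if "x \<in> K" for x using that abs_le_D1 by blast
  have "norm (f x - f y) \<le> (max L 1) * norm (x - y)" if "x \<in> K" "y \<in> K" for x y
  proof (rule differentiable_bound[OF S(5) _ _ that])
    fix z assume z: "z \<in> K"
    then show "(f has_derivative ?D z) (at z within K)"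
      using S by (meson has_derivative_at_withinI smooth_on_has_derivative subsetD)
    have "onorm (?D z) \<le> ?h z"
      using z S by (intro onorm_le_sum_Basis linear_frechet_derivative)
        (auto intro: smooth_on_imp_differentiable)
    also have "\<dots> \<le> max L 1" using L[OF z] by simp
    finally show "onorm (?D z) \<le> max L 1" .
  qed
  then show ?thesis by (intro exI[of _ "max L 1"]) auto
qed

section \<open>Symmetry of mixed derivatives\<close>

lemma smooth_on_line_derivative:
  assumes "smooth_on S f" "x + s *\<^sub>R v \<in> S"
  shows "((\<lambda>s. f (x + s *\<^sub>R v)) has_vector_derivative frechet_derivative f (at (x + s *\<^sub>R v)) v) (at s)"
proof -
  have f: "(f has_derivative frechet_derivative f (at (x + s *\<^sub>R v))) (at (x + s *\<^sub>R v))"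
    using smooth_on_has_derivative[OF assms] .
  have "((\<lambda>s. x + s *\<^sub>R v) has_derivative (\<lambda>h. h *\<^sub>R v)) (at s)"
    by (auto intro!: derivative_eq_intros)
  from has_derivative_compose[OF this f] show ?thesis
    using linear_scale[OF has_derivative_linear[OF f]] by (simp add: has_vector_derivative_def)
qed

text \<open>Two applications of the mean value theorem: in direction \<open>v\<close> to the
  difference of \<open>u\<close> along two parallel sides, then in direction \<open>w\<close> to
  \<open>?D\<close>. The bound on \<open>h\<close> keeps the parallelogram inside the ball.\<close>

lemma mixed_difference_quotient:
  fixes u :: "'a::euclidean_space \<Rightarrow> real"
  assumes S: "open S" "smooth_on S u" "ball x r \<subseteq> S" and h: "h > 0" "h * (norm v + norm w) < r"
  shows "\<exists>z\<in>ball x r. u (x + h *\<^sub>R v + h *\<^sub>R w) - u (x + h *\<^sub>R v) - u (x + h *\<^sub>R w) + u x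
     = h * (h * frechet_derivative (\<lambda>z. frechet_derivative u (at z) v) (at z) w)"
proof -
  let ?D = "\<lambda>z. frechet_derivative u (at z) v"
  have D: "smooth_on S ?D" using smooth_on_frechet_derivative S by blast
  have in_S: "x + a *\<^sub>R v + b *\<^sub>R w \<in> ball x r" if "0 \<le> a" "a \<le> h" "0 \<le> b" "b \<le> h" for a b
  proof -
    have "norm (a *\<^sub>R v + b *\<^sub>R w) \<le> a * norm v + b * norm w"
      using norm_triangle_ineq[of "a *\<^sub>R v" "b *\<^sub>R w"] that by simp
    also have "\<dots> \<le> h * norm v + h * norm w" using that by (intro add_mono mult_right_mono) auto
    also have "\<dots> < r" using h(2) by (simp add: algebra_simps)
    finally show ?thesis by (simp add: mem_ball dist_norm norm_minus_commute add.assoc add.commute)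
  qed
  define p where "p s = u (x + h *\<^sub>R w + s *\<^sub>R v) - u (x + s *\<^sub>R v)" for s
  have "\<exists>\<xi>. 0 < \<xi> \<and> \<xi> < h \<and> p h - p 0 = (h - 0) * (?D (x + h *\<^sub>R w + \<xi> *\<^sub>R v) - ?D (x + \<xi> *\<^sub>R v))"
  proof (rule MVT2[OF h(1)])
    fix s assume s: "0 \<le> s" "s \<le> h"
    have "x + h *\<^sub>R w + s *\<^sub>R v \<in> S" "x + s *\<^sub>R v \<in> S"
      using in_S[OF s, of h] in_S[OF s, of 0] h S(3) by (auto simp: add_ac)
    then show "(p has_real_derivative ?D (x + h *\<^sub>R w + s *\<^sub>R v) - ?D (x + s *\<^sub>R v)) (at s)"
      unfolding p_def has_real_derivative_iff_has_vector_derivative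
      by (intro has_vector_derivative_diff smooth_on_line_derivative[OF S(2)])
  qed
  then obtain \<xi> where \<xi>: "0 < \<xi>" "\<xi> < h"
    "p h - p 0 = h * (?D (x + h *\<^sub>R w + \<xi> *\<^sub>R v) - ?D (x + \<xi> *\<^sub>R v))" by auto
  define q where "q s = ?D (x + \<xi> *\<^sub>R v + s *\<^sub>R w)" for s
  have "\<exists>\<eta>. 0 < \<eta> \<and> \<eta> < h \<and> q h - q 0 = (h - 0) * frechet_derivative ?D (at (x + \<xi> *\<^sub>R v + \<eta> *\<^sub>R w)) w"
  proof (rule MVT2[OF h(1)])
    fix s assume s: "0 \<le> s" "s \<le> h"
    have "x + \<xi> *\<^sub>R v + s *\<^sub>R w \<in> S" using in_S[of \<xi> s] s \<xi> S(3) by auto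
    then show "(q has_real_derivative frechet_derivative ?D (at (x + \<xi> *\<^sub>R v + s *\<^sub>R w)) w) (at s)"
      unfolding q_def has_real_derivative_iff_has_vector_derivative
      by (intro smooth_on_line_derivative[OF D])
  qed
  then obtain \<eta> where \<eta>: "0 < \<eta>" "\<eta> < h"
    "q h - q 0 = h * frechet_derivative ?D (at (x + \<xi> *\<^sub>R v + \<eta> *\<^sub>R w)) w" by auto
  have "x + \<xi> *\<^sub>R v + \<eta> *\<^sub>R w \<in> ball x r" using in_S \<xi> \<eta> by auto
  moreover have "p h - p 0 = h * (q h - q 0)" unfolding \<xi>(3) q_def by (simp add: add_ac)
  ultimately show ?thesis unfolding \<eta>(3) 
    by (intro bexI[of _ "x + \<xi> *\<^sub>R v + \<eta> *\<^sub>R w"]) (auto simp: p_def add_ac)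
qed

text \<open>Both sides are limits of the second difference quotient, which is symmetric in \<open>v\<close> and \<open>w\<close>.\<close>

lemma mixed_derivative_symmetric_real:
  fixes u :: "'a::euclidean_space \<Rightarrow> real"
  assumes S: "open S" "smooth_on S u" "x \<in> S"
  shows "frechet_derivative (\<lambda>z. frechet_derivative u (at z) v) (at x) w =
    frechet_derivative (\<lambda>z. frechet_derivative u (at z) w) (at x) v"
proof -
  define F where "F v w z = frechet_derivative (\<lambda>z. frechet_derivative u (at z) v) (at z) w" for v w z
  have cont: "isCont (F v w) x" for v w
  proof -
    have "smooth_on S (F v w)"
      unfolding F_def by (intro smooth_on_frechet_derivative[OF S(1)] S(2))
    then show ?thesis
      using S(1,3) continuous_on_eq_continuous_at smooth_on_imp_continuous_on by blast
  qed
  have "dist (F v w x) (F w v x) < e" if "e > 0" for e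
  proof -
    obtain r0 where r0: "r0 > 0" "ball x r0 \<subseteq> S" using S openE by blast
    obtain r1 where r1: "r1 > 0" "\<And>z. dist z x < r1 \<Longrightarrow> dist (F v w z) (F v w x) < e/2"
      using cont[of v w] \<open>e > 0\<close> unfolding continuous_at_eps_delta by (metis half_gt_zero)
    obtain r2 where r2: "r2 > 0" "\<And>z. dist z x < r2 \<Longrightarrow> dist (F w v z) (F w v x) < e/2"
      using cont[of w v] \<open>e > 0\<close> unfolding continuous_at_eps_delta by (metis half_gt_zero)
    define r where "r = min r0 (min r1 r2)"
    have r: "r > 0" "ball x r \<subseteq> S" using r0 r1 r2 by (auto simp: r_def)
    define h where "h = r / (norm v + norm w + 1)"
    have n: "norm v + norm w + 1 > 0" by (smt (verit) norm_ge_zero)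
    then have h0: "h > 0" using r by (simp add: h_def)
    have "h * (norm v + norm w) < h * (norm v + norm w + 1)" using h0 by simp
    also have "\<dots> = r" using n by (simp add: h_def)
    finally have h: "h * (norm v + norm w) < r" "h * (norm w + norm v) < r" by (simp_all add: add.commute)
    obtain z where z: "z \<in> ball x r" "u (x + h *\<^sub>R v + h *\<^sub>R w) - u (x + h *\<^sub>R v) - u (x + h *\<^sub>R w) + u x
     = h * (h * F v w z)"
      using mixed_difference_quotient[OF S(1,2) r(2) h0 h(1)] unfolding F_def by blast
    obtain z' where z': "z' \<in> ball x r" "u (x + h *\<^sub>R w + h *\<^sub>R v) - u (x + h *\<^sub>R w) - u (x + h *\<^sub>R v) + u x
     = h * (h * F w v z')"
      using mixed_difference_quotient[OF S(1,2) r(2) h0 h(2)] unfolding F_def by blast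
    have "x + h *\<^sub>R v + h *\<^sub>R w = x + h *\<^sub>R w + h *\<^sub>R v" by simp
    then have "h * (h * F v w z) = h * (h * F w v z')" using z(2) z'(2) by (simp only: diff_diff_eq add.commute)
    then have "F v w z = F w v z'" using h0 by simp
    moreover have "dist (F v w z) (F v w x) < e/2" "dist (F w v z') (F w v x) < e/2"
      using r1(2)[of z] r2(2)[of z'] z(1) z'(1) by (auto simp: r_def mem_ball dist_commute)
    ultimately show ?thesis by (metis dist_commute dist_triangle_half_l)
  qed
  from this[of "dist (F v w x) (F w v x)"] have "F v w x = F w v x"
    by (metis less_irrefl zero_less_dist_iff)
  then show ?thesis by (simp add: F_def)
qed

lemma mixed_derivative_symmetric:
  fixes u :: "'a::euclidean_space \<Rightarrow> 'b::euclidean_space"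
  assumes S: "open S" "smooth_on S u" "x \<in> S"
  shows "frechet_derivative (\<lambda>z. frechet_derivative u (at z) v) (at x) w =
    frechet_derivative (\<lambda>z. frechet_derivative u (at z) w) (at x) v"
proof (rule euclidean_eqI)
  fix b :: 'b
  have *: "frechet_derivative (\<lambda>z. g z \<bullet> b) (at z) = (\<lambda>v. frechet_derivative g (at z) v \<bullet> b)"
    if "smooth_on S g" "z \<in> S" for g :: "'a \<Rightarrow> 'b" and z
    by (rule frechet_derivative_at[symmetric])
      (intro bounded_linear.has_derivative[OF bounded_linear_inner_left] smooth_on_has_derivative[OF that])
  have ub: "smooth_on S (\<lambda>z. u z \<bullet> b)"
    using S by (intro smooth_on_bounded_linear_compose[OF bounded_linear_inner_left])
  have **: "frechet_derivative (\<lambda>z. frechet_derivative (\<lambda>z. u z \<bullet> b) (at z) v) (at x) w =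
    frechet_derivative (\<lambda>z. frechet_derivative u (at z) v) (at x) w \<bullet> b" for v w
  proof -
    have "frechet_derivative (\<lambda>z. frechet_derivative (\<lambda>z. u z \<bullet> b) (at z) v) (at x) =
      frechet_derivative (\<lambda>z. frechet_derivative u (at z) v \<bullet> b) (at x)"
      by (rule frechet_derivative_transform_within_open[OF _ S(1,3)])
        (use * S ub in \<open>auto intro: smooth_on_imp_differentiable smooth_on_frechet_derivative\<close>)
    then show ?thesis using *[OF smooth_on_frechet_derivative[OF S(1,2)] S(3)] by simp
  qed
  show "frechet_derivative (\<lambda>z. frechet_derivative u (at z) v) (at x) w \<bullet> b =
    frechet_derivative (\<lambda>z. frechet_derivative u (at z) w) (at x) v \<bullet> b"
    using mixed_derivative_symmetric_real[OF S(1) ub S(3), of v w] unfolding ** .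
qed

section \<open>Integral curves\<close>

text \<open>Bootstrapping: the derivative \<open>F (c t)\<close> is as smooth as \<open>c\<close>,
  so each degree of smoothness yields the next.\<close>

lemma integral_curve_smooth:
  fixes F :: "'a::euclidean_space \<Rightarrow> 'a"
  assumes F: "smooth_on S F"
    and c: "\<And>t. t \<in> I \<Longrightarrow> c t \<in> S" "\<And>t. t \<in> I \<Longrightarrow> (c has_vector_derivative F (c t)) (at t)"
  shows "smooth_on I c"
proof -
  have "Ck_on k I c" for k
  proof (induction k)
    case 0
    then show ?case using c(2)
      by (auto intro!: continuous_at_imp_continuous_on has_vector_derivative_continuous)
  next
    case (Suc k)
    have "Ck_on k I (\<lambda>t. F (c t))"
      using F c(1) by (intro Ck_on_compose[OF Suc, of S]) (auto simp: smooth_on_def)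
    then have "Ck_on k I (\<lambda>t. v *\<^sub>R F (c t))" for v
      by (rule Ck_on_bounded_linear_compose[OF bounded_linear_scaleR_right])
    then show ?case using c(2)
      by (auto simp: has_vector_derivative_def intro!: exI[of _ "\<lambda>t v. v *\<^sub>R F (c t)"])
  qed
  then show ?thesis by (simp add: smooth_on_def)
qed

text \<open>Picard iteration as a contraction on bounded continuous curves over the whole line. Time
  is clamped to \<open>[-d, d]\<close> to keep the iterates bounded; integrating from
  \<open>-d\<close> and subtracting \<open>J y 0\<close> lets one formula cover both signs of
  time.\<close>

lemma integral_curve_exists_lipschitz:
  fixes G :: "'a::euclidean_space \<Rightarrow> 'a"
  assumes L: "L > 0" "\<And>x y. norm (G x - G y) \<le> L * norm (x - y)"
    and M: "M > 0" "\<And>x. norm (G x) \<le> M" and d: "d > 0" "6 * d * L \<le> 1"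
  shows "\<exists>c. c 0 = x0 \<and> (\<forall>t. \<bar>t\<bar> < d \<longrightarrow> (c has_vector_derivative G (c t)) (at t)) \<and>
    (\<forall>t. norm (c t - x0) \<le> 3 * d * M)"
proof -
  have contG: "continuous_on S G" for S
  proof -
    have "L-lipschitz_on UNIV G" using L by (auto simp: lipschitz_on_def dist_norm)
    then show ?thesis using lipschitz_on_continuous_on continuous_on_subset by blast
  qed
  define cl where "cl t = max (-d) (min d t)" for t :: real
  have cl: "cl t \<in> {-d..d}" "continuous_on UNIV cl" for t
    using d unfolding cl_def by (auto intro!: continuous_intros)
  define J where "J y u = integral {-d..u} (\<lambda>s. G (y s))" for y :: "real \<Rightarrow> 'a" and u
  have contGy: "continuous_on {-d..u} (\<lambda>s. G (y s))" if "continuous_on UNIV y" for y :: "real \<Rightarrow> 'a" and u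
    using that contG[of UNIV] continuous_on_compose2 continuous_on_subset by (metis subset_UNIV)
  have J_deriv: "(J y has_vector_derivative G (y u)) (at u within {-d..d})"
    if "continuous_on UNIV y" "u \<in> {-d..d}" for y u
    unfolding J_def by (intro integral_has_vector_derivative contGy that)
  define P where "P y t = x0 + (J y (cl t) - J y 0)" for y t
  have J_bound: "norm (J y u) \<le> M * (2 * d)" if "continuous_on UNIV y" "u \<in> {-d..d}" for y u
  proof -
    have "norm (J y u) \<le> M * (u - (-d))" unfolding J_def
      by (rule integral_bound) (use that M contGy in auto)
    also have "\<dots> \<le> M * (2 * d)" using that M by (intro mult_left_mono) auto
    finally show ?thesis .
  qed
  have J_diff: "norm (J y u - J z u) \<le> (L * B) * (u + d)"
    if "continuous_on UNIV y" "continuous_on UNIV z" "u \<in> {-d..d}" "\<And>s. norm (y s - z s) \<le> B" for y z u B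
  proof -
    have "J y u - J z u = integral {-d..u} (\<lambda>s. G (y s) - G (z s))"
      unfolding J_def by (rule integral_diff[symmetric]) (use that contGy in \<open>auto intro: integrable_continuous_real\<close>)
    moreover have "norm (G (y s) - G (z s)) \<le> L * B" for s
      using L that(4) by (meson mult_left_mono less_imp_le order_trans)
    ultimately show ?thesis
      using integral_bound[of "-d" u "\<lambda>s. G (y s) - G (z s)" "L * B"] that
        continuous_on_diff[OF contGy[OF that(1)] contGy[OF that(2)]] by simp
  qed
  have contP: "continuous_on UNIV (P y)" if "continuous_on UNIV y" for y
  proof -
    have "continuous_on {-d..d} (J y)"
      using J_deriv[OF that] has_vector_derivative_continuous
      by (fastforce simp: continuous_on_eq_continuous_within)
    then have "continuous_on UNIV (\<lambda>t. J y (cl t))"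
      using cl by (intro continuous_on_compose2[of "{-d..d}" "J y" UNIV cl]) auto
    then show ?thesis unfolding P_def by (intro continuous_intros)
  qed
  have zero: "0 \<in> {-d..d}" using d by simp
  have "P y \<in> bcontfun" if "continuous_on UNIV y" for y
  proof (rule bcontfun_normI[OF contP[OF that]])
    fix t
    show "norm (P y t) \<le> norm x0 + (M * (2 * d) + M * (2 * d))"
      unfolding P_def
      by (intro order_trans[OF norm_triangle_ineq] add_left_mono order_trans[OF norm_triangle_ineq4] add_mono
          J_bound that cl zero)
  qed
  then have app: "apply_bcontfun (Bcontfun (P (apply_bcontfun y))) = P (apply_bcontfun y)" for y
    by (intro Bcontfun_inverse) simp
  have "\<exists>!y. Bcontfun (P (apply_bcontfun y)) = y"
  proof (rule banach_fix_type[of "1/2"]; (intro allI)?)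
    fix y z :: "real \<Rightarrow>\<^sub>C 'a"
    show "dist (Bcontfun (P (apply_bcontfun y))) (Bcontfun (P (apply_bcontfun z))) \<le> 1/2 * dist y z"
    proof (rule dist_bound, unfold app)
      fix t
      have n: "norm (apply_bcontfun y s - apply_bcontfun z s) \<le> dist y z" for s
        using dist_bounded[of y s z] by (simp add: dist_norm)
      have B0: "L * dist y z \<ge> 0" using L by simp
      have "norm (P y t - P z t) \<le> norm (J y (cl t) - J z (cl t)) + norm (J y 0 - J z 0)"
        using norm_triangle_ineq4[of "J y (cl t) - J z (cl t)" "J y 0 - J z 0"]
        by (simp add: P_def algebra_simps)
      also have "\<dots> \<le> (L * dist y z) * (cl t + d) + (L * dist y z) * (0 + d)"
        using n cl(1) zero by (intro add_mono J_diff) auto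
      also have "\<dots> \<le> (L * dist y z) * (2 * d) + (L * dist y z) * d"
        using cl(1)[of t] B0 by (intro add_mono mult_left_mono) auto
      \<comment> \<open>The integrals up to \<open>cl t\<close> and up to 0 have lengths at most
        \<open>2 * d\<close> and \<open>d\<close>; hence the total factor \<open>3 * d * L\<close>,
        which is at most 1/2.\<close>
      also have "\<dots> = (6 * d * L) * (1/2 * dist y z)" by (simp add: algebra_simps)
      also have "\<dots> \<le> 1 * (1/2 * dist y z)" using d by (intro mult_right_mono) auto
      finally show "dist (P y t) (P z t) \<le> 1/2 * dist y z" by (simp add: dist_norm)
    qed
  qed auto
  then obtain y where "Bcontfun (P (apply_bcontfun y)) = y" by blast
  then have y: "apply_bcontfun y = P (apply_bcontfun y)" using app by metis
  define c where "c = apply_bcontfun y"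
  have c: "c = P c" "continuous_on UNIV c" using y by (auto simp: c_def)
  have c0: "c 0 = x0" using d by (subst c(1)) (simp add: P_def cl_def)
  have "(c has_vector_derivative G (c t)) (at t)" if t: "\<bar>t\<bar> < d" for t
  proof -
    have "(J c has_vector_derivative G (c t)) (at t)"
    proof -
      have "-d < t" "t < d" using t by linarith+
      then show ?thesis using J_deriv[OF c(2), of t] at_within_Icc_at[of "-d" t d] by simp
    qed
    then have "((\<lambda>t. x0 + (J c t - J c 0)) has_vector_derivative G (c t)) (at t)"
      by (auto intro!: derivative_eq_intros)
    then show ?thesis
    proof (rule has_vector_derivative_transform_within_open[of _ _ _ "{-d<..<d}"])
      fix s assume "s \<in> {-d<..<d}"
      then have "cl s = s" by (simp add: cl_def)
      then show "x0 + (J c s - J c 0) = c s" by (subst c(1)) (simp add: P_def)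
    qed (use t in auto)
  qed
  moreover have "norm (c t - x0) \<le> 3 * d * M" for t
  proof -
    have "norm (J c 0) \<le> M * (0 - (-d))" unfolding J_def
      by (rule integral_bound) (use M contGy c d in auto)
    moreover have "norm (c t - x0) \<le> norm (J c (cl t)) + norm (J c 0)"
      by (subst c(1)) (simp add: P_def norm_triangle_ineq4)
    ultimately show ?thesis using J_bound[OF c(2) cl(1)[of t]] by (simp add: algebra_simps)
  qed
  ultimately show ?thesis using c0 by blast
qed

text \<open>The field is known to be Lipschitz only on a compact ball, so it is extended by
  composition with the nearest-point projection \<open>cp\<close>, which does not increase
  distances. The choice of \<open>d\<close> keeps the curve in the ball, where the extension agrees
  with \<open>F\<close>.\<close>

lemma integral_curve_exists:
  fixes F :: "'a::euclidean_space \<Rightarrow> 'a"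
  assumes S: "open S" "smooth_on S F" "x0 \<in> S"
  obtains c \<epsilon> where "\<epsilon> > 0" "c 0 = x0" "\<And>t. \<bar>t\<bar> < \<epsilon> \<Longrightarrow> c t \<in> S"
    "\<And>t. \<bar>t\<bar> < \<epsilon> \<Longrightarrow> (c has_vector_derivative F (c t)) (at t)"
proof -
  obtain r where r: "r > 0" "cball x0 r \<subseteq> S" using S open_contains_cball by blast
  let ?K = "cball x0 r"
  obtain L where L: "L > 0" "\<And>x y. x \<in> ?K \<Longrightarrow> y \<in> ?K \<Longrightarrow> norm (F x - F y) \<le> L * norm (x - y)"
    using smooth_on_lipschitz[OF S(1,2) r(2)] by auto
  have "compact (F ` ?K)"
    by (rule compact_continuous_image[OF continuous_on_subset[OF smooth_on_imp_continuous_on[OF S(2)] r(2)] compact_cball])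
  then obtain M where M: "M > 0" "\<And>x. x \<in> ?K \<Longrightarrow> norm (F x) \<le> M"
    using compact_imp_bounded[of "F ` ?K"] unfolding bounded_pos by blast
  define cp where "cp = closest_point ?K"
  have K: "closed ?K" "?K \<noteq> {}" "convex ?K" using r by auto
  have cp: "cp x \<in> ?K" "x \<in> ?K \<Longrightarrow> cp x = x" "norm (cp x - cp y) \<le> norm (x - y)" for x y
    using closest_point_in_set[OF K(1,2), of x] closest_point_self[of x ?K]
      closest_point_lipschitz[OF K(3,1,2), of x y] unfolding cp_def by (auto simp: dist_norm)
  define d where "d = min (r / (3 * M)) (1 / (6 * L))"
  have d: "d > 0" "6 * d * L \<le> 1" "3 * d * M \<le> r"
    using r L M by (auto simp: d_def min_def field_simps)
  have "\<exists>c. c 0 = x0 \<and> (\<forall>t. \<bar>t\<bar> < d \<longrightarrow> (c has_vector_derivative F (cp (c t))) (at t)) \<and>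
    (\<forall>t. norm (c t - x0) \<le> 3 * d * M)"
  proof (rule integral_curve_exists_lipschitz[OF L(1) _ M(1) _ d(1,2)])
    show "norm (F (cp x) - F (cp y)) \<le> L * norm (x - y)" for x y
      using L(2)[OF cp(1) cp(1)] cp(3) L(1) by (meson mult_left_mono less_imp_le order_trans)
    show "norm (F (cp x)) \<le> M" for x using M(2) cp(1) by blast
  qed
  then obtain c where c: "c 0 = x0" "\<And>t. \<bar>t\<bar> < d \<Longrightarrow> (c has_vector_derivative F (cp (c t))) (at t)"
    "\<And>t. norm (c t - x0) \<le> 3 * d * M" by blast
  have "c t \<in> ?K" for t using c(3)[of t] d(3) by (simp add: dist_norm norm_minus_commute)
  then have "(c has_vector_derivative F (c t)) (at t)" "c t \<in> S" if "\<bar>t\<bar> < d" for t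
    using c(2)[OF that] cp(2) r(2) by auto
  with d(1) c(1) that show thesis by blast
qed

section \<open>Cocompact subgroups of a semidirect product\<close>

lemma separated_bounded_finite:
  fixes S :: "'a::euclidean_space set"
  assumes "d > 0" "\<And>x y. x \<in> S \<Longrightarrow> y \<in> S \<Longrightarrow> dist y x < d \<Longrightarrow> y = x" "bounded S"
  shows "finite S"
  using uniform_discrete_finite_iff[of S] uniformI1[of d S] assms by (metis dist_commute)

text \<open>Dividing an approximation of \<open>k *\<^sub>R v\<close> by a large \<open>k\<close>
  makes the error arbitrarily small, and subspaces are closed.\<close>

lemma subspace_subset_if_near:
  fixes V W :: "'a::euclidean_space set"
  assumes "subspace V" "subspace W" "\<And>v. v \<in> V \<Longrightarrow> \<exists>w\<in>W. norm (v - w) \<le> C"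
  shows "V \<subseteq> W"
proof
  fix v assume v: "v \<in> V"
  have "\<exists>y\<in>W. dist y v < e" if "e > 0" for e
  proof -
    obtain r :: nat where r: "C < real r * e" using \<open>e > 0\<close> reals_Archimedean3 by blast
    define k where "k = real r + 1"
    have k: "k > 0" "C < k * e" using r \<open>e > 0\<close> by (auto simp: k_def algebra_simps)
    obtain w where w: "w \<in> W" "norm (k *\<^sub>R v - w) \<le> C"
      using assms(3)[of "k *\<^sub>R v"] v assms(1) subspace_scale by blast
    have "k * norm (v - (1/k) *\<^sub>R w) = norm (k *\<^sub>R (v - (1/k) *\<^sub>R w))" using k by simp
    also have "\<dots> = norm (k *\<^sub>R v - w)" using k by (simp add: scaleR_diff_right)
    finally have "norm (v - (1/k) *\<^sub>R w) < e" using w k by (metis mult_less_cancel_left_pos order_le_less_trans)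
    then show ?thesis using w assms(2) subspace_scale by (metis dist_commute dist_norm)
  qed
  then have "v \<in> closure W" by (simp add: closure_approachable)
  then show "v \<in> W" using closed_subspace[OF assms(2)] closure_closed by blast
qed

lemma linear_bounded_imp_zero:
  fixes L :: "'a::euclidean_space \<Rightarrow> 'b::euclidean_space"
  assumes "linear L" "subspace V" "\<And>v. v \<in> V \<Longrightarrow> norm (L v) \<le> C" "v \<in> V"
  shows "L v = 0"
proof -
  have "L ` V \<subseteq> {0}"
    using assms by (intro subspace_subset_if_near[where C=C])
      (auto intro: linear_subspace_image subspace_single_0)
  then show ?thesis using assms(4) by auto
qed

text \<open>Pigeonhole: the multiples of \<open>c\<close>, reduced to fractional coefficients in \<open>a\<close> and \<open>b\<close>, stay in a
  finite set.\<close>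

lemma lattice_relation_rational:
  fixes a b c :: "'a::euclidean_space"
  assumes fin: "\<And>R. finite {x \<in> L. norm x \<le> R}"
    and mem: "\<And>(j::int) k l. of_int j *\<^sub>R a + of_int k *\<^sub>R b + of_int l *\<^sub>R c \<in> L"
    and c: "c = \<alpha> *\<^sub>R a + \<beta> *\<^sub>R b" and a: "a \<notin> span {b}"
  shows "\<exists>(m::int) (k::int). m \<noteq> 0 \<and> of_int m * \<alpha> = of_int k"
proof -
  define g where "g j = frac (real j * \<alpha>) *\<^sub>R a + frac (real j * \<beta>) *\<^sub>R b" for j :: nat
  have "g j \<in> {x \<in> L. norm x \<le> norm a + norm b}" for j
  proof -
    have "g j = of_int (- \<lfloor>real j * \<alpha>\<rfloor>) *\<^sub>R a + of_int (- \<lfloor>real j * \<beta>\<rfloor>) *\<^sub>R b + of_int (int j) *\<^sub>R c"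
      by (simp add: g_def frac_def c algebra_simps)
    then have "g j \<in> L" using mem by metis
    moreover have "norm (g j) \<le> \<bar>frac (real j * \<alpha>)\<bar> * norm a + \<bar>frac (real j * \<beta>)\<bar> * norm b"
      unfolding g_def by (metis norm_scaleR norm_triangle_ineq)
    moreover have "\<bar>frac (real j * \<alpha>)\<bar> * norm a \<le> norm a" "\<bar>frac (real j * \<beta>)\<bar> * norm b \<le> norm b"
      by (intro mult_left_le_one_le; simp add: frac_lt_1 less_imp_le)+
    ultimately show ?thesis by simp
  qed
  then have "finite (range g)" by (intro finite_subset[OF _ fin[of "norm a + norm b"]]) blast
  then obtain i j where ij: "i \<noteq> j" "g i = g j"
    by (meson finite_imageD infinite_UNIV_nat injI)
  have "(frac (real i * \<alpha>) - frac (real j * \<alpha>)) *\<^sub>R a = (frac (real j * \<beta>) - frac (real i * \<beta>)) *\<^sub>R b"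
    using ij(2) by (simp add: g_def algebra_simps)
  then have *: "(frac (real i * \<alpha>) - frac (real j * \<alpha>)) *\<^sub>R a \<in> span {b}"
    by (simp add: span_base span_scale)
  have "frac (real i * \<alpha>) - frac (real j * \<alpha>) = 0"
  proof (rule ccontr)
    assume n0: "frac (real i * \<alpha>) - frac (real j * \<alpha>) \<noteq> 0"
    then have "a \<in> span {b}" using span_scale[OF *, of "1 / (frac (real i * \<alpha>) - frac (real j * \<alpha>))"] by simp
    with a show False ..
  qed
  then have "of_int (int i - int j) * \<alpha> = of_int (\<lfloor>real i * \<alpha>\<rfloor> - \<lfloor>real j * \<alpha>\<rfloor>)"
    by (simp add: frac_def algebra_simps)
  then show ?thesis using ij(1) by (metis eq_iff_diff_eq_0 of_nat_eq_iff)
qed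

section \<open>Unipotent one-parameter groups of linear maps\<close>

locale nilpotent_flow =
  fixes T :: "'e::euclidean_space \<Rightarrow> 'e" and N :: nat and E :: "real \<Rightarrow> 'e \<Rightarrow> 'e"
  assumes linear_T: "linear T"
    and T_nil: "(T ^^ N) v = 0"
    and E_eq: "E t v = (\<Sum>k<N. (t ^ k / fact k) *\<^sub>R (T ^^ k) v)"
    and E_add: "E (s + t) v = E s (E t v)"
begin

lemma linear_T_pow: "linear (T ^^ k)"
proof (induction k)
  case 0 then show ?case using linear_id by (simp add: id_def)
next
  case (Suc k) then show ?case using linear_compose[OF Suc linear_T] by (simp only: funpow.simps)
qed

lemma T_pow_split: "i \<le> k \<Longrightarrow> (T ^^ k) v = (T ^^ (k - i)) ((T ^^ i) v)"
  using funpow_add[of "k - i" i T] by (metis comp_apply le_add_diff_inverse2)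

lemma T_pow_ge: "k \<ge> N \<Longrightarrow> (T ^^ k) v = 0"
proof -
  assume "k \<ge> N"
  then have "(T ^^ k) v = (T ^^ (k - N)) ((T ^^ N) v)" by (rule T_pow_split)
  then show ?thesis using T_nil linear_0[OF linear_T_pow] by simp
qed

lemma E_ge: "M \<ge> N \<Longrightarrow> E t v = (\<Sum>k<M. (t ^ k / fact k) *\<^sub>R (T ^^ k) v)"
  unfolding E_eq by (rule sum.mono_neutral_left) (auto simp: T_pow_ge)

lemma linear_E: "linear (E t)"
proof -
  have "E t = (\<lambda>v. \<Sum>k<N. (t ^ k / fact k) *\<^sub>R (T ^^ k) v)" using E_eq by blast
  then show ?thesis
    by (auto intro!: linear_compose_sum linear_compose_scale_right linear_T_pow)
qed

lemmas E_simps = linear_add[OF linear_E] linear_diff[OF linear_E] linear_neg[OF linear_E]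
  linear_0[OF linear_E] linear_scale[OF linear_E]
lemmas T_simps = linear_add[OF linear_T] linear_diff[OF linear_T] linear_neg[OF linear_T]
  linear_0[OF linear_T] linear_scale[OF linear_T]

lemma E_0: "E 0 v = v"
proof -
  have "E 0 v = (\<Sum>k<Suc N. (0 ^ k / fact k) *\<^sub>R (T ^^ k) v)" by (rule E_ge) simp
  also have "\<dots> = v" by (subst sum.lessThan_Suc_shift) simp
  finally show ?thesis .
qed

lemma E_E_minus: "E (-t) (E t v) = v" "E t (E (-t) v) = v"
  using E_add[of "-t" t v] E_add[of t "-t" v] E_0 by auto

lemma T_E: "T (E t v) = E t (T v)"
  unfolding E_eq by (simp add: linear_sum[OF linear_T] T_simps funpow_swap1)

lemma continuous_E: "continuous_on S (\<lambda>t. E t v)"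
  unfolding E_eq by (intro continuous_intros)  auto

lemma T_pow_E: "(T ^^ j) (E t v) = (\<Sum>k<N. (t ^ k / fact k) *\<^sub>R (T ^^ (j + k)) v)"
  unfolding E_eq by (simp add: linear_sum[OF linear_T_pow[of j]] linear_scale[OF linear_T_pow[of j]] funpow_add)

lemma E_if_T_square_zero:
  assumes "T (T v) = 0" shows "E t v = v + t *\<^sub>R T v"
proof -
  have "(T ^^ k) v = 0" if "k \<ge> 2" for k
  proof -
    have "(T ^^ k) v = (T ^^ (k - 2)) ((T ^^ 2) v)"
      using that by (rule T_pow_split)
    then show ?thesis using assms linear_0[OF linear_T_pow] by (simp add: numeral_2_eq_2)
  qed
  note z = this
  have "E t v = (\<Sum>k<N+2. (t ^ k / fact k) *\<^sub>R (T ^^ k) v)" by (rule E_ge) simp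
  also have "\<dots> = (\<Sum>k<2. (t ^ k / fact k) *\<^sub>R (T ^^ k) v)"
    by (rule sum.mono_neutral_right) (auto simp: z)
  finally show ?thesis by (simp add: numeral_2_eq_2)
qed

text \<open>Let \<open>m\<close> be the least exponent with \<open>(T ^^ m) v = 0\<close>. Applying
  \<open>T ^^ (m - 2)\<close> to \<open>E t v = v\<close> cuts the exponential series off after its
  linear term and leaves \<open>t *\<^sub>R (T ^^ (m - 1)) v = 0\<close>, against
  minimality.\<close>

lemma E_fix_imp:
  assumes "E t v = v" "t \<noteq> 0" shows "T v = 0"
proof (rule ccontr)
  assume Tv: "T v \<noteq> 0"
  define m where "m = (LEAST m. (T ^^ m) v = 0)"
  have m: "(T ^^ m) v = 0" unfolding m_def using T_nil by (rule LeastI)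
  have "m \<noteq> 0" using m Tv linear_0[OF linear_T] by (metis funpow_0)
  moreover have "m \<noteq> 1" using m Tv by auto
  ultimately obtain j where j: "m = j + 2" by (metis One_nat_def add_2_eq_Suc' not0_implies_Suc)
  have nz: "(T ^^ (j+1)) v \<noteq> 0" using not_less_Least[of "j+1" "\<lambda>m. (T ^^ m) v = 0"] j m_def by simp
  have z: "(T ^^ (j + k)) v = 0" if "k \<ge> 2" for k
  proof -
    have "(T ^^ (j+k)) v = (T ^^ (k - 2)) ((T ^^ m) v)"
      using that j T_pow_split[of m "j + k" v] by (simp del: funpow.simps)
    then show ?thesis using m linear_0[OF linear_T_pow] by simp
  qed
  have "(T ^^ j) (E t v) = (\<Sum>k<N. (t ^ k / fact k) *\<^sub>R (T ^^ (j + k)) v)" by (rule T_pow_E)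
  also have "\<dots> = (\<Sum>k<N+2. (t ^ k / fact k) *\<^sub>R (T ^^ (j + k)) v)"
    by (rule sum.mono_neutral_left) (auto simp: T_pow_ge)
  also have "\<dots> = (\<Sum>k<2. (t ^ k / fact k) *\<^sub>R (T ^^ (j + k)) v)"
    by (rule sum.mono_neutral_right) (auto simp: z)
  also have "\<dots> = (T ^^ j) v + t *\<^sub>R (T ^^ (j+1)) v" by (simp add: numeral_2_eq_2)
  finally have "t *\<^sub>R (T ^^ (j+1)) v = 0" using assms(1) by simp
  with nz assms(2) show False by simp
qed

end

section \<open>Cocompact subgroups meeting V in a discrete group\<close>

text \<open>\<open>(t, v)\<close> stands for \<open>exp(tn) exp(v)\<close>; moving \<open>exp(v)\<close> past \<open>exp(sn)\<close> turns \<open>v\<close> into \<open>E (-s) v\<close>.\<close>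

locale flow_lattice = nilpotent_flow +
  fixes V :: "'a::euclidean_space set" and H :: "(real \<times> 'a) set"
  assumes V: "subspace V"
    and T_V: "v \<in> V \<Longrightarrow> T v \<in> V"
    and H_V: "(t, v) \<in> H \<Longrightarrow> v \<in> V"
    and H_mult: "(t, v) \<in> H \<Longrightarrow> (s, w) \<in> H \<Longrightarrow> (t + s, E (-s) v + w) \<in> H"
    and H_inv: "(t, v) \<in> H \<Longrightarrow> (- t, - E t v) \<in> H"
    and H_sep: "\<exists>d>0. \<forall>v. (0, v) \<in> H \<longrightarrow> norm v < d \<longrightarrow> v = 0"
    and H_cocompact: "\<exists>C. \<forall>v\<in>V. \<exists>(s, w)\<in>H. \<bar>s\<bar> \<le> C \<and> norm (v - w) \<le> C"
begin

abbreviation "Lam \<equiv> {v. (0, v) \<in> H}"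

text \<open>This is the inverse of \<open>(s, w)\<close> times \<open>(t, v)\<close>. For
  \<open>t = s\<close> it lies over 0, which is how points of \<open>Lam\<close> are produced
  below.\<close>

lemma H_diff:
  assumes "(t, v) \<in> H" "(s, w) \<in> H" shows "(t - s, v - E (s - t) w) \<in> H"
  using H_mult[OF H_inv[OF assms(2)] assms(1)] E_add[of "-t" s w] by (simp add: E_simps algebra_simps)

lemma Lam_0: "0 \<in> Lam"
proof -
  obtain s w where "(s, w) \<in> H" using H_cocompact subspace_0[OF V] by blast
  from H_diff[OF this this] show ?thesis by (simp add: E_0)
qed

lemma Lam_add: "v \<in> Lam \<Longrightarrow> w \<in> Lam \<Longrightarrow> v + w \<in> Lam"
  using H_mult[of 0 v 0 w] by (simp add: E_0)

lemma Lam_minus: "v \<in> Lam \<Longrightarrow> - v \<in> Lam"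
  using H_inv[of 0 v] by (simp add: E_0)

lemma Lam_diff: "v \<in> Lam \<Longrightarrow> w \<in> Lam \<Longrightarrow> v - w \<in> Lam"
  using Lam_add Lam_minus by (metis diff_conv_add_uminus)

lemma Lam_scale_int: "v \<in> Lam \<Longrightarrow> of_int k *\<^sub>R v \<in> Lam"
proof (induction k rule: int_induct[of _ 0])
  case base then show ?case using Lam_0 by simp
next
  case (step1 i) then show ?case using Lam_add[of "of_int i *\<^sub>R v" v] by (simp add: algebra_simps)
next
  case (step2 i) then show ?case using Lam_diff[of "of_int i *\<^sub>R v" v] by (simp add: algebra_simps)
qed

lemma Lam_finite: "finite {v \<in> Lam. norm v \<le> R}"
proof -
  obtain d where d: "d > 0" "\<And>v. (0, v) \<in> H \<Longrightarrow> norm v < d \<Longrightarrow> v = 0" using H_sep by blast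
  show ?thesis
  proof (rule separated_bounded_finite[OF d(1)])
    show "bounded {v \<in> Lam. norm v \<le> R}" by (auto simp: bounded_iff)
  next
    fix x y assume "x \<in> {v \<in> Lam. norm v \<le> R}" "y \<in> {v \<in> Lam. norm v \<le> R}" "dist y x < d"
    then have "y - x = 0" using d(2)[of "y - x"] Lam_diff[of y x] by (simp add: dist_norm)
    then show "y = x" by simp
  qed
qed

text \<open>Only finitely many first coordinates occur in \<open>[-C, C]\<close>. Dividing an
  approximation of \<open>v\<close> by a fixed element over the same coordinate gives a point of
  \<open>Lam\<close> at bounded distance from \<open>v\<close>.\<close>

lemma Lam_spans_if_discrete_projection:
  assumes "d > 0" "\<And>t v. (t, v) \<in> H \<Longrightarrow> \<bar>t\<bar> < d \<Longrightarrow> t = 0"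
  shows "V \<subseteq> span Lam"
proof -
  obtain C where C: "\<And>v. v \<in> V \<Longrightarrow> \<exists>(s, w)\<in>H. \<bar>s\<bar> \<le> C \<and> norm (v - w) \<le> C" using H_cocompact by blast
  define P where "P = {t. \<bar>t\<bar> \<le> C \<and> (\<exists>v. (t, v) \<in> H)}"
  have "finite P"
  proof (rule separated_bounded_finite[OF assms(1)])
    show "bounded P" by (auto simp: bounded_iff P_def)
    fix x y assume "x \<in> P" "y \<in> P" "dist y x < d"
    then show "y = x" using assms(2)[OF H_diff] by (fastforce simp: P_def dist_real_def)
  qed
  have "\<forall>t\<in>P. \<exists>v. (t, v) \<in> H" by (auto simp: P_def)
  then obtain f where f: "\<And>t. t \<in> P \<Longrightarrow> (t, f t) \<in> H" by metis
  obtain B where B: "\<And>t. t \<in> P \<Longrightarrow> norm (f t) \<le> B"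
    using finite_imp_bounded[OF finite_imageI[OF \<open>finite P\<close>, of f]] by (auto simp: bounded_iff)
  show ?thesis
  proof (rule subspace_subset_if_near[OF V subspace_span, where C = "C + B"])
    fix v assume "v \<in> V"
    then obtain s w where sw: "(s, w) \<in> H" "\<bar>s\<bar> \<le> C" "norm (v - w) \<le> C" using C by blast
    then have s: "s \<in> P" by (auto simp: P_def)
    have "w - f s \<in> span Lam" using H_diff[OF sw(1) f[OF s]] by (auto simp: E_0 intro: span_base)
    moreover have "norm (v - (w - f s)) \<le> C + B"
      using norm_triangle_ineq[of "v - w" "f s"] sw(3) B[OF s] by (simp add: algebra_simps)
    ultimately show "\<exists>w\<in>span Lam. norm (v - w) \<le> C + B" by blast
  qed
qed

end

section \<open>Subgroups whose projection to the real line accumulates at 0\<close>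

locale flow_lattice_dense = flow_lattice +
  assumes dense: "d > 0 \<Longrightarrow> \<exists>t v. (t, v) \<in> H \<and> t \<noteq> 0 \<and> \<bar>t\<bar> < d"
begin

lemma T_zero_on_Lam:
  assumes "x \<in> Lam" shows "T x = 0"
proof -
  obtain d where d: "d > 0" "\<And>v. (0, v) \<in> H \<Longrightarrow> norm v < d \<Longrightarrow> v = 0" using H_sep by blast
  have "isCont (\<lambda>t. E t x) 0" using continuous_E[of UNIV x] continuous_on_eq_continuous_at open_UNIV by blast
  then obtain e where e: "e > 0" "\<And>t. \<bar>t\<bar> < e \<Longrightarrow> norm (E t x - x) < d"
    using d(1) unfolding continuous_at_eps_delta dist_norm by (force simp: E_0)
  obtain t v where tv: "(t, v) \<in> H" "t \<noteq> 0" "\<bar>t\<bar> < e" using dense e(1) by blast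
  \<comment> \<open>The conjugate of \<open>(0, x)\<close> by \<open>(t, v)\<close>; the
    contributions of \<open>v\<close> cancel.\<close>
  have "(0, E t x) \<in> H"
  proof -
    have "(t, v + x) \<in> H" using H_mult[OF tv(1), of 0 x] assms by (simp add: E_0)
    from H_mult[OF this H_inv[OF tv(1)]] show ?thesis by (simp add: E_simps)
  qed
  then have "E t x - x \<in> Lam" using Lam_diff assms by blast
  then have "E t x = x" using d(2) e(2)[OF tv(3)] by fastforce
  then show ?thesis using tv(2) E_fix_imp by blast
qed

text \<open>The products in the two orders share the first coordinate \<open>t + s\<close>, so their
  quotient lies over 0.\<close>

lemma commutator_Lam:
  assumes "(t, v) \<in> H" "(s, w) \<in> H" shows "(E (-s) v - v) - (E (-t) w - w) \<in> Lam"
  using H_diff[OF H_mult[OF assms] H_mult[OF assms(2,1)]] by (simp add: E_0 algebra_simps)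

text \<open>\<open>T\<close> kills the commutators, so \<open>(E (-s) - 1) T\<close> agrees at the points \<open>v\<close> of \<open>H\<close> with a function of the
  bounded parameter \<open>t\<close>; hence this linear map is bounded on \<open>V\<close> and vanishes.\<close>

lemma T_square_zero:
  assumes "v \<in> V" shows "T (T v) = 0"
proof -
  obtain s w where sw: "(s, w) \<in> H" "s \<noteq> 0" using dense[of 1] by auto
  obtain C where C: "\<And>v. v \<in> V \<Longrightarrow> \<exists>(s, w)\<in>H. \<bar>s\<bar> \<le> C \<and> norm (v - w) \<le> C" using H_cocompact by blast
  define L where "L v = E (-s) (T v) - T v" for v
  have L: "linear L" unfolding L_def by (intro linear_compose_sub linear_T linear_compose[OF linear_T linear_E, unfolded o_def])
  then obtain K where K: "K > 0" "\<And>v. norm (L v) \<le> K * norm v"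
    using linear_bounded_pos by blast
  \<comment> \<open>The approximating elements have first coordinates in \<open>[-C, C]\<close>, so
    compactness bounds this side of the commutator identity uniformly.\<close>
  have "compact ((\<lambda>t. E t (T w) - T w) ` {-C..C})"
    by (intro compact_continuous_image continuous_on_diff continuous_E continuous_on_const compact_Icc)
  then obtain M where M: "\<And>t. t \<in> {-C..C} \<Longrightarrow> norm (E t (T w) - T w) \<le> M"
    by (meson bounded_iff compact_imp_bounded imageI)
  have "L v = 0"
  proof (rule linear_bounded_imp_zero[OF L V _ assms, where C = "K * C + M"])
    fix v assume "v \<in> V"
    then obtain t v' where t: "(t, v') \<in> H" "\<bar>t\<bar> \<le> C" "norm (v - v') \<le> C" using C by blast
    have "L v' = E (-t) (T w) - T w"
      using T_zero_on_Lam[OF commutator_Lam[OF t(1) sw(1)]] by (simp add: T_simps T_E L_def)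
    then have "norm (L v') \<le> M" using M[of "-t"] t(2) by (simp add: abs_le_iff minus_le_iff)
    moreover have "norm (L (v - v')) \<le> K * C" using K t(3) by (meson mult_left_mono less_imp_le order_trans)
    ultimately show "norm (L v) \<le> K * C + M"
      using norm_triangle_ineq[of "L (v - v')" "L v'"] by (simp add: linear_diff[OF L])
  qed
  then show ?thesis using E_fix_imp[of "-s" "T v"] sw(2) by (simp add: L_def)
qed

lemma E_affine: "v \<in> V \<Longrightarrow> E t v = v + t *\<^sub>R T v"
  using E_if_T_square_zero T_square_zero by blast

lemma commutator_form_Lam:
  assumes "(t, v) \<in> H" "(s, w) \<in> H" shows "t *\<^sub>R T w - s *\<^sub>R T v \<in> Lam"
  using commutator_Lam[OF assms] E_affine H_V assms by (simp add: algebra_simps)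

text \<open>As \<open>T\<close> has square zero on \<open>V\<close>, it does not see the twist by
  \<open>E\<close>, and \<open>(t, v) \<mapsto> T v\<close> is additive under the product of
  \<open>H\<close>. The witness is the \<open>k\<close>-th power of \<open>(t, v)\<close>.\<close>

lemma H_int_multiple:
  assumes "(t, v) \<in> H" shows "\<exists>u. (of_int k * t, u) \<in> H \<and> T u = of_int k *\<^sub>R T v"
proof (induction k rule: int_induct[of _ 0])
  case base then show ?case using Lam_0 T_simps by (intro exI[of _ 0]) auto
next
  case (step1 i)
  then obtain u where u: "(of_int i * t, u) \<in> H" "T u = of_int i *\<^sub>R T v" by blast
  then show ?case using H_mult[OF u(1) assms] E_affine[OF H_V[OF u(1)]] T_square_zero[OF H_V[OF u(1)]]
    by (intro exI[of _ "E (-t) u + v"]) (auto simp: T_simps algebra_simps)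
next
  case (step2 i)
  then obtain u where u: "(of_int i * t, u) \<in> H" "T u = of_int i *\<^sub>R T v" by blast
  then show ?case using H_diff[OF u(1) assms] E_affine[OF H_V[OF assms]] T_square_zero[OF H_V[OF assms]]
    by (intro exI[of _ "u - E (t - of_int i * t) v"]) (auto simp: T_simps algebra_simps)
qed

text \<open>The \<open>m\<close>-th power of \<open>(r, u)\<close> and the \<open>k\<close>-th power
  of \<open>(s, w)\<close> have the same first coordinate; their quotient lies in \<open>Lam\<close>
  and is killed by \<open>T\<close>.\<close>

lemma commutator_form_zero_if_commensurable:
  assumes "(s, w) \<in> H" "(r, u) \<in> H" "of_int m * r = of_int k * s" "(m::int) \<noteq> 0"
  shows "s *\<^sub>R T u - r *\<^sub>R T w = 0"
proof -
  obtain u1 where u1: "(of_int m * r, u1) \<in> H" "T u1 = of_int m *\<^sub>R T u" using H_int_multiple[OF assms(2)] by blast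
  obtain w1 where w1: "(of_int k * s, w1) \<in> H" "T w1 = of_int k *\<^sub>R T w" using H_int_multiple[OF assms(1)] by blast
  have "T (u1 - w1) = 0" using T_zero_on_Lam H_diff[OF u1(1) w1(1)] assms(3) by (simp add: E_0)
  then have "T u1 = T w1" by (simp add: T_simps)
  then have *: "of_int m *\<^sub>R T u = of_int k *\<^sub>R T w" using u1 w1 by simp
  have "of_int m *\<^sub>R (s *\<^sub>R T u - r *\<^sub>R T w) = s *\<^sub>R (of_int m *\<^sub>R T u) - (of_int m * r) *\<^sub>R T w"
    by (simp add: algebra_simps)
  also have "\<dots> = 0" by (simp add: * assms(3))
  finally show ?thesis using assms(4) by simp
qed

text \<open>If \<open>(t, v')\<close> approximates \<open>v\<close> with bounded \<open>t\<close>,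
  then \<open>s *\<^sub>R T v\<close> is at bounded distance from the commutator form of
  \<open>(t, v')\<close>, which lies in \<open>W\<close>; \<open>subspace_subset_if_near\<close>
  removes the error.\<close>

lemma T_near_line:
  assumes "(s, w) \<in> H" "subspace W" "s \<noteq> 0"
    and "\<And>t v. (t, v) \<in> H \<Longrightarrow> s *\<^sub>R T v - t *\<^sub>R T w \<in> W"
    and "v \<in> V"
  shows "T v \<in> W"
proof -
  obtain C where C: "\<And>v. v \<in> V \<Longrightarrow> \<exists>(s, w)\<in>H. \<bar>s\<bar> \<le> C \<and> norm (v - w) \<le> C" using H_cocompact by blast
  define L where "L v = s *\<^sub>R T v" for v
  have L: "linear L" unfolding L_def by (intro linear_compose_scale_right linear_T)
  then obtain K where K: "K > 0" "\<And>v. norm (L v) \<le> K * norm v"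
    using linear_bounded_pos by blast
  have "L ` V \<subseteq> W"
  proof (rule subspace_subset_if_near[OF linear_subspace_image[OF L V] assms(2), where C = "K * C + C * norm (T w)"])
    fix y assume "y \<in> L ` V"
    then obtain v where v: "v \<in> V" "y = L v" by blast
    then obtain t v' where t: "(t, v') \<in> H" "\<bar>t\<bar> \<le> C" "norm (v - v') \<le> C" using C by blast
    have "norm (L (v - v')) \<le> K * C" using K t(3) by (meson mult_left_mono less_imp_le order_trans)
    moreover have "norm (t *\<^sub>R T w) \<le> C * norm (T w)" using t(2) by (simp add: mult_right_mono)
    ultimately have "norm (y - (s *\<^sub>R T v' - t *\<^sub>R T w)) \<le> K * C + C * norm (T w)"
      using norm_triangle_ineq[of "L (v - v')" "t *\<^sub>R T w"] by (simp add: v linear_diff[OF L]) (simp add: L_def algebra_simps)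
    then show "\<exists>z\<in>W. norm (y - z) \<le> K * C + C * norm (T w)" using assms(4)[OF t(1)] by blast
  qed
  then have "s *\<^sub>R T v \<in> W" using assms(5) by (auto simp: L_def)
  then show ?thesis using assms(2,3) subspace_scale[of W "s *\<^sub>R T v" "1/s"] by simp
qed

text \<open>The three commutator forms of \<open>(t, v)\<close>, \<open>(s, w)\<close>, \<open>(r, u)\<close> satisfy a linear relation with coefficients
  \<open>t\<close>, \<open>r\<close>, \<open>s\<close>. If \<open>a\<close> and \<open>b\<close> were independent, \<open>r / s\<close> would be rational and \<open>b\<close> would vanish.\<close>

theorem T_rank_one:
  assumes "v0 \<in> V" "T v0 \<noteq> 0"
  obtains s w b where "(s, w) \<in> H" "s \<noteq> 0" "b \<noteq> 0" "\<And>v. v \<in> V \<Longrightarrow> T v \<in> span {b}"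
proof -
  obtain s w where sw: "(s, w) \<in> H" "s \<noteq> 0" using dense[of 1] by auto
  \<comment> \<open>If every form with \<open>(s, w)\<close> vanished, \<open>T_near_line\<close>
    with \<open>W = {0}\<close> would make \<open>T\<close> zero on \<open>V\<close>.\<close>
  have "\<exists>r u. (r, u) \<in> H \<and> s *\<^sub>R T u - r *\<^sub>R T w \<noteq> 0"
  proof (rule ccontr)
    assume "\<not> ?thesis"
    then have "s *\<^sub>R T u - r *\<^sub>R T w \<in> {0}" if "(r, u) \<in> H" for r u using that by blast
    then show False using T_near_line[OF sw(1) subspace_single_0 sw(2) _ assms(1)] assms(2) by blast
  qed
  then obtain r u where ru: "(r, u) \<in> H" "s *\<^sub>R T u - r *\<^sub>R T w \<noteq> 0" by blast
  define b where "b = s *\<^sub>R T u - r *\<^sub>R T w"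
  have b: "b \<in> Lam" "b \<noteq> 0" using commutator_form_Lam[OF sw(1) ru(1)] ru by (auto simp: b_def)
  have "s *\<^sub>R T v - t *\<^sub>R T w \<in> span {b}" if tv: "(t, v) \<in> H" for t v
  proof (rule ccontr)
    let ?a = "s *\<^sub>R T v - t *\<^sub>R T w" and ?c = "r *\<^sub>R T v - t *\<^sub>R T u"
    assume a: "?a \<notin> span {b}"
    have aL: "?a \<in> Lam" and cL: "?c \<in> Lam" using commutator_form_Lam[OF sw(1) tv] commutator_form_Lam[OF ru(1) tv] by auto
    have "s *\<^sub>R ?c = s *\<^sub>R ((r/s) *\<^sub>R ?a + (- t/s) *\<^sub>R b)"
      using sw(2) by (simp add: b_def algebra_simps)
    then have c: "?c = (r/s) *\<^sub>R ?a + (- t/s) *\<^sub>R b" using sw(2) by (metis scaleR_left_imp_eq)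
    have "\<exists>(m::int) (k::int). m \<noteq> 0 \<and> of_int m * (r/s) = of_int k"
    proof (rule lattice_relation_rational[OF Lam_finite _ c a])
      fix j k l :: int
      show "of_int j *\<^sub>R ?a + of_int k *\<^sub>R b + of_int l *\<^sub>R ?c \<in> Lam"
        using Lam_add Lam_scale_int aL cL b(1) by metis
    qed
    then obtain m k :: int where mk: "m \<noteq> 0" "of_int m * (r/s) = of_int k" by blast
    then have "of_int m * r = of_int k * s" using sw(2) by (simp add: field_simps)
    then show False using commutator_form_zero_if_commensurable[OF sw(1) ru(1) _ mk(1)] ru(2) by blast
  qed
  then have "T v \<in> span {b}" if "v \<in> V" for v
    using T_near_line[OF sw(1) subspace_span sw(2) _ that] by blast
  then show thesis using that sw b by blast
qed

text \<open>\<open>\<aa>\<close> is the centralizer of \<open>log (s, w)\<close>, and \<open>log (t, v) = tn + v + (t/2) Tv\<close> because \<open>T\<^sup>2 = 0\<close>.\<close>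

theorem centralizer_spanned:
  assumes sw: "(s, w) \<in> H" "s \<noteq> 0"
    and n: "norm n = 1" "T n = 0" "V = {v. n \<bullet> v = 0}"
  defines "\<aa> \<equiv> {x. s *\<^sub>R T x = (n \<bullet> x) *\<^sub>R T w}"
  shows "\<aa> \<subseteq> span (\<aa> \<inter> {t *\<^sub>R n + v + (t/2) *\<^sub>R T v | t v. (t, v) \<in> H})"
proof -
  define lg where "lg t v = t *\<^sub>R n + v + (t/2) *\<^sub>R T v" for t v
  let ?Q = "\<aa> \<inter> {lg t v | t v. (t, v) \<in> H}"
  have nn: "n \<bullet> n = 1" using n(1) by (simp add: dot_square_norm)
  have in_V: "v \<in> V" "n \<bullet> v = 0" "n \<bullet> T v = 0" "T (T v) = 0" if "(t, v) \<in> H" for t v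
    using H_V[OF that] T_V[OF H_V[OF that]] T_square_zero[OF H_V[OF that]] n(3) by auto
  have lg: "lg t v \<in> ?Q" if "(t, v) \<in> H" "s *\<^sub>R T v = t *\<^sub>R T w" for t v
    using that in_V[OF that(1)] by (auto simp: \<aa>_def lg_def T_simps n(2) inner_add_right nn)
  obtain C where C: "\<And>v. v \<in> V \<Longrightarrow> \<exists>(s, w)\<in>H. \<bar>s\<bar> \<le> C \<and> norm (v - w) \<le> C" using H_cocompact by blast
  obtain K where K: "K > 0" "\<And>v. norm (T v) \<le> K * norm v"
    using linear_bounded_pos[OF linear_T] by blast
  \<comment> \<open>The bracket of log (s, w) with log (t, v): it vanishes exactly when
    \<open>lg t v\<close> lies in \<open>\<aa>\<close>.\<close>
  define q where "q t v = s *\<^sub>R T v - t *\<^sub>R T w" for t v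
  define R where "R = \<bar>s\<bar> * (K * C) + C * norm (T w)"
  \<comment> \<open>Values of \<open>q\<close> lie in \<open>Lam\<close>, so only finitely many have
    norm at most \<open>R\<close>; \<open>f\<close> will fix one element of \<open>H\<close> for
    each. \<open>R\<close> bounds \<open>q t v\<close> when \<open>(t, v)\<close> approximates a
    point of the kernel of \<open>T\<close>.\<close>
  define Y where "Y = {q t v | t v. (t, v) \<in> H \<and> \<bar>t\<bar> \<le> C \<and> norm (q t v) \<le> R}"
  have "finite Y"
    by (rule finite_subset[OF _ Lam_finite[of R]]) (use commutator_form_Lam[OF sw(1)] in \<open>auto simp: Y_def q_def\<close>)
  have "\<forall>y\<in>Y. \<exists>p. p \<in> H \<and> \<bar>fst p\<bar> \<le> C \<and> q (fst p) (snd p) = y" by (auto simp: Y_def)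
  then obtain f where f: "\<And>y. y \<in> Y \<Longrightarrow> f y \<in> H \<and> \<bar>fst (f y)\<bar> \<le> C \<and> q (fst (f y)) (snd (f y)) = y"
    by metis
  obtain B where B: "\<And>y. y \<in> Y \<Longrightarrow> norm (snd (f y)) \<le> B"
    using finite_imp_bounded[OF finite_imageI[OF \<open>finite Y\<close>, of "\<lambda>y. snd (f y)"]] by (auto simp: bounded_iff)
  \<comment> \<open>Let \<open>(t, v)\<close> approximate \<open>z\<close>. Its quotient by the
    chosen element with the same value of \<open>q\<close> has \<open>q\<close> equal to 0, so the
    logarithm of the quotient is in \<open>?Q\<close>, and it is still at bounded distance from
    \<open>z\<close>. The constant collects bounds for the four summands of
    \<open>z - lg a u\<close>.\<close>
  have kernel: "{z \<in> V. T z = 0} \<subseteq> span ?Q"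
  proof (rule subspace_subset_if_near[OF _ subspace_span,
        where C = "2 * C + C + (B + (2 * C) * (K * B)) + (2 * C) * ((2 * C) / \<bar>s\<bar> * norm (T w))"])
    show "subspace {z \<in> V. T z = 0}"
      using V by (auto simp: subspace_def T_simps)
    fix z assume "z \<in> {z \<in> V. T z = 0}"
    then have z: "z \<in> V" "T z = 0" by auto
    then obtain t v where tv: "(t, v) \<in> H" "\<bar>t\<bar> \<le> C" "norm (z - v) \<le> C" using C by blast
    have Cnn: "0 \<le> C" using tv(2) by linarith
    have "norm (q t v) \<le> norm (s *\<^sub>R T (v - z)) + norm (t *\<^sub>R T w)"
      unfolding q_def T_simps z(2) using norm_triangle_ineq4[of "s *\<^sub>R T v" "t *\<^sub>R T w"] by simp
    also have "\<dots> \<le> R"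
    proof -
      have "norm (T (v - z)) \<le> K * C"
        using K(2)[of "v - z"] tv(3) K(1) by (metis norm_minus_commute mult_left_mono less_imp_le order_trans)
      then show ?thesis using tv(2) unfolding R_def by (auto intro!: add_mono mult_left_mono mult_right_mono)
    qed
    finally have y: "q t v \<in> Y" using tv unfolding Y_def by blast
    obtain t' v' where tv': "f (q t v) = (t', v')" by fastforce
    then have 1: "(t', v') \<in> H" "\<bar>t'\<bar> \<le> C" "q t' v' = q t v" "norm v' \<le> B" using f[OF y] B[OF y] by auto
    define a where "a = t - t'"
    define u where "u = v - E (t' - t) v'"
    have au: "(a, u) \<in> H" unfolding a_def u_def by (rule H_diff[OF tv(1) 1(1)])
    have Ev: "E (t' - t) v' = v' - a *\<^sub>R T v'" using E_affine[OF in_V(1)[OF 1(1)]] by (simp add: a_def algebra_simps)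
    have Tu: "T u = T v - T v'" unfolding u_def Ev T_simps in_V(4)[OF 1(1)] by simp
    have sTu: "s *\<^sub>R T u = a *\<^sub>R T w"
      using 1(3) by (simp add: Tu q_def a_def algebra_simps)
    have aC: "\<bar>a\<bar> \<le> 2 * C" using tv(2) 1(2) by (simp add: a_def)
    have Tu': "T u = (a / s) *\<^sub>R T w" using sTu sw(2) by (metis divide_inverse_commute scaleR_scaleR scaleR_one left_inverse)
    have n1: "norm (T u) \<le> (2 * C) / \<bar>s\<bar> * norm (T w)"
    proof -
      have "\<bar>a / s\<bar> \<le> 2 * C / \<bar>s\<bar>" using aC by (simp add: abs_divide divide_right_mono)
      then show ?thesis unfolding Tu' norm_scaleR by (intro mult_right_mono) auto
    qed
    have "norm ((a / 2) *\<^sub>R T u) \<le> (2 * C) * ((2 * C) / \<bar>s\<bar> * norm (T w))"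
    proof -
      have "\<bar>a / 2\<bar> \<le> 2 * C" using aC by simp
      then show ?thesis using n1 Cnn unfolding norm_scaleR by (intro mult_mono) auto
    qed
    moreover have "norm (v' - a *\<^sub>R T v') \<le> B + (2 * C) * (K * B)"
    proof -
      have "norm (T v') \<le> K * B" using K 1(4) by (meson mult_left_mono less_imp_le order_trans)
      then have "norm (a *\<^sub>R T v') \<le> (2 * C) * (K * B)" using aC Cnn unfolding norm_scaleR by (intro mult_mono) auto
      then show ?thesis using norm_triangle_ineq4[of v' "a *\<^sub>R T v'"] 1(4) by linarith
    qed
    moreover have "norm (a *\<^sub>R n) \<le> 2 * C" using aC n(1) by simp
    moreover have eq: "z - lg a u = (z - v) + (v' - a *\<^sub>R T v') - a *\<^sub>R n - (a / 2) *\<^sub>R T u"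
      unfolding lg_def u_def Ev by (simp add: algebra_simps)
    moreover have "norm (z - lg a u)
       \<le> norm (z - v) + norm (v' - a *\<^sub>R T v') + norm (a *\<^sub>R n) + norm ((a / 2) *\<^sub>R T u)"
      unfolding eq by (intro order_trans[OF norm_triangle_ineq4] add_right_mono norm_triangle_ineq)
    ultimately have "norm (z - lg a u) \<le> 2 * C + C + (B + (2 * C) * (K * B)) + (2 * C) * ((2 * C) / \<bar>s\<bar> * norm (T w))"
      using tv(3) by linarith
    moreover have "lg a u \<in> span ?Q" using lg[OF au sTu] by (rule span_base)
    ultimately show "\<exists>w'\<in>span ?Q. norm (z - w') \<le> 2 * C + C + (B + (2 * C) * (K * B)) + (2 * C) * ((2 * C) / \<bar>s\<bar> * norm (T w))"
      by blast
  qed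
  show ?thesis
  proof
    fix x assume x: "x \<in> \<aa>"
    have b: "lg s w \<in> span ?Q" using lg[OF sw(1)] by (intro span_base) simp
    have Tb: "T (lg s w) = T w" "n \<bullet> lg s w = s"
      using in_V[OF sw(1)] by (auto simp: lg_def T_simps n(2) inner_add_right nn)
    \<comment> \<open>Since \<open>lg s w\<close> is in \<open>\<aa>\<close> with normal component
      \<open>s\<close>, this multiple reduces \<open>x\<close> to a point of \<open>V\<close> killed
      by \<open>T\<close>.\<close>
    define z where "z = x - ((n \<bullet> x) / s) *\<^sub>R lg s w"
    have "s *\<^sub>R T z = 0" using x sw(2) by (simp add: z_def T_simps Tb \<aa>_def algebra_simps)
    then have "T z = 0" using sw(2) by simp
    moreover have "z \<in> V" unfolding n(3) using sw(2) by (simp add: z_def inner_diff_right Tb)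
    ultimately have "z \<in> span ?Q" using kernel by blast
    then have "z + ((n \<bullet> x) / s) *\<^sub>R lg s w \<in> span ?Q" by (intro span_add span_scale b)
    then show "x \<in> span (\<aa> \<inter> {t *\<^sub>R n + v + (t/2) *\<^sub>R T v | t v. (t, v) \<in> H})"
      by (simp add: z_def lg_def)
  qed
qed

end

section \<open>Smooth maps into a Lie group\<close>

locale smooth_group = group G for G :: "'g::{t2_space, second_countable_topology} monoid" (structure) +
  fixes A :: "('g, 'e::euclidean_space) chart set"
  assumes lie_group: "lie_group G A"
begin

lemma carrier_UNIV [simp]: "carrier G = UNIV"
  using lie_group by (simp add: lie_group_def)

lemma cancel_inv [simp]: "inv x \<otimes> (x \<otimes> y) = y" "x \<otimes> (inv x \<otimes> y) = y"
  by (simp_all flip: m_assoc)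

lemma atlas: "smooth_atlas A"
  using lie_group by (simp add: lie_group_def)

lemma ex_chart: obtains V \<kappa> where "(V, \<kappa>) \<in> A" "x \<in> V"
proof -
  have "x \<in> \<Union> (fst ` A)" using atlas by (simp add: smooth_atlas_def)
  then show ?thesis using that by auto
qed

lemma chart:
  assumes "(V, \<kappa>) \<in> A"
  shows "open V" "open (\<kappa> ` V)" "continuous_on V \<kappa>" "continuous_on (\<kappa> ` V) (inv_into V \<kappa>)"
    "inj_on \<kappa> V" "x \<in> V \<Longrightarrow> inv_into V \<kappa> (\<kappa> x) = x"
proof -
  have "\<forall>(U, \<phi>)\<in>A. open U \<and> open (\<phi> ` U) \<and> homeomorphism U (\<phi> ` U) \<phi> (inv_into U \<phi>)"
    using atlas unfolding smooth_atlas_def by (elim conjE)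
  from bspec[OF this assms] have *: "open V" "open (\<kappa> ` V)"
    "homeomorphism V (\<kappa> ` V) \<kappa> (inv_into V \<kappa>)" by (simp_all only: prod.case)
  show "open V" "open (\<kappa> ` V)" using * by blast+
  show "continuous_on V \<kappa>" by (rule homeomorphism_cont1[OF *(3)])
  show "continuous_on (\<kappa> ` V) (inv_into V \<kappa>)" by (rule homeomorphism_cont2[OF *(3)])
  show "inj_on \<kappa> V" using homeomorphism_apply1[OF *(3)] by (rule inj_on_inverseI)
  then show "x \<in> V \<Longrightarrow> inv_into V \<kappa> (\<kappa> x) = x" by simp
qed

lemma transition:
  assumes "(V, \<kappa>) \<in> A" "(W, \<omega>) \<in> A"
  shows "smooth_on (\<kappa> ` (V \<inter> W)) (\<lambda>x. \<omega> (inv_into V \<kappa> x))"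
  using atlas assms by (fastforce simp: smooth_atlas_def o_def)

lemma continuous_on_mult:
  assumes "continuous_on S f" "continuous_on S g" shows "continuous_on S (\<lambda>x. f x \<otimes> g x)"
proof -
  have "continuous_on UNIV (\<lambda>(x, y). x \<otimes> y)"
    using lie_group by (simp add: lie_group_def smooth_map_def)
  then have "continuous_on S (\<lambda>x. (\<lambda>(x, y). x \<otimes> y) (f x, g x))"
    by (rule continuous_on_compose2) (auto intro!: continuous_on_Pair assms)
  then show ?thesis by simp
qed

lemma continuous_on_inverse:
  assumes "continuous_on S f" shows "continuous_on S (\<lambda>x. inv (f x))"
proof -
  have "continuous_on UNIV (\<lambda>x. inv x)"
    using lie_group by (simp add: lie_group_def smooth_map_def)
  then show ?thesis by (rule continuous_on_compose2) (auto intro: assms)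
qed

text \<open>Maps from open subsets of Euclidean spaces, tested in every chart. Closure under
  products, inverses and substitution of parameters makes them convenient for families of group
  elements.\<close>

definition plot :: "'x::euclidean_space set \<Rightarrow> ('x \<Rightarrow> 'g) \<Rightarrow> bool" where
  "plot S f \<longleftrightarrow> open S \<and> continuous_on S f \<and>
     (\<forall>V \<kappa>. (V, \<kappa>) \<in> A \<longrightarrow> smooth_on (S \<inter> f -` V) (\<lambda>x. \<kappa> (f x)))"

lemma plot_open: "plot S f \<Longrightarrow> open S"
  and plot_continuous: "plot S f \<Longrightarrow> continuous_on S f"
  and plot_smooth: "plot S f \<Longrightarrow> (V, \<kappa>) \<in> A \<Longrightarrow> smooth_on (S \<inter> f -` V) (\<lambda>x. \<kappa> (f x))"
  by (auto simp: plot_def)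

lemma plot_vimage_open: "plot S f \<Longrightarrow> open V \<Longrightarrow> open (S \<inter> f -` V)"
  using plot_open plot_continuous continuous_on_open_vimage[of S f] by (metis Int_commute)

text \<open>One chart around each point suffices: transition maps carry smoothness to every other
  chart.\<close>

lemma plotI:
  assumes S: "open S" "continuous_on S f"
    and "\<And>x. x \<in> S \<Longrightarrow> \<exists>T W \<omega>. open T \<and> x \<in> T \<and> T \<subseteq> S \<and> (W, \<omega>) \<in> A \<and> f ` T \<subseteq> W \<and> smooth_on T (\<lambda>x. \<omega> (f x))"
  shows "plot S f"
  unfolding plot_def
proof (intro conjI allI impI S)
  fix V \<kappa> assume V: "(V, \<kappa>) \<in> A"
  have op: "open (S \<inter> f -` V)"
    using S chart(1)[OF V] continuous_on_open_vimage[of S f] by (metis Int_commute)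
  then show "smooth_on (S \<inter> f -` V) (\<lambda>x. \<kappa> (f x))"
  proof (rule smooth_on_local)
    fix x assume x: "x \<in> S \<inter> f -` V"
    then have "x \<in> S" by simp
    from assms(3)[OF this] obtain T W \<omega> where T: "open T" "x \<in> T" "T \<subseteq> S" "(W, \<omega>) \<in> A" "f ` T \<subseteq> W"
      "smooth_on T (\<lambda>x. \<omega> (f x))" by (elim exE conjE) (rule that; assumption)
    let ?T = "T \<inter> (S \<inter> f -` V)"
    have o: "open ?T" using T(1) op by blast
    have "smooth_on ?T (\<lambda>y. \<kappa> (inv_into W \<omega> (\<omega> (f y))))"
      by (rule smooth_on_compose[OF smooth_on_subset[OF T(6)] transition[OF T(4) V]]) (use T in auto)
    then have "smooth_on ?T (\<lambda>y. \<kappa> (f y))"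
      by (rule smooth_on_cong[OF o, rotated]) (use T chart(6)[OF T(4)] in auto)
    with o T(2) x show "\<exists>T. open T \<and> x \<in> T \<and> smooth_on T (\<lambda>x. \<kappa> (f x))" by blast
  qed
qed

lemma plot_chart: "(V, \<kappa>) \<in> A \<Longrightarrow> plot (\<kappa> ` V) (inv_into V \<kappa>)"
proof (rule plotI)
  assume V: "(V, \<kappa>) \<in> A"
  show "open (\<kappa> ` V)" "continuous_on (\<kappa> ` V) (inv_into V \<kappa>)" using chart[OF V] by auto
  fix x assume "x \<in> \<kappa> ` V"
  moreover have "smooth_on (\<kappa> ` V) (\<lambda>x. \<kappa> (inv_into V \<kappa> x))"
    by (rule smooth_on_cong[OF chart(2)[OF V] _ smooth_on_id]) (simp add: f_inv_into_f)
  ultimately show "\<exists>T W \<omega>. open T \<and> x \<in> T \<and> T \<subseteq> \<kappa> ` V \<and> (W, \<omega>) \<in> A \<and> inv_into V \<kappa> ` T \<subseteq> W \<and>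
      smooth_on T (\<lambda>x. \<omega> (inv_into V \<kappa> x))"
    using V chart(2)[OF V] by (intro exI[of _ "\<kappa> ` V"] exI[of _ V] exI[of _ \<kappa>]) (auto simp: inv_into_into)
qed

lemma plot_compose:
  assumes "plot T f" "open S" "smooth_on S h" "h ` S \<subseteq> T"
  shows "plot S (\<lambda>x. f (h x))"
  unfolding plot_def
proof (intro conjI allI impI assms)
  show "continuous_on S (\<lambda>x. f (h x))"
    using continuous_on_compose2[OF plot_continuous[OF assms(1)] smooth_on_imp_continuous_on[OF assms(3)] assms(4)] .
  fix V \<kappa> assume V: "(V, \<kappa>) \<in> A"
  show "smooth_on (S \<inter> (\<lambda>x. f (h x)) -` V) (\<lambda>x. \<kappa> (f (h x)))"
    by (rule smooth_on_compose[OF smooth_on_subset[OF assms(3)] plot_smooth[OF assms(1) V]])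
      (use assms(4) in auto)
qed

lemma plot_subset: "plot S f \<Longrightarrow> open T \<Longrightarrow> T \<subseteq> S \<Longrightarrow> plot T f"
  using plot_compose[of S f T "\<lambda>x. x"] smooth_on_id by auto

lemma plot_const: "open S \<Longrightarrow> plot S (\<lambda>x. g)"
  by (auto simp: plot_def smooth_on_const)

lemma plot_local:
  assumes "open S" "\<And>x. x \<in> S \<Longrightarrow> \<exists>T g. x \<in> T \<and> plot T g \<and> (\<forall>y\<in>T. f y = g y)"
  shows "plot S f"
proof (rule plotI[OF assms(1)])
  have loc: "\<exists>T g. x \<in> T \<and> plot T g \<and> (\<forall>y\<in>T. f y = g y) \<and> T \<subseteq> S" if x: "x \<in> S" for x
  proof -
    obtain T g where "x \<in> T" "plot T g" "\<forall>y\<in>T. f y = g y" using assms(2)[OF x] by blast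
    then show ?thesis using plot_subset[of T g "T \<inter> S"] assms(1) plot_open x
      by (intro exI[of _ "T \<inter> S"] exI[of _ g]) auto
  qed
  show "continuous_on S f"
  proof (intro continuous_at_imp_continuous_on ballI)
    fix x assume "x \<in> S"
    then obtain T g where T: "x \<in> T" "plot T g" "\<forall>y\<in>T. f y = g y" using loc by blast
    then have "continuous_on T f" using plot_continuous continuous_on_cong by metis
    then show "isCont f x" using T plot_open continuous_on_eq_continuous_at by blast
  qed
  fix x assume "x \<in> S"
  then obtain T g where T: "x \<in> T" "plot T g" "\<forall>y\<in>T. f y = g y" "T \<subseteq> S" using loc by blast
  obtain W \<omega> where W: "(W, \<omega>) \<in> A" "f x \<in> W" using ex_chart by blast
  have op: "open (T \<inter> g -` W)" using plot_vimage_open[OF T(2) chart(1)[OF W(1)]] .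
  have "smooth_on (T \<inter> g -` W) (\<lambda>x. \<omega> (f x))"
    by (rule smooth_on_cong[OF op _ plot_smooth[OF T(2) W(1)]]) (use T in auto)
  with op T W show "\<exists>T W \<omega>. open T \<and> x \<in> T \<and> T \<subseteq> S \<and> (W, \<omega>) \<in> A \<and> f ` T \<subseteq> W \<and> smooth_on T (\<lambda>x. \<omega> (f x))"
    by (intro exI[of _ "T \<inter> g -` W"] exI[of _ W] exI[of _ \<omega>]) auto
qed

text \<open>On a neighbourhood \<open>T\<close> that \<open>f\<close>, \<open>g\<close> and their
  product each map into a single chart, smoothness with respect to \<open>prod_atlas\<close> applies
  to the pair of coordinate maps; injectivity of the product chart evaluates its
  \<open>inv_into\<close>.\<close>

lemma plot_mult:
  assumes f: "plot S f" and g: "plot S g" shows "plot S (\<lambda>x. f x \<otimes> g x)"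
proof (rule plotI)
  let ?m = "\<lambda>(x, y). x \<otimes> y"
  show S: "open S" using f plot_open by blast
  show c: "continuous_on S (\<lambda>x. f x \<otimes> g x)" using f g by (intro continuous_on_mult plot_continuous)
  fix x assume x: "x \<in> S"
  obtain V1 \<kappa>1 where V1: "(V1, \<kappa>1) \<in> A" "f x \<in> V1" using ex_chart by blast
  obtain V2 \<kappa>2 where V2: "(V2, \<kappa>2) \<in> A" "g x \<in> V2" using ex_chart by blast
  obtain W \<omega> where W: "(W, \<omega>) \<in> A" "f x \<otimes> g x \<in> W" using ex_chart by blast
  define T where "T = (S \<inter> f -` V1) \<inter> (S \<inter> g -` V2) \<inter> (S \<inter> (\<lambda>x. f x \<otimes> g x) -` W)"
  have T: "open T" unfolding T_def
    using plot_vimage_open[OF f chart(1)[OF V1(1)]] plot_vimage_open[OF g chart(1)[OF V2(1)]]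
      continuous_on_open_vimage[OF S, THEN iffD1, OF c] chart(1)[OF W(1)]
    by (metis Int_commute open_Int)
  have "smooth_map (prod_atlas A A) A ?m" using lie_group by (simp add: lie_group_def)
  moreover have "(V1 \<times> V2, map_prod \<kappa>1 \<kappa>2) \<in> prod_atlas A A"
    using V1 V2 by (auto simp: prod_atlas_def)
  ultimately have sm: "smooth_on (map_prod \<kappa>1 \<kappa>2 ` (V1 \<times> V2 \<inter> ?m -` W))
      (\<omega> \<circ> ?m \<circ> inv_into (V1 \<times> V2) (map_prod \<kappa>1 \<kappa>2))"
    using W(1) unfolding smooth_map_def by blast
  have inj: "inj_on (map_prod \<kappa>1 \<kappa>2) (V1 \<times> V2)"
    using chart(5)[OF V1(1)] chart(5)[OF V2(1)] by (rule map_prod_inj_on)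
  have "smooth_on T (\<lambda>x. (\<kappa>1 (f x), \<kappa>2 (g x)))"
    using plot_smooth[OF f V1(1)] plot_smooth[OF g V2(1)]
    by (intro smooth_on_Pair) (auto elim!: smooth_on_subset simp: T_def)
  from smooth_on_compose[OF this sm]
  have "smooth_on T (\<lambda>x. (\<omega> \<circ> ?m \<circ> inv_into (V1 \<times> V2) (map_prod \<kappa>1 \<kappa>2)) (\<kappa>1 (f x), \<kappa>2 (g x)))"
    by (force simp: T_def)
  then have "smooth_on T (\<lambda>x. \<omega> (f x \<otimes> g x))"
  proof (rule smooth_on_cong[OF T, rotated])
    fix y assume "y \<in> T"
    then have "inv_into (V1 \<times> V2) (map_prod \<kappa>1 \<kappa>2) (map_prod \<kappa>1 \<kappa>2 (f y, g y)) = (f y, g y)"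
      using inj by (intro inv_into_f_f) (auto simp: T_def)
    then show "(\<omega> \<circ> ?m \<circ> inv_into (V1 \<times> V2) (map_prod \<kappa>1 \<kappa>2)) (\<kappa>1 (f y), \<kappa>2 (g y)) = \<omega> (f y \<otimes> g y)"
      by simp
  qed
  with T W V1 V2 x show "\<exists>T W \<omega>. open T \<and> x \<in> T \<and> T \<subseteq> S \<and> (W, \<omega>) \<in> A \<and>
      (\<lambda>x. f x \<otimes> g x) ` T \<subseteq> W \<and> smooth_on T (\<lambda>x. \<omega> (f x \<otimes> g x))"
    by (intro exI[of _ T] exI[of _ W] exI[of _ \<omega>]) (auto simp: T_def)
qed

lemma plot_inv:
  assumes f: "plot S f" shows "plot S (\<lambda>x. inv (f x))"
proof (rule plotI)
  show S: "open S" using f plot_open by blast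
  show c: "continuous_on S (\<lambda>x. inv (f x))" using f by (intro continuous_on_inverse plot_continuous)
  fix x assume x: "x \<in> S"
  obtain V \<kappa> where V: "(V, \<kappa>) \<in> A" "f x \<in> V" using ex_chart by blast
  obtain W \<omega> where W: "(W, \<omega>) \<in> A" "inv (f x) \<in> W" using ex_chart by blast
  define T where "T = (S \<inter> f -` V) \<inter> (S \<inter> (\<lambda>x. inv (f x)) -` W)"
  have T: "open T" unfolding T_def
    using plot_vimage_open[OF f chart(1)[OF V(1)]]
      continuous_on_open_vimage[OF S, THEN iffD1, OF c] chart(1)[OF W(1)]
    by (metis Int_commute open_Int)
  have "smooth_map A A (\<lambda>x. inv x)" using lie_group by (simp add: lie_group_def)
  then have sm: "smooth_on (\<kappa> ` (V \<inter> (\<lambda>x. inv x) -` W)) (\<omega> \<circ> (\<lambda>x. inv x) \<circ> inv_into V \<kappa>)"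
    using V(1) W(1) unfolding smooth_map_def by blast
  have "smooth_on T (\<lambda>x. \<kappa> (f x))"
    using plot_smooth[OF f V(1)] by (auto elim!: smooth_on_subset simp: T_def)
  from smooth_on_compose[OF this sm]
  have "smooth_on T (\<lambda>x. (\<omega> \<circ> (\<lambda>x. inv x) \<circ> inv_into V \<kappa>) (\<kappa> (f x)))"
    by (force simp: T_def)
  then have "smooth_on T (\<lambda>x. \<omega> (inv (f x)))"
    by (rule smooth_on_cong[OF T, rotated]) (use chart(6)[OF V(1)] in \<open>auto simp: T_def\<close>)
  with T W V x show "\<exists>T W \<omega>. open T \<and> x \<in> T \<and> T \<subseteq> S \<and> (W, \<omega>) \<in> A \<and>
      (\<lambda>x. inv (f x)) ` T \<subseteq> W \<and> smooth_on T (\<lambda>x. \<omega> (inv (f x)))"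
    by (intro exI[of _ T] exI[of _ W] exI[of _ \<omega>]) (auto simp: T_def)
qed

lemma one_parameter_subgroup_iff:
  "one_parameter_subgroup G A \<phi> X \<gamma> \<longleftrightarrow>
     plot UNIV \<gamma> \<and> (\<forall>s t. \<gamma> (s + t) = \<gamma> s \<otimes> \<gamma> t) \<and> ((\<lambda>t. \<phi> (\<gamma> t)) has_vector_derivative X) (at 0)"
  by (auto simp: one_parameter_subgroup_def smooth_map_def real_atlas_def plot_def o_def)

end

section \<open>Velocities and one-parameter subgroups\<close>

locale charted_group = smooth_group +
  fixes U :: "'a set" and \<phi> :: "'a \<Rightarrow> 'b"
  assumes chart_at_one: "chart_at_identity G A U \<phi>"
begin

abbreviation \<psi> :: "'b \<Rightarrow> 'a" where "\<psi> \<equiv> inv_into U \<phi>"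
abbreviation e :: 'b where "e \<equiv> \<phi> \<one>"

lemma U_chart: "(U, \<phi>) \<in> A" and one_in_U: "\<one> \<in> U"
  using chart_at_one by (auto simp: chart_at_identity_def)

lemmas U_facts = chart[OF U_chart]

lemma psi_phi [simp]: "x \<in> U \<Longrightarrow> \<psi> (\<phi> x) = x"
  by (rule U_facts(6))

lemma psi_e [simp]: "\<psi> e = \<one>"
  using one_in_U by simp

lemma phi_psi [simp]: "x \<in> \<phi> ` U \<Longrightarrow> \<phi> (\<psi> x) = x"
  by (rule f_inv_into_f)

lemma e_in: "e \<in> \<phi> ` U"
  using one_in_U by blast

lemma plot_psi: "plot (\<phi> ` U) \<psi>"
  using plot_chart[OF U_chart] .

text \<open>Continuity at 0 is part of the notion because \<open>\<phi>\<close> is arbitrary outside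
  \<open>U\<close>: a derivative of \<open>\<phi> (c t)\<close> alone would not keep
  \<open>c\<close> in the chart.\<close>

definition velocity :: "(real \<Rightarrow> 'a) \<Rightarrow> 'b \<Rightarrow> bool" where
  "velocity c X \<longleftrightarrow> c 0 = \<one> \<and> isCont c 0 \<and> ((\<lambda>t. \<phi> (c t)) has_vector_derivative X) (at 0)"

lemma velocity_eventually:
  assumes "velocity c X" shows "\<forall>\<^sub>F t in at 0. c t \<in> U"
proof -
  have "(c \<longlongrightarrow> \<one>) (at 0)" using assms by (auto simp: velocity_def isCont_def)
  then show ?thesis using topological_tendstoD U_facts(1) one_in_U by blast
qed

lemma velocity_unique: "velocity c X \<Longrightarrow> velocity c Y \<Longrightarrow> X = Y"
  unfolding velocity_def using vector_derivative_unique_at by blast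

lemma velocity_const: "velocity (\<lambda>t. \<one>) 0"
  by (auto simp: velocity_def)

lemma velocity_scale:
  assumes "velocity c X" shows "velocity (\<lambda>t. c (r * t)) (r *\<^sub>R X)"
proof -
  have "isCont (\<lambda>t. c (r * t)) 0"
    using assms isCont_o2[of 0 "\<lambda>t. r * t" c] by (auto simp: velocity_def intro!: continuous_intros)
  moreover have "((\<lambda>t. \<phi> (c t)) \<circ> (\<lambda>t. r * t) has_vector_derivative r *\<^sub>R X) (at 0)"
    using assms by (intro vector_diff_chain_at) (auto simp: velocity_def intro!: derivative_eq_intros)
  ultimately show ?thesis using assms by (auto simp: velocity_def o_def)
qed

lemma velocity_has_derivative:
  assumes c: "velocity c X" and K: "(K has_derivative K') (at e)"
    and eq: "\<And>t. c t \<in> U \<Longrightarrow> f t = K (\<phi> (c t))"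
  shows "(f has_vector_derivative K' X) (at 0)"
proof -
  have "((\<lambda>t. K (\<phi> (c t))) has_derivative (\<lambda>h. K' (h *\<^sub>R X))) (at 0)"
    by (rule has_derivative_compose[where f = "\<lambda>t. \<phi> (c t)"])
      (use c K in \<open>auto simp: velocity_def has_vector_derivative_def\<close>)
  then have "((\<lambda>t. K (\<phi> (c t))) has_vector_derivative K' X) (at 0)"
    using linear_scale[OF has_derivative_linear[OF K]] by (simp add: has_vector_derivative_def)
  then show ?thesis
    unfolding has_vector_derivative_def
    by (rule has_derivative_transform_eventually)
      (use velocity_eventually[OF c] eq c one_in_U in \<open>auto simp: velocity_def elim: eventually_mono\<close>)
qed

section \<open>Multiplication in the chart and its derivative at the identity\<close>

definition \<mu> :: "'b \<times> 'b \<Rightarrow> 'b" where "\<mu> p = \<phi> (\<psi> (fst p) \<otimes> \<psi> (snd p))"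

definition \<mu>_dom :: "('b \<times> 'b) set" where
  "\<mu>_dom = (\<phi> ` U \<times> \<phi> ` U) \<inter> (\<lambda>p. \<psi> (fst p) \<otimes> \<psi> (snd p)) -` U"

lemma plot_mu: "plot (\<phi> ` U \<times> \<phi> ` U) (\<lambda>p. \<psi> (fst p) \<otimes> \<psi> (snd p))"
  by (intro plot_mult plot_compose[OF plot_psi])
    (auto intro!: smooth_on_bounded_linear bounded_linear_fst bounded_linear_snd open_Times U_facts)

lemma mu_dom_open: "open \<mu>_dom"
  unfolding \<mu>_dom_def by (rule plot_vimage_open[OF plot_mu U_facts(1)])

lemma mu_smooth: "smooth_on \<mu>_dom \<mu>"
  unfolding \<mu>_dom_def \<mu>_def[abs_def] by (rule plot_smooth[OF plot_mu U_chart])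

lemma mu_dom_e: "x \<in> \<phi> ` U \<Longrightarrow> (x, e) \<in> \<mu>_dom" "x \<in> \<phi> ` U \<Longrightarrow> (e, x) \<in> \<mu>_dom"
  using e_in by (auto simp: \<mu>_dom_def)

lemma mu_e: "x \<in> \<phi> ` U \<Longrightarrow> \<mu> (x, e) = x" "x \<in> \<phi> ` U \<Longrightarrow> \<mu> (e, x) = x"
  by (auto simp: \<mu>_def)

abbreviation D\<mu> :: "'b \<times> 'b \<Rightarrow> 'b \<times> 'b \<Rightarrow> 'b" where "D\<mu> p \<equiv> frechet_derivative \<mu> (at p)"

lemma mu_has_derivative: "p \<in> \<mu>_dom \<Longrightarrow> (\<mu> has_derivative D\<mu> p) (at p)"
  by (rule smooth_on_has_derivative[OF mu_smooth])

lemma mu_derivative_right: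
  assumes "(x, y) \<in> \<mu>_dom"
  shows "((\<lambda>y. \<mu> (x, y)) has_derivative (\<lambda>Y. D\<mu> (x, y) (0, Y))) (at y)"
  by (rule has_derivative_compose[where f = "\<lambda>y. (x, y)", OF _ mu_has_derivative[OF assms]])
    (auto intro!: derivative_eq_intros)

lemma mu_derivative_left:
  assumes "(x, y) \<in> \<mu>_dom"
  shows "((\<lambda>x. \<mu> (x, y)) has_derivative (\<lambda>X. D\<mu> (x, y) (X, 0))) (at x)"
  by (rule has_derivative_compose[where f = "\<lambda>x. (x, y)", OF _ mu_has_derivative[OF assms]])
    (auto intro!: derivative_eq_intros)

text \<open>Multiplication by \<open>\<one>\<close> on either side is the identity, so both partial
  derivatives at \<open>(e, e)\<close> are the identity.\<close>

lemma Dmu_e: "D\<mu> (e, e) (X, Y) = X + Y"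
proof -
  have "((\<lambda>x. x) has_derivative (\<lambda>X. D\<mu> (e, e) (X, 0))) (at e)"
    by (rule has_derivative_transform_within_open[OF mu_derivative_left[OF mu_dom_e(1)[OF e_in]] U_facts(2) e_in])
      (rule mu_e)
  then have "(\<lambda>X. D\<mu> (e, e) (X, 0)) = (\<lambda>x. x)"
    using has_derivative_unique has_derivative_ident by blast
  then have 1: "D\<mu> (e, e) (X, 0) = X" by metis
  have "((\<lambda>x. x) has_derivative (\<lambda>X. D\<mu> (e, e) (0, X))) (at e)"
    by (rule has_derivative_transform_within_open[OF mu_derivative_right[OF mu_dom_e(1)[OF e_in]] U_facts(2) e_in])
      (rule mu_e)
  then have "(\<lambda>X. D\<mu> (e, e) (0, X)) = (\<lambda>x. x)"
    using has_derivative_unique has_derivative_ident by blast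
  then have 2: "D\<mu> (e, e) (0, Y) = Y" by metis
  have "linear (D\<mu> (e, e))" using mu_has_derivative[OF mu_dom_e(1)[OF e_in]] has_derivative_linear by blast
  from linear_add[OF this, of "(X, 0)" "(0, Y)"] show ?thesis by (simp add: 1 2)
qed

lemma isCont_mult: "isCont c x \<Longrightarrow> isCont d x \<Longrightarrow> isCont (\<lambda>t. c t \<otimes> d t) x" for c d :: "'x::t2_space \<Rightarrow> 'a"
proof -
  assume *: "isCont c x" "isCont d x"
  have "continuous_on UNIV (\<lambda>p::'a \<times> 'a. fst p \<otimes> snd p)"
    by (intro continuous_on_mult continuous_intros)
  then have "isCont (\<lambda>p. fst p \<otimes> snd p) (c x, d x)" using continuous_on_eq_continuous_at open_UNIV by blast
  from isCont_o2[where f = "\<lambda>t. (c t, d t)" and a = x, OF _ this] * show ?thesis by simp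
qed

lemma isCont_inv: "isCont c x \<Longrightarrow> isCont (\<lambda>t. inv (c t)) x" for c :: "'x::t2_space \<Rightarrow> 'a"
proof -
  assume *: "isCont c x"
  have "continuous_on UNIV (\<lambda>p::'a. inv p)"
    by (intro continuous_on_inverse continuous_intros)
  then have "isCont (\<lambda>p. inv p) (c x)" using continuous_on_eq_continuous_at open_UNIV by blast
  from isCont_o2[OF * this] show ?thesis .
qed

lemma velocity_mult:
  assumes c: "velocity c X" and d: "velocity d Y" shows "velocity (\<lambda>t. c t \<otimes> d t) (X + Y)"
proof -
  have 0: "c 0 = \<one>" "d 0 = \<one>" using c d by (auto simp: velocity_def)
  have "((\<lambda>t. (\<phi> (c t), \<phi> (d t))) has_derivative (\<lambda>h. (h *\<^sub>R X, h *\<^sub>R Y))) (at 0)"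
    using c d by (auto simp: velocity_def has_vector_derivative_def intro!: has_derivative_Pair)
  moreover have "(\<mu> has_derivative D\<mu> (e, e)) (at (\<phi> (c 0), \<phi> (d 0)))"
    using mu_has_derivative mu_dom_e(1)[OF e_in] 0 by simp
  ultimately have "((\<lambda>t. \<mu> (\<phi> (c t), \<phi> (d t))) has_derivative (\<lambda>h. D\<mu> (e, e) (h *\<^sub>R X, h *\<^sub>R Y))) (at 0)"
    by (rule has_derivative_compose[where f = "\<lambda>t. (\<phi> (c t), \<phi> (d t))"])
  then have "((\<lambda>t. \<mu> (\<phi> (c t), \<phi> (d t))) has_derivative (\<lambda>h. h *\<^sub>R (X + Y))) (at 0)"
    by (simp add: Dmu_e scaleR_add_right)
  then have "((\<lambda>t. \<phi> (c t \<otimes> d t)) has_derivative (\<lambda>h. h *\<^sub>R (X + Y))) (at 0)"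
  proof (rule has_derivative_transform_eventually)
    show "\<forall>\<^sub>F t in at 0. \<mu> (\<phi> (c t), \<phi> (d t)) = \<phi> (c t \<otimes> d t)"
      using velocity_eventually[OF c] velocity_eventually[OF d] by eventually_elim (simp add: \<mu>_def)
  qed (auto simp: 0 \<mu>_def)
  then show ?thesis using c d by (auto simp: velocity_def has_vector_derivative_def intro!: isCont_mult)
qed

lemma smooth_chart_translate:
  assumes V: "(V, \<kappa>) \<in> A" and ab: "a \<otimes> b \<in> V"
  obtains K' where "((\<lambda>x. \<kappa> (a \<otimes> \<psi> x \<otimes> b)) has_derivative K') (at e)"
proof -
  have p: "plot (\<phi> ` U) (\<lambda>x. a \<otimes> \<psi> x \<otimes> b)"
    by (intro plot_mult plot_const plot_psi U_facts)
  have "e \<in> \<phi> ` U \<inter> (\<lambda>x. a \<otimes> \<psi> x \<otimes> b) -` V" using e_in ab by simp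
  from smooth_on_has_derivative[OF plot_smooth[OF p V] this] that show thesis by blast
qed

text \<open>Smoothness of inversion gives some velocity \<open>K' X\<close>. The product of
  \<open>c t\<close> with its inverse is constant, so \<open>velocity_mult\<close> forces
  \<open>X + K' X = 0\<close>.\<close>

lemma velocity_inv:
  assumes c: "velocity c X" shows "velocity (\<lambda>t. inv (c t)) (- X)"
proof -
  have "plot (\<phi> ` U) (\<lambda>x. inv (\<psi> x))" by (intro plot_inv plot_psi)
  moreover have "e \<in> \<phi> ` U \<inter> (\<lambda>x. inv (\<psi> x)) -` U" using e_in one_in_U by simp
  ultimately obtain K' where "((\<lambda>x. \<phi> (inv (\<psi> x))) has_derivative K') (at e)"
    using smooth_on_has_derivative[OF plot_smooth[OF _ U_chart]] by blast
  from velocity_has_derivative[OF c this, of "\<lambda>t. \<phi> (inv (c t))"]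
  have v: "velocity (\<lambda>t. inv (c t)) (K' X)" using c by (auto simp: velocity_def intro: isCont_inv)
  have "velocity (\<lambda>t. \<one>) (X + K' X)" using velocity_mult[OF c v] by simp
  then have "X + K' X = 0" using velocity_unique velocity_const by blast
  then have "K' X = - X" by (simp add: eq_neg_iff_add_eq_0 add.commute)
  with v show ?thesis by simp
qed

text \<open>This replaces uniqueness for differential equations: two solutions of a left-invariant equation have a
  quotient with zero velocity.\<close>

lemma constant_if_velocity_zero:
  fixes k :: "real \<Rightarrow> 'a"
  assumes I: "open I" "connected I" "continuous_on I k"
    and k: "\<And>t. t \<in> I \<Longrightarrow> \<exists>a b m. velocity m 0 \<and> (\<exists>d>0. \<forall>r. \<bar>r\<bar> < d \<longrightarrow> k (t + r) = a \<otimes> m r \<otimes> b)"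
    and st: "s \<in> I" "t \<in> I"
  shows "k s = k t"
proof (rule connected_local_const[OF I(2) st], rule ballI)
  fix t assume t: "t \<in> I"
  obtain V \<kappa> where V: "(V, \<kappa>) \<in> A" "k t \<in> V" using ex_chart by blast
  have "open (I \<inter> k -` V)" using I chart(1)[OF V(1)] continuous_on_open_vimage by (metis Int_commute)
  then obtain d where d: "d > 0" "ball t d \<subseteq> I \<inter> k -` V" using t V openE by blast
  have "((\<lambda>t. \<kappa> (k t)) has_vector_derivative 0) (at s within ball t d)" if s: "s \<in> ball t d" for s
  proof -
    have sI: "s \<in> I" "k s \<in> V" using d s by auto
    obtain a b m d' where m: "velocity m 0" "d' > 0" "\<And>r. \<bar>r\<bar> < d' \<Longrightarrow> k (s + r) = a \<otimes> m r \<otimes> b"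
      using k[OF sI(1)] by blast
    have ab: "a \<otimes> b \<in> V" using m(3)[of 0] m(1,2) sI(2) by (simp add: velocity_def)
    obtain K' where K: "((\<lambda>x. \<kappa> (a \<otimes> \<psi> x \<otimes> b)) has_derivative K') (at e)"
      using smooth_chart_translate[OF V(1) ab] .
    have "((\<lambda>r. \<kappa> (a \<otimes> m r \<otimes> b)) has_vector_derivative K' 0) (at 0)"
      by (rule velocity_has_derivative[OF m(1) K]) simp
    then have "((\<lambda>r. \<kappa> (a \<otimes> m r \<otimes> b)) has_vector_derivative 0) (at 0)"
      using linear_0[OF has_derivative_linear[OF K]] by simp
    then have "((\<lambda>r. \<kappa> (k (s + r))) has_vector_derivative 0) (at 0)"
      by (rule has_vector_derivative_transform_within_open[of _ _ _ "ball 0 d'"])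
        (use m in \<open>auto simp: dist_real_def\<close>)
    then have "((\<lambda>r. \<kappa> (k (s + r))) has_vector_derivative 0) (at (s - s))" by simp
    moreover have "((\<lambda>u. u - s) has_vector_derivative 1) (at s)"
      by (auto intro!: derivative_eq_intros)
    ultimately have "((\<lambda>t. \<kappa> (k t)) has_vector_derivative 0) (at s)"
      using vector_diff_chain_at[of "\<lambda>u. u - s" 1 s "\<lambda>r. \<kappa> (k (s + r))" 0] by (simp add: o_def)
    then show ?thesis using has_vector_derivative_at_within by blast
  qed
  then obtain c where c: "\<And>s. s \<in> ball t d \<Longrightarrow> \<kappa> (k s) = c"
    using has_vector_derivative_zero_constant[of "ball t d" "\<lambda>t. \<kappa> (k t)"] convex_ball by blast
  have "k t = k s" if "s \<in> ball t d" for s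
    using c[OF that] c[of t] d that V(2) by (intro inj_onD[OF chart(5)[OF V(1)]]) auto
  then show "\<forall>\<^sub>F s in at t within I. k t = k s"
    unfolding eventually_at using d(1) by (intro exI[of _ d]) (auto simp: dist_commute)
qed

section \<open>Uniqueness and existence of one-parameter subgroups\<close>

lemma one_parameter_subgroup_velocity:
  assumes "one_parameter_subgroup G A \<phi> X \<gamma>" shows "velocity \<gamma> X"
proof -
  have *: "plot UNIV \<gamma>" "\<And>s t. \<gamma> (s + t) = \<gamma> s \<otimes> \<gamma> t" "((\<lambda>t. \<phi> (\<gamma> t)) has_vector_derivative X) (at 0)"
    using assms by (auto simp: one_parameter_subgroup_iff)
  have "\<gamma> 0 = \<one>" using *(2)[of 0 0] by (metis UNIV_I add_0 carrier_UNIV r_cancel_one')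
  then show ?thesis using * plot_continuous[OF *(1)] continuous_on_eq_continuous_at[OF open_UNIV]
    by (auto simp: velocity_def)
qed

lemma one_parameter_subgroup_0: "one_parameter_subgroup G A \<phi> X \<gamma> \<Longrightarrow> \<gamma> 0 = \<one>"
  using one_parameter_subgroup_velocity velocity_def by blast

lemma one_parameter_subgroup_minus: "one_parameter_subgroup G A \<phi> X \<gamma> \<Longrightarrow> \<gamma> (- t) = inv (\<gamma> t)"
proof -
  assume *: "one_parameter_subgroup G A \<phi> X \<gamma>"
  then have "\<gamma> (- t) \<otimes> \<gamma> t = \<one>" using one_parameter_subgroup_0[OF *] one_parameter_subgroup_iff by (metis add.left_inverse)
  then show ?thesis by (metis UNIV_I carrier_UNIV inv_equality)
qed

text \<open>The quotient \<open>?h\<close> has velocity \<open>X - X\<close>, and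
  \<open>?h (t + r)\<close> is \<open>?h r\<close> between the fixed factors
  \<open>\<gamma> t\<close> and \<open>inv (\<delta> t)\<close>, so
  \<open>constant_if_velocity_zero\<close> applies.\<close>

lemma one_parameter_subgroup_unique:
  assumes c: "one_parameter_subgroup G A \<phi> X \<gamma>" and d: "one_parameter_subgroup G A \<phi> X \<delta>"
  shows "\<gamma> = \<delta>"
proof
  fix t
  have *: "plot UNIV \<gamma>" "\<And>s t. \<gamma> (s + t) = \<gamma> s \<otimes> \<gamma> t" "plot UNIV \<delta>" "\<And>s t. \<delta> (s + t) = \<delta> s \<otimes> \<delta> t"
    using assms by (auto simp: one_parameter_subgroup_iff)
  let ?h = "\<lambda>t. \<gamma> t \<otimes> inv (\<delta> t)"
  have "?h t = ?h 0"
  proof (rule constant_if_velocity_zero[of UNIV])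
    show "continuous_on UNIV ?h" by (intro continuous_on_mult continuous_on_inverse plot_continuous *)
    fix t
    have "velocity ?h (X + - X)"
      by (intro velocity_mult velocity_inv one_parameter_subgroup_velocity c d)
    moreover have "?h (t + r) = \<gamma> t \<otimes> ?h r \<otimes> inv (\<delta> t)" for r
      by (simp add: * inv_mult_group m_assoc)
    ultimately show "\<exists>a b m. velocity m 0 \<and> (\<exists>d>0. \<forall>r. \<bar>r\<bar> < d \<longrightarrow> ?h (t + r) = a \<otimes> m r \<otimes> b)"
      by (intro exI[of _ "\<gamma> t"] exI[of _ "inv (\<delta> t)"] exI[of _ ?h]) (auto intro!: exI[of _ 1])
  qed auto
  then have "\<gamma> t \<otimes> inv (\<delta> t) = \<one>" using one_parameter_subgroup_0[OF c] one_parameter_subgroup_0[OF d] by simp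
  then show "\<gamma> t = \<delta> t" by (metis UNIV_I carrier_UNIV inv_equality inv_inv)
qed

abbreviation lf :: "'b \<Rightarrow> 'b \<Rightarrow> 'b" where "lf X \<equiv> left_invariant_field G U \<phi> X"

lemma chart_mult_eq: "chart_mult G U \<phi> x = (\<lambda>y. \<mu> (x, y))"
  by (simp add: chart_mult_def[abs_def] \<mu>_def)

lemma lf_eq: "x \<in> \<phi> ` U \<Longrightarrow> lf X x = D\<mu> (x, e) (0, X)"
  unfolding left_invariant_field_def chart_mult_eq
  using frechet_derivative_at[OF mu_derivative_right[OF mu_dom_e(1)]] by metis

lemma smooth_on_Pair_const: "smooth_on S (\<lambda>x. (x, c))" "smooth_on S (\<lambda>x. (c, x))"
  by (intro smooth_on_Pair smooth_on_id smooth_on_const)+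

lemma lf_smooth: "smooth_on (\<phi> ` U) (lf X)"
proof (rule smooth_on_cong[OF U_facts(2)])
  show "smooth_on (\<phi> ` U) (\<lambda>x. D\<mu> (x, e) (0, X))"
    by (rule smooth_on_compose[OF smooth_on_Pair_const(1) smooth_on_frechet_derivative[OF mu_dom_open mu_smooth]])
      (auto intro: mu_dom_e(1))
qed (simp add: lf_eq)

lemma lf_e: "lf X e = X"
  by (simp add: lf_eq e_in Dmu_e)

text \<open>Left translation by \<open>inv (\<psi> (c t))\<close> undoes left translation by
  \<open>\<psi> (c t)\<close>, so its derivative \<open>M'\<close> sends \<open>lf X (c t)\<close>
  back to \<open>X\<close>.\<close>

lemma integral_curve_velocity:
  assumes c: "c t \<in> \<phi> ` U" "(c has_vector_derivative lf X (c t)) (at t)"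
  shows "velocity (\<lambda>r. inv (\<psi> (c t)) \<otimes> \<psi> (c (t + r))) X"
proof -
  let ?M = "\<lambda>y. \<phi> (inv (\<psi> (c t)) \<otimes> \<psi> y)"
  have p: "plot (\<phi> ` U) (\<lambda>y. inv (\<psi> (c t)) \<otimes> \<psi> y)"
    by (intro plot_mult plot_const plot_psi U_facts)
  have "c t \<in> \<phi> ` U \<inter> (\<lambda>y. inv (\<psi> (c t)) \<otimes> \<psi> y) -` U" using c(1) one_in_U by simp
  from smooth_on_has_derivative[OF plot_smooth[OF p U_chart] this]
  obtain M' where M': "(?M has_derivative M') (at (c t))" by blast
  have d: "((\<lambda>y. \<mu> (c t, y)) has_derivative (\<lambda>Y. D\<mu> (c t, e) (0, Y))) (at e)"
    by (rule mu_derivative_right[OF mu_dom_e(1)[OF c(1)]])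
  have "((\<lambda>y. ?M (\<mu> (c t, y))) has_derivative (\<lambda>Y. M' (D\<mu> (c t, e) (0, Y)))) (at e)"
    by (rule has_derivative_compose[OF d]) (simp add: mu_e c(1) M')
  then have "((\<lambda>y. y) has_derivative (\<lambda>Y. M' (D\<mu> (c t, e) (0, Y)))) (at e)"
  proof (rule has_derivative_transform_within_open)
    show "open (Pair (c t) -` \<mu>_dom)" by (rule open_vimage[OF mu_dom_open]) (intro continuous_intros)
    show "e \<in> Pair (c t) -` \<mu>_dom" using mu_dom_e(1)[OF c(1)] by simp
    fix y assume "y \<in> Pair (c t) -` \<mu>_dom"
    then have "y \<in> \<phi> ` U" "\<psi> (c t) \<otimes> \<psi> y \<in> U" by (auto simp: \<mu>_dom_def split: if_splits)
    then show "?M (\<mu> (c t, y)) = y" by (simp add: \<mu>_def)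
  qed
  then have "(\<lambda>Y. M' (D\<mu> (c t, e) (0, Y))) = (\<lambda>Y. Y)"
    using has_derivative_unique has_derivative_ident by blast
  then have M'X: "M' (lf X (c t)) = X" unfolding lf_eq[OF c(1)] by metis
  have "(c has_vector_derivative lf X (c t)) (at (t + 0))" using c(2) by simp
  moreover have "((\<lambda>r. t + r) has_vector_derivative 1) (at 0)" by (auto intro!: derivative_eq_intros)
  ultimately have cs: "((\<lambda>r. c (t + r)) has_vector_derivative lf X (c t)) (at 0)"
    using vector_diff_chain_at[of "\<lambda>r. t + r" 1 0 c] by (simp add: o_def)
  have "((\<lambda>r. ?M (c (t + r))) has_derivative (\<lambda>h. M' (h *\<^sub>R lf X (c t)))) (at 0)"
    by (rule has_derivative_compose[OF cs[unfolded has_vector_derivative_def]]) (simp add: M')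
  then have deriv: "((\<lambda>r. ?M (c (t + r))) has_vector_derivative X) (at 0)"
    by (simp add: has_vector_derivative_def linear_scale[OF has_derivative_linear[OF M']] M'X)
  have "isCont \<psi> (c t)" using U_facts(2,4) c(1) continuous_on_eq_continuous_at by blast
  moreover have "isCont (\<lambda>r. c (t + r)) 0" using cs has_vector_derivative_continuous by blast
  ultimately have "isCont (\<lambda>r. \<psi> (c (t + r))) 0" by (intro isCont_o2[of 0 "\<lambda>r. c (t + r)" \<psi>]) auto
  then show ?thesis using deriv by (auto simp: velocity_def intro!: isCont_mult)
qed

text \<open>For fixed \<open>s\<close>, both \<open>g s \<otimes> g t\<close> and
  \<open>g (s + t)\<close> follow the left-invariant field, so their quotient \<open>?k\<close> is
  constant in \<open>t\<close>. The radius \<open>\<epsilon>/2\<close> keeps \<open>s + t\<close>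
  where \<open>g\<close> solves the equation.\<close>

lemma local_one_parameter_subgroup:
  obtains g \<epsilon> where "\<epsilon> > 0" "plot {-\<epsilon><..<\<epsilon>} g" "velocity g X"
    "\<And>s t. \<bar>s\<bar> < \<epsilon>/2 \<Longrightarrow> \<bar>t\<bar> < \<epsilon>/2 \<Longrightarrow> g (s + t) = g s \<otimes> g t"
proof -
  obtain c \<epsilon> where c: "\<epsilon> > 0" "c 0 = e" "\<And>t. \<bar>t\<bar> < \<epsilon> \<Longrightarrow> c t \<in> \<phi> ` U"
    "\<And>t. \<bar>t\<bar> < \<epsilon> \<Longrightarrow> (c has_vector_derivative lf X (c t)) (at t)"
    by (rule integral_curve_exists[OF U_facts(2) lf_smooth[of X] e_in]) (rule that; assumption)
  define g where "g t = \<psi> (c t)" for t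
  have c': "c t \<in> \<phi> ` U" "(c has_vector_derivative lf X (c t)) (at t)" if "t \<in> {-\<epsilon><..<\<epsilon>}" for t
    using that c by auto
  have "smooth_on {-\<epsilon><..<\<epsilon>} c" by (rule integral_curve_smooth[OF lf_smooth c'])
  then have p: "plot {-\<epsilon><..<\<epsilon>} g"
    unfolding g_def using c' by (intro plot_compose[OF plot_psi]) auto
  have vel: "velocity (\<lambda>r. inv (g t) \<otimes> g (t + r)) X" if "\<bar>t\<bar> < \<epsilon>" for t
    unfolding g_def by (rule integral_curve_velocity) (use c that in auto)
  have g0: "g 0 = \<one>" by (simp add: g_def c)
  have "velocity g X" using vel[of 0] c(1) by (simp add: g0)
  moreover have "g (s + t) = g s \<otimes> g t" if st: "\<bar>s\<bar> < \<epsilon>/2" "\<bar>t\<bar> < \<epsilon>/2" for s t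
  proof -
    let ?I = "{-(\<epsilon>/2)<..<\<epsilon>/2}"
    let ?k = "\<lambda>t. g s \<otimes> g t \<otimes> inv (g (s + t))"
    have "?k t = ?k 0"
    proof (rule constant_if_velocity_zero[of ?I])
      have sh: "plot ?I (\<lambda>t. g (s + t))"
        by (rule plot_compose[OF p]) (use st in \<open>auto simp: abs_less_iff intro!: smooth_on_add smooth_on_id smooth_on_const\<close>)
      have "plot ?I g" by (rule plot_subset[OF p]) auto
      then show "continuous_on ?I ?k"
        using sh by (intro continuous_on_mult continuous_on_inverse plot_continuous) (auto intro: plot_const)
      fix t assume t: "t \<in> ?I"
      then have "\<bar>t\<bar> < \<epsilon>" "\<bar>s + t\<bar> < \<epsilon>" using st by auto
      then have "velocity (\<lambda>r. (inv (g t) \<otimes> g (t + r)) \<otimes> inv (inv (g (s + t)) \<otimes> g (s + t + r))) (X + - X)"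
        by (intro velocity_mult velocity_inv vel)
      \<comment> \<open>The middle factor is a quotient of two curves of velocity \<open>X\<close>,
        hence has velocity 0; the outer factors do not depend on \<open>r\<close>.\<close>
      moreover have "?k (t + r) = (g s \<otimes> g t) \<otimes> ((inv (g t) \<otimes> g (t + r)) \<otimes> inv (inv (g (s + t)) \<otimes> g (s + t + r))) \<otimes> inv (g (s + t))" for r
        by (simp add: inv_mult_group m_assoc add.assoc)
      ultimately show "\<exists>a b m. velocity m 0 \<and> (\<exists>d>0. \<forall>r. \<bar>r\<bar> < d \<longrightarrow> ?k (t + r) = a \<otimes> m r \<otimes> b)"
        by (intro exI[of _ "g s \<otimes> g t"] exI[of _ "inv (g (s + t))"] exI[of _ "\<lambda>r. (inv (g t) \<otimes> g (t + r)) \<otimes> inv (inv (g (s + t)) \<otimes> g (s + t + r))"])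
          (auto intro!: exI[of _ 1])
    qed (use st c(1) in \<open>auto simp: abs_less_iff\<close>)
    then have "?k t = \<one>" using g0 by simp
    then show ?thesis by (metis UNIV_I carrier_UNIV inv_equality inv_inv)
  qed
  ultimately show thesis using that c(1) p by blast
qed

text \<open>A local solution \<open>g\<close> extends to all times by \<open>\<gamma> t = g (t / 2\<^sup>n)\<close> raised to the power \<open>2\<^sup>n\<close>, \<open>n\<close> large.\<close>

lemma one_parameter_subgroup_exists: "\<exists>\<gamma>. one_parameter_subgroup G A \<phi> X \<gamma>"
proof -
  obtain g \<epsilon> where g: "\<epsilon> > 0" "plot {-\<epsilon><..<\<epsilon>} g" "velocity g X"
    "\<And>s t. \<bar>s\<bar> < \<epsilon>/2 \<Longrightarrow> \<bar>t\<bar> < \<epsilon>/2 \<Longrightarrow> g (s + t) = g s \<otimes> g t"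
    by (rule local_one_parameter_subgroup[of X]) (rule that; assumption)
  define small where "small n t \<longleftrightarrow> \<bar>t\<bar> / 2 ^ n < \<epsilon>/2" for n t
  define p where "p n t = g (t / 2 ^ n) [^] ((2::nat) ^ n)" for n t
  have small_mono: "small n t \<Longrightarrow> n \<le> m \<Longrightarrow> small m t" for n m t
  proof -
    assume "small n t" "n \<le> m"
    moreover have "\<bar>t\<bar> / 2 ^ m \<le> \<bar>t\<bar> / 2 ^ n" using \<open>n \<le> m\<close> by (intro divide_left_mono) auto
    ultimately show ?thesis unfolding small_def by linarith
  qed
  have small_ex: "\<exists>n. small n t" for t
  proof -
    obtain n where "\<bar>t\<bar> / (\<epsilon>/2) < 2 ^ n" using real_arch_pow[of 2] by auto
    then show ?thesis using g(1) by (auto simp: small_def field_simps)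
  qed
  have step: "p (Suc n) t = p n t" if "small n t" for n t
  proof -
    have s: "\<bar>t / 2 ^ Suc n\<bar> < \<epsilon>/2" using small_mono[OF that, of "Suc n"] by (simp add: small_def)
    have "g (t / 2 ^ n) = g (t / 2 ^ Suc n + t / 2 ^ Suc n)" by simp
    also have "\<dots> = g (t / 2 ^ Suc n) \<otimes> g (t / 2 ^ Suc n)" by (rule g(4)[OF s s])
    also have "\<dots> = g (t / 2 ^ Suc n) [^] (2::nat)" by (simp add: numeral_2_eq_2)
    finally show ?thesis by (simp add: p_def nat_pow_pow)
  qed
  have stable: "p m t = p n t" if "small n t" "n \<le> m" for n m t
    using that(2) by (induction rule: dec_induct) (use step small_mono[OF that(1)] in auto)
  define \<gamma> where "\<gamma> t = p (SOME n. small n t) t" for t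
  have \<gamma>: "\<gamma> t = p n t" if "small n t" for n t
  proof -
    have s: "small (SOME n. small n t) t" using small_ex by (rule someI_ex)
    show ?thesis unfolding \<gamma>_def
      using stable[OF s, of "max n (SOME n. small n t)"] stable[OF that, of "max n (SOME n. small n t)"] by simp
  qed
  have near: "\<gamma> t = g t" if "\<bar>t\<bar> < \<epsilon>/2" for t
    using \<gamma>[of 0 t] that by (simp add: small_def p_def)
  have hom: "\<gamma> (s + t) = \<gamma> s \<otimes> \<gamma> t" for s t
  proof -
    obtain a b c where "small a s" "small b t" "small c (s + t)" using small_ex by meson
    then obtain n where n: "small n s" "small n t" "small n (s + t)"
      using small_mono[of a s "max a (max b c)"] small_mono[of b t "max a (max b c)"]
        small_mono[of c "s + t" "max a (max b c)"] by auto
    have st: "\<bar>s / 2 ^ n\<bar> < \<epsilon>/2" "\<bar>t / 2 ^ n\<bar> < \<epsilon>/2" using n by (auto simp: small_def)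
    have 1: "g ((s + t) / 2 ^ n) = g (s / 2 ^ n) \<otimes> g (t / 2 ^ n)"
      using g(4)[OF st] by (simp add: add_divide_distrib)
    \<comment> \<open>Commuting factors are what lets the power distribute over the product.\<close>
    have "g (s / 2 ^ n) \<otimes> g (t / 2 ^ n) = g (t / 2 ^ n) \<otimes> g (s / 2 ^ n)"
      using g(4)[OF st] g(4)[OF st(2,1)] by (simp add: add.commute)
    then have "p n (s + t) = p n s \<otimes> p n t" unfolding p_def 1 by (intro pow_mult_distrib) auto
    then show ?thesis using \<gamma> n by simp
  qed
  \<comment> \<open>Near any \<open>t0\<close> the curve is a left translate of the smooth local
    solution.\<close>
  have "plot UNIV \<gamma>"
  proof (rule plot_local)
    fix t0 :: real
    let ?T = "{t0 - \<epsilon>/2<..<t0 + \<epsilon>/2}"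
    have "plot ?T (\<lambda>t. g (t + - t0))"
      by (rule plot_compose[OF g(2) _ smooth_on_add[OF smooth_on_id smooth_on_const]]) (use g(1) in auto)
    then have "plot ?T (\<lambda>t. \<gamma> t0 \<otimes> g (t + - t0))" by (intro plot_mult plot_const) auto
    moreover have "\<gamma> t = \<gamma> t0 \<otimes> g (t + - t0)" if "t \<in> ?T" for t
    proof -
      have "\<bar>t + - t0\<bar> < \<epsilon>/2" using that unfolding greaterThanLessThan_iff by linarith
      from near[OF this] hom[of t0 "t + - t0"] show ?thesis by simp
    qed
    moreover have "t0 \<in> ?T" using g(1) by simp
    ultimately show "\<exists>T g. t0 \<in> T \<and> plot T g \<and> (\<forall>y\<in>T. \<gamma> y = g y)" by blast
  qed simp
  moreover have "((\<lambda>t. \<phi> (\<gamma> t)) has_vector_derivative X) (at 0)"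
    by (rule has_vector_derivative_transform_within_open[of "\<lambda>t. \<phi> (g t)" _ _ "{-(\<epsilon>/2)<..<\<epsilon>/2}"])
      (use g near in \<open>auto simp: velocity_def abs_less_iff\<close>)
  ultimately show ?thesis using hom one_parameter_subgroup_iff by blast
qed

section \<open>The exponential map\<close>

definition ex :: "'b \<Rightarrow> 'a" where "ex X = lie_exp G A \<phi> X"

lemma one_parameter_subgroup_scale:
  assumes "one_parameter_subgroup G A \<phi> X \<gamma>"
  shows "one_parameter_subgroup G A \<phi> (r *\<^sub>R X) (\<lambda>t. \<gamma> (r * t))"
  unfolding one_parameter_subgroup_iff
proof (intro conjI allI)
  have *: "plot UNIV \<gamma>" "\<And>s t. \<gamma> (s + t) = \<gamma> s \<otimes> \<gamma> t"
    using assms by (auto simp: one_parameter_subgroup_iff)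
  show "plot UNIV (\<lambda>t. \<gamma> (r * t))"
    by (rule plot_compose[OF *(1)]) (auto intro: smooth_on_bounded_linear bounded_linear_mult_right)
  show "\<gamma> (r * (s + t)) = \<gamma> (r * s) \<otimes> \<gamma> (r * t)" for s t by (simp add: distrib_left *)
  show "((\<lambda>t. \<phi> (\<gamma> (r * t))) has_vector_derivative r *\<^sub>R X) (at 0)"
    using velocity_scale[OF one_parameter_subgroup_velocity[OF assms], of r] unfolding velocity_def by (elim conjE)
qed

lemma ex_unique: "one_parameter_subgroup G A \<phi> X \<gamma> \<Longrightarrow> \<gamma> t = ex (t *\<^sub>R X)"
proof -
  assume \<gamma>: "one_parameter_subgroup G A \<phi> X \<gamma>"
  have "(THE \<delta>. one_parameter_subgroup G A \<phi> (t *\<^sub>R X) \<delta>) = (\<lambda>s. \<gamma> (t * s))"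
    using one_parameter_subgroup_scale[OF \<gamma>] one_parameter_subgroup_unique by blast
  then show ?thesis by (simp add: ex_def lie_exp_def)
qed

lemma ex_one_parameter_subgroup: "one_parameter_subgroup G A \<phi> X (\<lambda>t. ex (t *\<^sub>R X))"
  using one_parameter_subgroup_exists[of X] ex_unique by (metis (no_types, lifting) ext)

lemma ex_plot: "plot UNIV (\<lambda>t. ex (t *\<^sub>R X))"
  and ex_add_scale: "ex ((s + t) *\<^sub>R X) = ex (s *\<^sub>R X) \<otimes> ex (t *\<^sub>R X)"
  using ex_one_parameter_subgroup[of X] unfolding one_parameter_subgroup_iff by blast+

lemma ex_velocity: "velocity (\<lambda>t. ex (t *\<^sub>R X)) X"
  using one_parameter_subgroup_velocity[OF ex_one_parameter_subgroup] .

lemma ex_0 [simp]: "ex 0 = \<one>"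
  using one_parameter_subgroup_0[OF ex_one_parameter_subgroup[of 0]] by simp

lemma ex_minus: "ex (- X) = inv (ex X)"
  using one_parameter_subgroup_minus[OF ex_one_parameter_subgroup[of X], of 1] by simp

end

section \<open>The adjoint action and the bracket\<close>

context charted_group
begin

section \<open>The adjoint representation\<close>

definition Ad :: "'a \<Rightarrow> 'b \<Rightarrow> 'b" where
  "Ad g = frechet_derivative (\<lambda>y. \<phi> (g \<otimes> \<psi> y \<otimes> inv g)) (at e)"

lemma Ad_has_derivative: "((\<lambda>y. \<phi> (g \<otimes> \<psi> y \<otimes> inv g)) has_derivative Ad g) (at e)"
proof -
  have "g \<otimes> inv g \<in> U" using one_in_U by simp
  from smooth_chart_translate[OF U_chart this]
  obtain K' where "((\<lambda>y. \<phi> (g \<otimes> \<psi> y \<otimes> inv g)) has_derivative K') (at e)" .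
  then show ?thesis unfolding Ad_def using frechet_derivative_at by blast
qed

lemma linear_Ad: "linear (Ad g)"
  using has_derivative_linear[OF Ad_has_derivative] .

lemma Ad_velocity:
  assumes c: "velocity c Y" shows "velocity (\<lambda>t. g \<otimes> c t \<otimes> inv g) (Ad g Y)"
proof -
  have "((\<lambda>t. \<phi> (g \<otimes> c t \<otimes> inv g)) has_vector_derivative Ad g Y) (at 0)"
    by (rule velocity_has_derivative[OF c Ad_has_derivative]) simp
  then show ?thesis using c by (auto simp: velocity_def intro!: isCont_mult)
qed

lemma Ad_one: "Ad \<one> Y = Y"
  using Ad_velocity[OF ex_velocity[of Y], of \<one>] ex_velocity[of Y] by (auto intro: velocity_unique)

lemma Ad_mult: "Ad (g \<otimes> h) Y = Ad g (Ad h Y)"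
proof (rule velocity_unique)
  show "velocity (\<lambda>t. (g \<otimes> h) \<otimes> ex (t *\<^sub>R Y) \<otimes> inv (g \<otimes> h)) (Ad (g \<otimes> h) Y)"
    by (rule Ad_velocity[OF ex_velocity])
  have "velocity (\<lambda>t. g \<otimes> (h \<otimes> ex (t *\<^sub>R Y) \<otimes> inv h) \<otimes> inv g) (Ad g (Ad h Y))"
    by (intro Ad_velocity ex_velocity)
  then show "velocity (\<lambda>t. (g \<otimes> h) \<otimes> ex (t *\<^sub>R Y) \<otimes> inv (g \<otimes> h)) (Ad g (Ad h Y))"
    by (simp add: inv_mult_group m_assoc)
qed

lemma conj_ex: "g \<otimes> ex Y \<otimes> inv g = ex (Ad g Y)"
proof -
  have "one_parameter_subgroup G A \<phi> (Ad g Y) (\<lambda>t. g \<otimes> ex (t *\<^sub>R Y) \<otimes> inv g)"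
    unfolding one_parameter_subgroup_iff
  proof (intro conjI allI)
    show "plot UNIV (\<lambda>t. g \<otimes> ex (t *\<^sub>R Y) \<otimes> inv g)" by (intro plot_mult plot_const ex_plot open_UNIV)
    show "g \<otimes> ex ((s + t) *\<^sub>R Y) \<otimes> inv g = (g \<otimes> ex (s *\<^sub>R Y) \<otimes> inv g) \<otimes> (g \<otimes> ex (t *\<^sub>R Y) \<otimes> inv g)" for s t
      unfolding ex_add_scale by (simp add: m_assoc)
    show "((\<lambda>t. \<phi> (g \<otimes> ex (t *\<^sub>R Y) \<otimes> inv g)) has_vector_derivative Ad g Y) (at 0)"
      using Ad_velocity[OF ex_velocity, of g Y] unfolding velocity_def by (elim conjE)
  qed
  from ex_unique[OF this, of 1] show ?thesis by simp
qed

section \<open>The bracket as a second derivative of multiplication\<close>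

definition M2 :: "'b \<times> 'b \<Rightarrow> 'b \<times> 'b \<Rightarrow> 'b" where
  "M2 v w = frechet_derivative (\<lambda>p. D\<mu> p v) (at (e, e)) w"

lemma M2_derivative: "((\<lambda>p. D\<mu> p v) has_derivative M2 v) (at (e, e))"
  unfolding M2_def[abs_def]
  using smooth_on_has_derivative[OF smooth_on_frechet_derivative[OF mu_dom_open mu_smooth] mu_dom_e(1)[OF e_in]] .

lemma M2_sym: "M2 v w = M2 w v"
  unfolding M2_def by (rule mixed_derivative_symmetric[OF mu_dom_open mu_smooth mu_dom_e(1)[OF e_in]])

lemma linear_M2: "linear (M2 v)"
  using has_derivative_linear[OF M2_derivative] .

abbreviation br :: "'b \<Rightarrow> 'b \<Rightarrow> 'b" where "br \<equiv> lie_bracket G U \<phi>"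

text \<open>The left-invariant field through \<open>Z\<close> is \<open>D\<mu> (x, e) (0, Z)\<close>
  at \<open>x\<close>. Its derivative at \<open>e\<close> is a mixed second derivative of
  multiplication, which the bracket antisymmetrizes.\<close>

lemma br_eq: "br X Y = M2 (0, Y) (X, 0) - M2 (0, X) (Y, 0)"
proof -
  have "frechet_derivative (lf Z) (at e) W = M2 (0, Z) (W, 0)" for Z W
  proof -
    have "((\<lambda>x. D\<mu> (x, e) (0, Z)) has_derivative (\<lambda>W. M2 (0, Z) (W, 0))) (at e)"
      by (rule has_derivative_compose[where f = "\<lambda>x. (x, e)", OF _ M2_derivative])
        (auto intro!: derivative_eq_intros)
    then have "(lf Z has_derivative (\<lambda>W. M2 (0, Z) (W, 0))) (at e)"
      by (rule has_derivative_transform_within_open[OF _ U_facts(2) e_in]) (simp add: lf_eq)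
    from frechet_derivative_at[OF this] show ?thesis by metis
  qed
  then show ?thesis by (simp add: lie_bracket_def field_bracket_def lf_e)
qed

lemma br_antisym: "br Y X = - br X Y"
  by (simp add: br_eq)

lemma linear_br: "linear (br X)"
proof -
  \<comment> \<open>\<open>linear_M2\<close> concerns the second argument; the symmetry of
    \<open>M2\<close> has moved \<open>Y\<close> there in the first summand.\<close>
  have "linear (\<lambda>Y. M2 (X, 0) (0, Y) - M2 (0, X) (Y, 0))"
  proof (intro linear_compose_sub)
    have "linear (M2 (X, 0) \<circ> (\<lambda>Y. (0, Y)))" "linear (M2 (0, X) \<circ> (\<lambda>Y. (Y, 0)))"
      by (intro linear_compose[OF _ linear_M2]; simp add: linear_iff)+
    then show "linear (\<lambda>Y. M2 (X, 0) (0, Y))" "linear (\<lambda>Y. M2 (0, X) (Y, 0))" by (simp_all add: o_def)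
  qed
  then show ?thesis using br_eq M2_sym[of "(0, Y)" "(X, 0)" for Y] by (simp add: br_eq[abs_def])
qed

lemmas br_simps = linear_add[OF linear_br] linear_diff[OF linear_br] linear_neg[OF linear_br]
  linear_0[OF linear_br] linear_scale[OF linear_br]

lemma br_left_simps:
  "br (X + X') Y = br X Y + br X' Y" "br (r *\<^sub>R X) Y = r *\<^sub>R br X Y" "br X X = 0"
proof -
  show "br (X + X') Y = br X Y + br X' Y"
    by (simp only: br_antisym[where X = Y] br_simps minus_add_distrib)
  show "br (r *\<^sub>R X) Y = r *\<^sub>R br X Y"
    by (simp only: br_antisym[where X = Y] br_simps scaleR_minus_right)
  show "br X X = 0" using br_antisym[of X X] by (simp add: eq_neg_iff_add_eq_0 flip: scaleR_2)
qed

lemma velocity_compose_right: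
  assumes "velocity c X" "(H has_derivative H') (at (e, e))"
  shows "((\<lambda>r. H (e, \<phi> (c r))) has_vector_derivative H' (0, X)) (at 0)"
proof -
  have "((\<lambda>y. H (e, y)) has_derivative (\<lambda>Y. H' (0, Y))) (at e)"
    by (rule has_derivative_compose[where f = "\<lambda>y. (e, y)", OF _ assms(2)]) (auto intro!: derivative_eq_intros)
  from velocity_has_derivative[OF assms(1) this] show ?thesis by simp
qed

lemma velocity_compose_left:
  assumes "velocity c X" "(H has_derivative H') (at (e, e))"
  shows "((\<lambda>r. H (\<phi> (c r), e)) has_vector_derivative H' (X, 0)) (at 0)"
proof -
  have "((\<lambda>y. H (y, e)) has_derivative (\<lambda>Y. H' (Y, 0))) (at e)"
    by (rule has_derivative_compose[where f = "\<lambda>y. (y, e)", OF _ assms(2)]) (auto intro!: derivative_eq_intros)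
  from velocity_has_derivative[OF assms(1) this] show ?thesis by simp
qed

text \<open>The derivative of \<open>g y = (g y g\<^sup>-\<^sup>1) g\<close> at \<open>y = \<one>\<close>. Differentiating it once more in \<open>g\<close>, the symmetry of
  second derivatives identifies the derivative of \<open>Ad\<close> with the bracket.\<close>

lemma left_right_translation:
  assumes "g \<in> U" shows "D\<mu> (\<phi> g, e) (0, Y) = D\<mu> (e, \<phi> g) (Ad g Y, 0)"
proof -
  have x: "\<phi> g \<in> \<phi> ` U" using assms by blast
  have "((\<lambda>y. \<mu> (\<phi> (g \<otimes> \<psi> y \<otimes> inv g), \<phi> g)) has_derivative (\<lambda>Y. D\<mu> (e, \<phi> g) (Ad g Y, 0))) (at e)"
    by (rule has_derivative_compose[OF Ad_has_derivative])
      (use mu_derivative_left[OF mu_dom_e(2)[OF x]] in simp)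
  then have "((\<lambda>y. \<mu> (\<phi> g, y)) has_derivative (\<lambda>Y. D\<mu> (e, \<phi> g) (Ad g Y, 0))) (at e)"
  proof (rule has_derivative_transform_within_open)
    have p: "plot (\<phi> ` U) (\<lambda>y. g \<otimes> \<psi> y \<otimes> inv g)"
      by (intro plot_mult plot_const plot_psi U_facts)
    show "open (\<phi> ` U \<inter> (\<lambda>y. g \<otimes> \<psi> y \<otimes> inv g) -` U)" by (rule plot_vimage_open[OF p U_facts(1)])
    show "e \<in> \<phi> ` U \<inter> (\<lambda>y. g \<otimes> \<psi> y \<otimes> inv g) -` U" using e_in one_in_U by simp
    fix y assume "y \<in> \<phi> ` U \<inter> (\<lambda>y. g \<otimes> \<psi> y \<otimes> inv g) -` U"
    then show "\<mu> (\<phi> (g \<otimes> \<psi> y \<otimes> inv g), \<phi> g) = \<mu> (\<phi> g, y)"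
      using assms by (simp add: \<mu>_def m_assoc)
  qed
  from has_derivative_unique[OF this mu_derivative_right[OF mu_dom_e(1)[OF x]]] show ?thesis by metis
qed

text \<open>Conjugation is jointly smooth in \<open>r\<close> and \<open>y\<close>, and
  \<open>Ad\<close> is its partial derivative in \<open>y\<close>. The value of the derivative in
  \<open>r\<close> is identified afterwards.\<close>

lemma Ad_ex_differentiable: "\<exists>A'. ((\<lambda>r. Ad (ex (r *\<^sub>R X)) Y) has_vector_derivative A') (at 0)"
proof -
  let ?k = "\<lambda>p. ex (fst p *\<^sub>R X) \<otimes> \<psi> (snd p) \<otimes> inv (ex (fst p *\<^sub>R X))"
  let ?S = "UNIV \<times> \<phi> ` U :: (real \<times> 'b) set"
  have S: "open ?S" by (intro open_Times open_UNIV U_facts)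
  have 1: "plot ?S (\<lambda>p. ex (fst p *\<^sub>R X))"
    by (rule plot_compose[OF ex_plot S smooth_on_bounded_linear[OF bounded_linear_fst]]) simp
  have 2: "plot ?S (\<lambda>p. \<psi> (snd p))"
    by (rule plot_compose[OF plot_psi S smooth_on_bounded_linear[OF bounded_linear_snd]]) auto
  have p: "plot ?S ?k" by (intro plot_mult plot_inv 1 2)
  define T where "T = ?S \<inter> ?k -` U"
  have T: "open T" unfolding T_def by (rule plot_vimage_open[OF p U_facts(1)])
  have sm: "smooth_on T (\<lambda>p. \<phi> (?k p))" unfolding T_def by (rule plot_smooth[OF p U_chart])
  have in_T: "(r, e) \<in> T" for r using e_in one_in_U by (simp add: T_def)
  have Ad: "Ad (ex (r *\<^sub>R X)) Y = frechet_derivative (\<lambda>p. \<phi> (?k p)) (at (r, e)) (0, Y)" for r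
  proof -
    have "((\<lambda>y. \<phi> (?k (r, y))) has_derivative (\<lambda>Y. frechet_derivative (\<lambda>p. \<phi> (?k p)) (at (r, e)) (0, Y))) (at e)"
      by (rule has_derivative_compose[where f = "\<lambda>y. (r, y)", OF _ smooth_on_has_derivative[OF sm in_T]])
        (auto intro!: derivative_eq_intros)
    then have "((\<lambda>y. \<phi> (ex (r *\<^sub>R X) \<otimes> \<psi> y \<otimes> inv ex (r *\<^sub>R X))) has_derivative
        (\<lambda>Y. frechet_derivative (\<lambda>p. \<phi> (?k p)) (at (r, e)) (0, Y))) (at e)" by simp
    from has_derivative_unique[OF Ad_has_derivative this] show ?thesis by metis
  qed
  have "smooth_on UNIV (\<lambda>r. frechet_derivative (\<lambda>p. \<phi> (?k p)) (at (r, e)) (0, Y))"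
    by (rule smooth_on_compose[OF smooth_on_Pair_const(1) smooth_on_frechet_derivative[OF T sm]]) (use in_T in auto)
  then have "(\<lambda>r. Ad (ex (r *\<^sub>R X)) Y) differentiable at 0"
    unfolding Ad by (rule smooth_on_imp_differentiable) simp
  then show ?thesis using vector_derivative_works by blast
qed

text \<open>\<open>left_right_translation\<close> is differentiated along
  \<open>ex (r *\<^sub>R X)\<close>: the left side yields \<open>M2 (0, Y) (X, 0)\<close>, the right
  side \<open>M2 (0, X) (Y, 0) + A'\<close>. Solving for \<open>A'\<close> gives the bracket. The
  sum over \<open>Basis\<close> is the product rule for a linear map and an argument that vary
  together.\<close>

lemma Ad_ex_derivative_0: "((\<lambda>r. Ad (ex (r *\<^sub>R X)) Y) has_vector_derivative br X Y) (at 0)"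
proof -
  let ?c = "\<lambda>r. ex (r *\<^sub>R X)"
  obtain A' where A': "((\<lambda>r. Ad (?c r) Y) has_vector_derivative A') (at 0)"
    using Ad_ex_differentiable by blast
  have L: "((\<lambda>r. D\<mu> (\<phi> (?c r), e) (0, Y)) has_vector_derivative M2 (0, Y) (X, 0)) (at 0)"
    by (rule velocity_compose_left[OF ex_velocity M2_derivative])
  have lin: "linear (\<lambda>Z. D\<mu> (e, \<phi> g) (Z, 0))" if "g \<in> U" for g
    using has_derivative_linear[OF mu_derivative_left[OF mu_dom_e(2)]] that by blast
  have R: "((\<lambda>r. \<Sum>b\<in>Basis. (Ad (?c r) Y \<bullet> b) *\<^sub>R D\<mu> (e, \<phi> (?c r)) (b, 0)) has_vector_derivative
      (\<Sum>b\<in>Basis. (Ad (?c 0) Y \<bullet> b) *\<^sub>R M2 (b, 0) (0, X) + (A' \<bullet> b) *\<^sub>R D\<mu> (e, \<phi> (?c 0)) (b, 0))) (at 0)"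
  proof (intro has_vector_derivative_sum has_vector_derivative_scaleR)
    fix b :: 'b
    show "((\<lambda>r. Ad (?c r) Y \<bullet> b) has_field_derivative A' \<bullet> b) (at 0)"
      using bounded_linear.has_vector_derivative[OF bounded_linear_inner_left A', of b]
      by (simp add: has_real_derivative_iff_has_vector_derivative)
    show "((\<lambda>r. D\<mu> (e, \<phi> (?c r)) (b, 0)) has_vector_derivative M2 (b, 0) (0, X)) (at 0)"
      by (rule velocity_compose_right[OF ex_velocity M2_derivative])
  qed
  have s1: "(\<Sum>b\<in>Basis. (Y \<bullet> b) *\<^sub>R M2 (b, 0) (0, X)) = M2 (0, X) (Y, 0)"
  proof -
    have "linear (M2 (0, X) \<circ> (\<lambda>Y. (Y, 0)))"
      by (intro linear_compose[OF _ linear_M2]) (simp add: linear_iff)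
    from linear_sum_Basis[OF this, of Y] show ?thesis by (simp add: M2_sym[of "(_, 0)"])
  qed
  have s2: "(\<Sum>b\<in>Basis. (A' \<bullet> b) *\<^sub>R D\<mu> (e, \<phi> (?c 0)) (b, 0)) = A'"
    by (simp add: Dmu_e euclidean_representation)
  have R': "((\<lambda>r. \<Sum>b\<in>Basis. (Ad (?c r) Y \<bullet> b) *\<^sub>R D\<mu> (e, \<phi> (?c r)) (b, 0)) has_vector_derivative
      (M2 (0, X) (Y, 0) + A')) (at 0)"
    using R unfolding sum.distrib s2 by (simp add: Ad_one s1)
  have "((\<lambda>r. D\<mu> (\<phi> (?c r), e) (0, Y)) has_vector_derivative (M2 (0, X) (Y, 0) + A')) (at 0)"
    unfolding has_vector_derivative_def
  proof (rule has_derivative_transform_eventually[OF R'[unfolded has_vector_derivative_def]])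
    have eq: "(\<Sum>b\<in>Basis. (Ad g Y \<bullet> b) *\<^sub>R D\<mu> (e, \<phi> g) (b, 0)) = D\<mu> (\<phi> g, e) (0, Y)" if "g \<in> U" for g
      using linear_sum_Basis[OF lin[OF that], of "Ad g Y"] left_right_translation[OF that] by simp
    show "\<forall>\<^sub>F r in at 0. (\<Sum>b\<in>Basis. (Ad (?c r) Y \<bullet> b) *\<^sub>R D\<mu> (e, \<phi> (?c r)) (b, 0)) = D\<mu> (\<phi> (?c r), e) (0, Y)"
      using velocity_eventually[OF ex_velocity] by eventually_elim (rule eq)
    show "(\<Sum>b\<in>Basis. (Ad (?c 0) Y \<bullet> b) *\<^sub>R D\<mu> (e, \<phi> (?c 0)) (b, 0)) = D\<mu> (\<phi> (?c 0), e) (0, Y)"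
      by (rule eq) (simp add: one_in_U)
  qed simp
  from vector_derivative_unique_at[OF L this] have "A' = br X Y" by (simp add: br_eq)
  then show ?thesis using A' by simp
qed

lemma Ad_ex_derivative:
  "((\<lambda>t. Ad (ex (t *\<^sub>R X)) Y) has_vector_derivative Ad (ex (t *\<^sub>R X)) (br X Y)) (at t)"
proof -
  have bl: "bounded_linear (Ad (ex (t *\<^sub>R X)))" using linear_Ad linear_conv_bounded_linear by blast
  have "((\<lambda>r. Ad (ex (t *\<^sub>R X)) (Ad (ex (r *\<^sub>R X)) Y)) has_vector_derivative Ad (ex (t *\<^sub>R X)) (br X Y)) (at (t - t))"
    using bounded_linear.has_vector_derivative[OF bl Ad_ex_derivative_0] by simp
  moreover have "((\<lambda>u. u - t) has_vector_derivative 1) (at t)" by (auto intro!: derivative_eq_intros)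
  ultimately have "((\<lambda>u. Ad (ex (t *\<^sub>R X)) (Ad (ex ((u - t) *\<^sub>R X)) Y)) has_vector_derivative Ad (ex (t *\<^sub>R X)) (br X Y)) (at t)"
    using vector_diff_chain_at[of "\<lambda>u. u - t" 1 t "\<lambda>r. Ad (ex (t *\<^sub>R X)) (Ad (ex (r *\<^sub>R X)) Y)"] by (simp add: o_def)
  moreover have "Ad (ex (t *\<^sub>R X)) (Ad (ex ((u - t) *\<^sub>R X)) Y) = Ad (ex (u *\<^sub>R X)) Y" for u
    using ex_add_scale[of t "u - t" X] by (simp flip: Ad_mult)
  ultimately show ?thesis by simp
qed

text \<open>Both sides equal \<open>Y\<close> at \<open>t = 0\<close>, and their derivatives agree
  by the induction hypothesis for \<open>br X Y\<close>, which \<open>br X\<close> kills one step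
  earlier.\<close>

lemma Ad_ex_formula:
  "(br X ^^ m) Y = 0 \<Longrightarrow> Ad (ex (t *\<^sub>R X)) Y = (\<Sum>k<m. (t ^ k / fact k) *\<^sub>R (br X ^^ k) Y)"
proof (induction m arbitrary: Y t)
  case 0 then show ?case using linear_0[OF linear_Ad] by simp
next
  case (Suc m)
  have "(br X ^^ m) (br X Y) = 0" using Suc.prems by (simp add: funpow_swap1)
  from Suc.IH[OF this] have IH: "Ad (ex (t *\<^sub>R X)) (br X Y) = (\<Sum>k<m. (t ^ k / fact k) *\<^sub>R (br X ^^ k) (br X Y))" for t .
  define f where "f t = Ad (ex (t *\<^sub>R X)) Y - (\<Sum>k<Suc m. (t ^ k / fact k) *\<^sub>R (br X ^^ k) Y)" for t
  have "(f has_vector_derivative 0) (at t)" for t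
  proof -
    have "((\<lambda>t. Y + (\<Sum>k<m. (t ^ Suc k / fact (Suc k)) *\<^sub>R (br X ^^ k) (br X Y))) has_vector_derivative
        0 + (\<Sum>k<m. (t ^ k / fact k) *\<^sub>R (br X ^^ k) (br X Y))) (at t)"
    proof (intro has_vector_derivative_add has_vector_derivative_const has_vector_derivative_sum)
      fix k
      have "((\<lambda>t. t ^ Suc k / fact (Suc k)) has_field_derivative (of_nat (Suc k) * t ^ k / fact (Suc k))) (at t)"
        using DERIV_cdivide[OF DERIV_pow[of "Suc k" t], of "fact (Suc k)"] by (simp del: power_Suc of_nat_Suc fact_Suc)
      moreover have "of_nat (Suc k) * t ^ k / fact (Suc k) = t ^ k / fact k"
        by (simp add: field_simps del: of_nat_Suc)
      ultimately have "((\<lambda>t. t ^ Suc k / fact (Suc k)) has_vector_derivative t ^ k / fact k) (at t)"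
        by (simp add: has_real_derivative_iff_has_vector_derivative)
      from bounded_linear.has_vector_derivative[OF bounded_linear_scaleR_left this]
      show "((\<lambda>t. (t ^ Suc k / fact (Suc k)) *\<^sub>R (br X ^^ k) (br X Y)) has_vector_derivative
        (t ^ k / fact k) *\<^sub>R (br X ^^ k) (br X Y)) (at t)" .
    qed
    moreover have "(\<Sum>k<Suc m. (t ^ k / fact k) *\<^sub>R (br X ^^ k) Y) =
        Y + (\<Sum>k<m. (t ^ Suc k / fact (Suc k)) *\<^sub>R (br X ^^ k) (br X Y))" for t
      by (subst sum.lessThan_Suc_shift) (simp add: funpow_swap1)
    ultimately have "((\<lambda>t. \<Sum>k<Suc m. (t ^ k / fact k) *\<^sub>R (br X ^^ k) Y) has_vector_derivative
       Ad (ex (t *\<^sub>R X)) (br X Y)) (at t)" by (simp only: IH add_0)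
    from has_vector_derivative_diff[OF Ad_ex_derivative[of X Y t] this] show ?thesis by (simp add: f_def[abs_def])
  qed
  then obtain c where c: "\<And>t. f t = c"
    using has_vector_derivative_zero_constant[of UNIV f] by auto
  have "f 0 = 0" unfolding f_def by (subst sum.lessThan_Suc_shift) (simp add: Ad_one)
  then have "f t = 0" using c by metis
  then show ?case by (simp add: f_def)
qed

section \<open>Exponentials of commuting vectors\<close>

lemma ex_commute:
  assumes "br X Y = 0" shows "ex X \<otimes> ex Y = ex Y \<otimes> ex X"
proof -
  have "Ad (ex X) Y = Y" using Ad_ex_formula[where m = 1 and t = 1 and X = X and Y = Y] assms by simp
  then have "ex X \<otimes> ex Y \<otimes> inv (ex X) = ex Y" by (simp add: conj_ex)
  then have "ex X \<otimes> ex Y \<otimes> inv (ex X) \<otimes> ex X = ex Y \<otimes> ex X" by simp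
  then show ?thesis by (simp add: m_assoc)
qed

lemma ex_add:
  assumes "br X Y = 0" shows "ex (X + Y) = ex X \<otimes> ex Y"
proof -
  have "one_parameter_subgroup G A \<phi> (X + Y) (\<lambda>t. ex (t *\<^sub>R X) \<otimes> ex (t *\<^sub>R Y))"
    unfolding one_parameter_subgroup_iff
  proof (intro conjI allI)
    show "plot UNIV (\<lambda>t. ex (t *\<^sub>R X) \<otimes> ex (t *\<^sub>R Y))" by (intro plot_mult ex_plot)
    fix s t :: real
    have "br (t *\<^sub>R X) (s *\<^sub>R Y) = 0" by (simp add: br_left_simps br_simps assms)
    from ex_commute[OF this] have "ex (t *\<^sub>R X) \<otimes> (ex (s *\<^sub>R Y) \<otimes> z) = ex (s *\<^sub>R Y) \<otimes> (ex (t *\<^sub>R X) \<otimes> z)" for z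
      by (metis UNIV_I carrier_UNIV m_assoc)
    then show "ex ((s + t) *\<^sub>R X) \<otimes> ex ((s + t) *\<^sub>R Y) = (ex (s *\<^sub>R X) \<otimes> ex (s *\<^sub>R Y)) \<otimes> (ex (t *\<^sub>R X) \<otimes> ex (t *\<^sub>R Y))"
      unfolding ex_add_scale by (simp add: m_assoc)
    show "((\<lambda>t. \<phi> (ex (t *\<^sub>R X) \<otimes> ex (t *\<^sub>R Y))) has_vector_derivative X + Y) (at 0)"
      using velocity_mult[OF ex_velocity[of X] ex_velocity[of Y]] unfolding velocity_def by (elim conjE)
  qed
  from ex_unique[OF this, of 1] show ?thesis by simp
qed

end

section \<open>Coordinates adapted to an abelian hyperplane\<close>

locale hyperplane_group = charted_group +
  fixes n :: 'b and N :: nat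
  assumes n: "norm n = 1"
    and hyperplane_ideal: "abelian_ideal (lie_bracket G U \<phi>) {v. n \<bullet> v = 0}"
    and n_nilpotent: "(lie_bracket G U \<phi> n ^^ N) v = 0"
begin

abbreviation V :: "'b set" where "V \<equiv> {v. n \<bullet> v = 0}"
abbreviation T :: "'b \<Rightarrow> 'b" where "T \<equiv> br n"
abbreviation E :: "real \<Rightarrow> 'b \<Rightarrow> 'b" where "E t \<equiv> Ad (ex (t *\<^sub>R n))"

text \<open>Nilpotency of \<open>T\<close> makes the series of \<open>Ad_ex_formula\<close> finite,
  so \<open>E t\<close> is the exponential of \<open>t T\<close>; its group law is the
  multiplicativity of \<open>Ad\<close>.\<close>

sublocale nilpotent_flow T N E
  by (rule nilpotent_flow.intro) (auto intro: linear_br n_nilpotent Ad_ex_formula simp: ex_add_scale Ad_mult)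

lemma nn [simp]: "n \<bullet> n = 1"
  using n by (simp add: dot_square_norm)

lemma subspace_V: "subspace V"
  and T_V: "v \<in> V \<Longrightarrow> T v \<in> V"
  and br_V: "v \<in> V \<Longrightarrow> w \<in> V \<Longrightarrow> br v w = 0"
  using hyperplane_ideal unfolding abelian_ideal_def by blast+

lemma T_n [simp]: "T n = 0"
  by (rule br_left_simps)

lemma E_V: "v \<in> V \<Longrightarrow> E t v \<in> V"
proof -
  assume v: "v \<in> V"
  have "(T ^^ k) v \<in> V" for k
    using v T_V by (induction k) auto
  then show ?thesis unfolding E_eq
    by (intro subspace_sum[OF subspace_V] subspace_scale[OF subspace_V])
qed

abbreviation pr :: "'b \<Rightarrow> 'b" where "pr Z \<equiv> Z - (n \<bullet> Z) *\<^sub>R n"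

lemma pr_V: "pr Z \<in> V"
  by (simp add: inner_diff_right)

lemma T_pr: "T (pr Z) = T Z"
  by (simp add: T_simps)

text \<open>Splitting off normal components leaves only brackets with \<open>n\<close>, because
  \<open>V\<close> is abelian; thus \<open>T\<close> determines the whole Lie algebra.\<close>

lemma br_formula: "br x y = (n \<bullet> x) *\<^sub>R T y - (n \<bullet> y) *\<^sub>R T x"
proof -
  have "br x y = br ((n \<bullet> x) *\<^sub>R n + pr x) ((n \<bullet> y) *\<^sub>R n + pr y)" by simp
  also have "\<dots> = (n \<bullet> x) *\<^sub>R T (pr y) + (n \<bullet> y) *\<^sub>R br (pr x) n"
    unfolding br_left_simps(1,2) br_simps(1,5) using br_V[OF pr_V pr_V, of x y] by (simp add: algebra_simps)
  also have "br (pr x) n = - T (pr x)" by (rule br_antisym)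
  finally show ?thesis by (simp add: T_pr)
qed

lemma ex_add_V: "v \<in> V \<Longrightarrow> w \<in> V \<Longrightarrow> ex (v + w) = ex v \<otimes> ex w"
  by (intro ex_add br_V)

section \<open>The semidirect product law and coordinates on the group\<close>

lemma semidirect_mult:
  assumes "v \<in> V" "w \<in> V"
  shows "(ex (t *\<^sub>R n) \<otimes> ex v) \<otimes> (ex (s *\<^sub>R n) \<otimes> ex w) = ex ((t + s) *\<^sub>R n) \<otimes> ex (E (-s) v + w)"
proof -
  have "ex (E (-s) v) = ex ((-s) *\<^sub>R n) \<otimes> ex v \<otimes> ex (s *\<^sub>R n)"
    using conj_ex[of "ex ((-s) *\<^sub>R n)" v] ex_minus[of "(-s) *\<^sub>R n"] by simp
  moreover have "ex ((t + s) *\<^sub>R n) \<otimes> ex ((-s) *\<^sub>R n) = ex (t *\<^sub>R n)"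
    using ex_add_scale[of "t + s" "-s" n] by simp
  then have "ex ((t + s) *\<^sub>R n) \<otimes> (ex ((-s) *\<^sub>R n) \<otimes> z) = ex (t *\<^sub>R n) \<otimes> z" for z
    by (metis UNIV_I carrier_UNIV m_assoc)
  ultimately show ?thesis using ex_add_V[OF E_V[OF assms(1)] assms(2), of "-s"] by (simp add: m_assoc)
qed

lemma semidirect_inv:
  assumes "v \<in> V" shows "inv (ex (t *\<^sub>R n) \<otimes> ex v) = ex ((-t) *\<^sub>R n) \<otimes> ex (- E t v)"
proof (rule inv_equality)
  have "- E t v \<in> V" using E_V[OF assms] by simp
  note m = semidirect_mult[OF this assms, of "-t" t]
  have "E (-t) (- E t v) + v = 0" by (simp only: E_simps(3) E_E_minus(1) left_minus)
  with m show "(ex ((-t) *\<^sub>R n) \<otimes> ex (- E t v)) \<otimes> (ex (t *\<^sub>R n) \<otimes> ex v) = \<one>"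
    by (simp only: left_minus scaleR_zero_left ex_0 r_one carrier_UNIV UNIV_I)
qed simp_all

text \<open>On the abelian ideal \<open>V\<close>, \<open>ex\<close> turns the basis expansion of
  \<open>pr Z\<close> into a finite product of one-parameter subgroups, each smooth in its
  coordinate of \<open>Z\<close>.\<close>

lemma plot_ex_V: "plot UNIV (\<lambda>Z. ex (pr Z))"
proof -
  have *: "plot UNIV (\<lambda>Z. ex (\<Sum>i\<in>I. (Z \<bullet> i) *\<^sub>R pr i))" if "finite I" for I
    using that
  proof induction
    case empty then show ?case by (simp add: plot_const)
  next
    case (insert i I)
    have "plot UNIV (\<lambda>Z. ex ((Z \<bullet> i) *\<^sub>R pr i))"
      by (rule plot_compose[OF ex_plot[of "pr i"]]) (auto intro: smooth_on_bounded_linear bounded_linear_inner_left)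
    then have "plot UNIV (\<lambda>Z. ex ((Z \<bullet> i) *\<^sub>R pr i) \<otimes> ex (\<Sum>i\<in>I. (Z \<bullet> i) *\<^sub>R pr i))"
      using insert.IH by (rule plot_mult)
    moreover have "ex ((Z \<bullet> i) *\<^sub>R pr i) \<otimes> ex (\<Sum>i\<in>I. (Z \<bullet> i) *\<^sub>R pr i) = ex (\<Sum>i\<in>insert i I. (Z \<bullet> i) *\<^sub>R pr i)" for Z
      unfolding sum.insert[OF insert.hyps]
      by (intro ex_add_V[symmetric] subspace_scale[OF subspace_V] subspace_sum[OF subspace_V] pr_V)
    ultimately show ?case by simp
  qed
  have "(\<Sum>i\<in>Basis. (Z \<bullet> i) *\<^sub>R pr i) = pr Z" for Z
  proof -
    have "linear pr" by (auto simp: linear_iff algebra_simps inner_add_right)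
    from linear_sum_Basis[OF this, of Z] show ?thesis by (rule sym)
  qed
  with *[OF finite_Basis] show ?thesis by (simp only:)
qed

text \<open>Canonical coordinates of the second kind for the splitting into the line of
  \<open>n\<close> and \<open>V\<close>; in them multiplication is the semidirect product
  law.\<close>

definition \<Phi> :: "'b \<Rightarrow> 'a" where "\<Phi> Z = ex ((n \<bullet> Z) *\<^sub>R n) \<otimes> ex (pr Z)"

lemma Phi_0 [simp]: "\<Phi> 0 = \<one>"
  by (simp add: \<Phi>_def)

lemma Phi_V: "v \<in> V \<Longrightarrow> \<Phi> v = ex v"
  by (simp add: \<Phi>_def)

lemma plot_Phi: "plot UNIV \<Phi>"
proof -
  have "plot UNIV (\<lambda>Z. ex ((n \<bullet> Z) *\<^sub>R n))"
    by (rule plot_compose[OF ex_plot[of n]]) (auto intro: smooth_on_bounded_linear bounded_linear_inner_right)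
  then show ?thesis unfolding \<Phi>_def[abs_def] by (intro plot_mult plot_ex_V)
qed

definition Phi_dom :: "'b set" where "Phi_dom = UNIV \<inter> \<Phi> -` U"

lemma Phi_dom_open: "open Phi_dom"
  unfolding Phi_dom_def by (rule plot_vimage_open[OF plot_Phi U_facts(1)])

lemma Phi_dom_0: "0 \<in> Phi_dom"
  by (simp add: Phi_dom_def one_in_U)

lemma phi_Phi_smooth: "smooth_on Phi_dom (\<lambda>Z. \<phi> (\<Phi> Z))"
  unfolding Phi_dom_def by (rule plot_smooth[OF plot_Phi U_chart])

lemma phi_Phi_derivative_0: "frechet_derivative (\<lambda>Z. \<phi> (\<Phi> Z)) (at 0) = id"
proof
  fix Z
  have "((\<lambda>s. \<phi> (\<Phi> (0 + s *\<^sub>R Z))) has_vector_derivative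
      frechet_derivative (\<lambda>Z. \<phi> (\<Phi> Z)) (at (0 + 0 *\<^sub>R Z)) Z) (at 0)"
    by (rule smooth_on_line_derivative[OF phi_Phi_smooth]) (simp add: Phi_dom_0)
  moreover have "velocity (\<lambda>s. \<Phi> (s *\<^sub>R Z)) Z"
  proof -
    have "velocity (\<lambda>s. ex (s *\<^sub>R ((n \<bullet> Z) *\<^sub>R n)) \<otimes> ex (s *\<^sub>R pr Z)) ((n \<bullet> Z) *\<^sub>R n + pr Z)"
      by (intro velocity_mult ex_velocity)
    then show ?thesis by (simp add: \<Phi>_def algebra_simps)
  qed
  ultimately show "frechet_derivative (\<lambda>Z. \<phi> (\<Phi> Z)) (at 0) Z = id Z"
    unfolding velocity_def using vector_derivative_unique_at by fastforce
qed

text \<open>The coordinate expression of \<open>\<Phi>\<close> has derivative \<open>id\<close> at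
  0. This is the injectivity half of the inverse function theorem, \<open>Phi_open_at_0\<close> the
  openness half.\<close>

lemma Phi_inj_near_0: obtains r where "r > 0" "inj_on \<Phi> (ball 0 r)"
proof -
  let ?F = "\<lambda>Z. \<phi> (\<Phi> Z)"
  obtain r where r: "r > 0" "ball 0 r \<subseteq> Phi_dom" "inj_on ?F (ball 0 r)"
  proof (rule has_derivative_locally_injective[of 0 Phi_dom id "\<lambda>x. frechet_derivative ?F (at x)" ?F])
    show "id \<circ> frechet_derivative ?F (at 0) = id" by (simp add: phi_Phi_derivative_0)
    show "(?F has_derivative frechet_derivative ?F (at x)) (at x)" if "x \<in> Phi_dom" for x
      using smooth_on_has_derivative[OF phi_Phi_smooth that] .
    show "\<exists>d>0. \<forall>x. dist 0 x < d \<longrightarrow> onorm (\<lambda>v. frechet_derivative ?F (at x) v - frechet_derivative ?F (at 0) v) < e"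
      if "e > 0" for e
      using smooth_on_frechet_onorm_continuous[OF Phi_dom_open phi_Phi_smooth Phi_dom_0 that] by blast
  qed (auto simp: Phi_dom_0 Phi_dom_open id_def)
  have "inj_on \<Phi> (ball 0 r)" using r(3) by (auto simp: inj_on_def)
  with r(1) that show thesis by blast
qed

lemma Phi_open_at_0:
  assumes "r > 0" obtains W where "open W" "\<one> \<in> W" "W \<subseteq> \<Phi> ` ball 0 r"
proof -
  let ?F = "\<lambda>Z. \<phi> (\<Phi> Z)"
  let ?T = "ball 0 r \<inter> Phi_dom"
  have "?F 0 \<in> interior (?F ` ?T)"
  proof (rule sussmann_open_mapping[OF Phi_dom_open smooth_on_imp_continuous_on[OF phi_Phi_smooth] Phi_dom_0])
    show "(?F has_derivative frechet_derivative ?F (at 0)) (at 0)"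
      using smooth_on_has_derivative[OF phi_Phi_smooth Phi_dom_0] .
    show "bounded_linear (id :: 'b \<Rightarrow> 'b)" by (simp add: id_def)
    show "frechet_derivative ?F (at 0) \<circ> id = id" by (simp add: phi_Phi_derivative_0)
    show "0 \<in> interior ?T" using assms Phi_dom_open Phi_dom_0 by (simp add: interior_open open_Int)
  qed simp
  then have e: "e \<in> interior (?F ` ?T)" by simp
  define W where "W = U \<inter> \<phi> -` interior (?F ` ?T)"
  have "open W" unfolding W_def
    using continuous_on_open_vimage[OF U_facts(1), THEN iffD1, OF U_facts(3)] open_interior by (metis Int_commute)
  moreover have "\<one> \<in> W" using e one_in_U by (simp add: W_def)
  moreover have "W \<subseteq> \<Phi> ` ball 0 r"
  proof
    fix g assume "g \<in> W"
    then have g: "g \<in> U" "\<phi> g \<in> ?F ` ?T" using interior_subset by (auto simp: W_def)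
    then obtain Z where Z: "Z \<in> ?T" "\<phi> g = \<phi> (\<Phi> Z)" by blast
    have "g = \<Phi> Z" using inj_onD[OF U_facts(5) Z(2)] g(1) Z(1) by (auto simp: Phi_dom_def)
    then show "g \<in> \<Phi> ` ball 0 r" using Z(1) by blast
  qed
  ultimately show thesis using that by blast
qed

lemma Phi_mult: "\<exists>Z. \<Phi> X \<otimes> \<Phi> Y = \<Phi> Z"
proof -
  have v: "E (- (n \<bullet> Y)) (pr X) + pr Y \<in> V"
    by (intro subspace_add[OF subspace_V] E_V pr_V)
  have "\<Phi> X \<otimes> \<Phi> Y = ex ((n \<bullet> X + n \<bullet> Y) *\<^sub>R n) \<otimes> ex (E (- (n \<bullet> Y)) (pr X) + pr Y)"
    unfolding \<Phi>_def by (rule semidirect_mult[OF pr_V pr_V])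
  also have "\<dots> = \<Phi> ((n \<bullet> X + n \<bullet> Y) *\<^sub>R n + (E (- (n \<bullet> Y)) (pr X) + pr Y))"
    using v by (simp add: \<Phi>_def inner_add_right)
  finally show ?thesis by blast
qed

lemma Phi_inv: "\<exists>Z. inv (\<Phi> X) = \<Phi> Z"
proof -
  have v: "- E (n \<bullet> X) (pr X) \<in> V"
    by (intro subspace_neg[OF subspace_V] E_V pr_V)
  have "inv (\<Phi> X) = ex ((- (n \<bullet> X)) *\<^sub>R n) \<otimes> ex (- E (n \<bullet> X) (pr X))"
    unfolding \<Phi>_def by (rule semidirect_inv[OF pr_V])
  also have "\<dots> = \<Phi> ((- (n \<bullet> X)) *\<^sub>R n + - E (n \<bullet> X) (pr X))"
    using v by (simp add: \<Phi>_def inner_diff_right)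
  finally show ?thesis by blast
qed

lemma open_translate: "open W \<Longrightarrow> open {x. g \<otimes> x \<in> W}" "open W \<Longrightarrow> open {x. x \<otimes> g \<in> W}"
proof -
  assume W: "open W"
  have "continuous_on UNIV (\<lambda>x. g \<otimes> x)" "continuous_on UNIV (\<lambda>x. x \<otimes> g)"
    by (intro continuous_on_mult continuous_intros)+
  from this[THEN open_vimage[OF W]] show "open {x. g \<otimes> x \<in> W}" "open {x. x \<otimes> g \<in> W}"
    by (simp_all add: vimage_def)
qed

text \<open>The range is a subgroup containing a neighbourhood \<open>W\<close> of
  \<open>\<one>\<close>; translates of \<open>W\<close> show that the range and its complement are
  open.\<close>

lemma Phi_surj:
  assumes "connected (UNIV :: 'a set)" shows "range \<Phi> = UNIV"
proof -
  obtain W where W: "open W" "\<one> \<in> W" "W \<subseteq> \<Phi> ` ball 0 1"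
    by (rule Phi_open_at_0[OF zero_less_one]) (rule that; assumption)
  have nbhd: "open {x. inv g \<otimes> x \<in> W}" "g \<in> {x. inv g \<otimes> x \<in> W}" for g
    using open_translate(1)[OF W(1)] W(2) by simp_all
  have "open (range \<Phi>)"
  proof (subst open_subopen, intro ballI)
    fix g assume g: "g \<in> range \<Phi>"
    have "{x. inv g \<otimes> x \<in> W} \<subseteq> range \<Phi>"
    proof clarify
      fix x assume "inv g \<otimes> x \<in> W"
      then obtain Z where "inv g \<otimes> x = \<Phi> Z" using W(3) by blast
      then have "x = g \<otimes> \<Phi> Z" using cancel_inv(2)[of g x] by simp
      moreover obtain X where "g = \<Phi> X" using g by blast
      ultimately show "x \<in> range \<Phi>" using Phi_mult[of X Z] by auto
    qed
    then show "\<exists>T. open T \<and> g \<in> T \<and> T \<subseteq> range \<Phi>" using nbhd by blast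
  qed
  moreover have "open (- range \<Phi>)"
  proof (subst open_subopen, intro ballI)
    fix g assume g: "g \<in> - range \<Phi>"
    have "{x. inv g \<otimes> x \<in> W} \<subseteq> - range \<Phi>"
    proof clarify
      fix Y assume "inv g \<otimes> \<Phi> Y \<in> W"
      then obtain Z where "inv g \<otimes> \<Phi> Y = \<Phi> Z" using W(3) by blast
      then have *: "g \<otimes> \<Phi> Z = \<Phi> Y" using cancel_inv(2)[of g "\<Phi> Y"] by simp
      obtain Z' where Z': "inv (\<Phi> Z) = \<Phi> Z'" using Phi_inv by blast
      have "g = \<Phi> Y \<otimes> \<Phi> Z'" unfolding *[symmetric] Z'[symmetric] by (simp add: m_assoc)
      then have "g \<in> range \<Phi>" using Phi_mult[of Y Z'] by auto
      then show False using g by simp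
    qed
    then show "\<exists>T. open T \<and> g \<in> T \<and> T \<subseteq> - range \<Phi>" using nbhd by blast
  qed
  ultimately show ?thesis
    using connectedD[OF assms, of "range \<Phi>" "- range \<Phi>"] by auto
qed

lemma continuous_E2: "continuous_on S (\<lambda>p. E (fst p) (snd p))"
proof -
  have "continuous_on S (\<lambda>p. \<Sum>k<N. (fst p ^ k / fact k) *\<^sub>R (T ^^ k) (snd p))"
  proof (intro continuous_on_sum continuous_on_scaleR)
    fix k
    have "continuous_on UNIV (T ^^ k)"
      using linear_T_pow by (intro linear_continuous_on) (simp add: linear_conv_bounded_linear)
    then show "continuous_on S (\<lambda>p. (T ^^ k) (snd p))"
      by (rule continuous_on_compose2) (auto intro: continuous_intros)
  qed (auto intro!: continuous_intros)
  then show ?thesis by (simp add: E_eq)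
qed

lemma E_bounded: obtains B where "\<And>t v. \<bar>t\<bar> \<le> c \<Longrightarrow> norm v \<le> d \<Longrightarrow> norm (E t v) \<le> B"
proof -
  have "compact ((\<lambda>p. E (fst p) (snd p)) ` ({-c..c} \<times> cball 0 d))"
    by (intro compact_continuous_image continuous_E2 compact_Times compact_Icc compact_cball)
  then obtain B where B: "\<forall>y\<in>(\<lambda>p. E (fst p) (snd p)) ` ({-c..c} \<times> cball 0 d). norm y \<le> B"
    using compact_imp_bounded bounded_iff by blast
  have "norm (E t v) \<le> B" if "\<bar>t\<bar> \<le> c" "norm v \<le> d" for t v
    using B that by (auto simp: abs_le_iff minus_le_iff)
  with that show thesis by blast
qed

text \<open>With \<open>u = v + (t/2) Tv\<close>, the one-parameter subgroup of \<open>tn + u\<close> is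
  \<open>\<sigma> \<mapsto> exp(\<sigma>tn) exp(\<sigma>u - (\<sigma>\<^sup>2t/2) Tu)\<close>.\<close>

lemma ex_log:
  assumes v: "v \<in> V" and TT: "T (T v) = 0"
  shows "ex (t *\<^sub>R n + v + (t/2) *\<^sub>R T v) = ex (t *\<^sub>R n) \<otimes> ex v"
proof -
  define u where "u = v + (t/2) *\<^sub>R T v"
  define \<rho> where "\<rho> \<sigma> = \<sigma> *\<^sub>R u - (\<sigma> * \<sigma> * t / 2) *\<^sub>R T u" for \<sigma>
  have Tu: "T u = T v" by (simp add: u_def T_simps TT)
  have uV: "u \<in> V" "T u \<in> V" using v T_V[OF v] unfolding Tu by (auto simp: u_def inner_add_right)
  have \<rho>V: "\<rho> \<sigma> \<in> V" for \<sigma> using uV by (simp add: \<rho>_def inner_diff_right)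
  have T\<rho>: "T (\<rho> \<sigma>) = \<sigma> *\<^sub>R T u" for \<sigma> by (simp add: \<rho>_def T_simps Tu TT)
  have E\<rho>: "E s (\<rho> \<sigma>) = \<rho> \<sigma> + (s * \<sigma>) *\<^sub>R T u" for s \<sigma>
    using E_if_T_square_zero[of "\<rho> \<sigma>" s] by (simp add: T\<rho> T_simps Tu TT)
  have ex\<rho>: "ex (\<rho> \<sigma>) = ex (\<sigma> *\<^sub>R u) \<otimes> ex ((\<sigma> *\<^sub>R ((- t / 2) * \<sigma>)) *\<^sub>R T u)" for \<sigma>
  proof -
    have "\<rho> \<sigma> = \<sigma> *\<^sub>R u + (\<sigma> *\<^sub>R ((- t / 2) * \<sigma>)) *\<^sub>R T u" by (simp add: \<rho>_def algebra_simps)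
    then show ?thesis using ex_add_V[of "\<sigma> *\<^sub>R u" "(\<sigma> *\<^sub>R ((- t / 2) * \<sigma>)) *\<^sub>R T u"] uV by simp
  qed
  have "one_parameter_subgroup G A \<phi> (t *\<^sub>R n + u) (\<lambda>\<sigma>. ex ((\<sigma> * t) *\<^sub>R n) \<otimes> ex (\<rho> \<sigma>))"
    unfolding one_parameter_subgroup_iff
  proof (intro conjI allI)
    have sm: "smooth_on UNIV (\<lambda>\<sigma>::real. \<sigma> *\<^sub>R ((- t / 2) * \<sigma>))"
      by (intro smooth_on_scaleR smooth_on_id smooth_on_bounded_linear bounded_linear_mult_right)
    have p: "plot UNIV (\<lambda>\<sigma>. ex ((\<sigma> *\<^sub>R ((- t / 2) * \<sigma>)) *\<^sub>R T u))"
      by (rule plot_compose[OF ex_plot[of "T u"] open_UNIV sm]) simp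
    have "plot UNIV (\<lambda>\<sigma>. ex (\<sigma> *\<^sub>R (t *\<^sub>R n)))" by (rule ex_plot)
    then show "plot UNIV (\<lambda>\<sigma>. ex ((\<sigma> * t) *\<^sub>R n) \<otimes> ex (\<rho> \<sigma>))"
      unfolding ex\<rho> by (intro plot_mult ex_plot p) simp
    show "ex (((\<sigma> + \<tau>) * t) *\<^sub>R n) \<otimes> ex (\<rho> (\<sigma> + \<tau>)) =
        (ex ((\<sigma> * t) *\<^sub>R n) \<otimes> ex (\<rho> \<sigma>)) \<otimes> (ex ((\<tau> * t) *\<^sub>R n) \<otimes> ex (\<rho> \<tau>))" for \<sigma> \<tau>
    proof -
      \<comment> \<open>The twist adds \<open>- (\<sigma> * \<tau> * t) *\<^sub>R T u\<close>, the
        cross term of the square in \<open>\<rho> (\<sigma> + \<tau>)\<close>.\<close>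
      have "E (- (\<tau> * t)) (\<rho> \<sigma>) + \<rho> \<tau> = \<rho> (\<sigma> + \<tau>)"
        unfolding E\<rho> by (simp add: \<rho>_def algebra_simps add_divide_distrib flip: scaleR_add_left)
      then show ?thesis using semidirect_mult[OF \<rho>V \<rho>V, of "\<sigma> * t" \<sigma> "\<tau> * t" \<tau>] by (simp add: distrib_right)
    qed
    \<comment> \<open>This factor is a one-parameter subgroup run with quadratic parameter, so it
      adds nothing to the velocity.\<close>
    have "velocity (\<lambda>\<sigma>. ex ((\<sigma> *\<^sub>R ((- t / 2) * \<sigma>)) *\<^sub>R T u)) 0"
    proof -
      have d: "((\<lambda>\<sigma>. \<sigma> *\<^sub>R ((- t / 2) * \<sigma>)) has_vector_derivative 0) (at 0)"
        by (auto intro!: derivative_eq_intros)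
      have "((\<lambda>\<sigma>. \<phi> (ex (\<sigma> *\<^sub>R T u))) has_vector_derivative T u) (at (0 *\<^sub>R ((- t / 2) * 0)))"
        using ex_velocity[of "T u"] by (simp add: velocity_def)
      from vector_diff_chain_at[OF d this]
      have "((\<lambda>\<sigma>. \<phi> (ex ((\<sigma> *\<^sub>R ((- t / 2) * \<sigma>)) *\<^sub>R T u))) has_vector_derivative 0) (at 0)" by (simp add: o_def)
      moreover have "isCont (\<lambda>\<sigma>. ex ((\<sigma> *\<^sub>R ((- t / 2) * \<sigma>)) *\<^sub>R T u)) 0"
        using plot_continuous[OF p] continuous_on_eq_continuous_at[OF open_UNIV] by blast
      ultimately show ?thesis by (simp add: velocity_def)
    qed
    then have "velocity (\<lambda>\<sigma>. ex (\<sigma> *\<^sub>R (t *\<^sub>R n)) \<otimes> ex (\<rho> \<sigma>)) (t *\<^sub>R n + (u + 0))"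
      unfolding ex\<rho> by (intro velocity_mult ex_velocity)
    then show "((\<lambda>\<sigma>. \<phi> (ex ((\<sigma> * t) *\<^sub>R n) \<otimes> ex (\<rho> \<sigma>))) has_vector_derivative t *\<^sub>R n + u) (at 0)"
      by (simp add: velocity_def)
  qed
  note ops = ex_unique[OF this, of 1]
  have "\<rho> 1 = v" by (simp add: \<rho>_def Tu) (simp add: u_def)
  with ops show ?thesis by (simp add: u_def add.assoc)
qed

end

section \<open>Rational abelian ideals\<close>

locale hyperplane_group_lattice = hyperplane_group +
  fixes \<Gamma> :: "'a set"
  assumes connected: "connected (UNIV :: 'a set)"
    and lattice: "discrete_uniform_subgroup G \<Gamma>"
begin

lemma Gamma_lattice: "subgroup \<Gamma> G" "discrete \<Gamma>" "compact_space (coset_topology G \<Gamma>)"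
  using lattice by (auto simp: discrete_uniform_subgroup_def)

lemma Gamma_closed: "x \<in> \<Gamma> \<Longrightarrow> y \<in> \<Gamma> \<Longrightarrow> x \<otimes> y \<in> \<Gamma>" "x \<in> \<Gamma> \<Longrightarrow> inv x \<in> \<Gamma>" "\<one> \<in> \<Gamma>"
  using Gamma_lattice(1) by (auto intro: subgroup.m_closed subgroup.m_inv_closed subgroup.one_closed)

section \<open>The lattice in semidirect coordinates\<close>

definition H :: "(real \<times> 'b) set" where
  "H = {(t, v). v \<in> V \<and> ex (t *\<^sub>R n) \<otimes> ex v \<in> \<Gamma>}"

text \<open>A small \<open>v\<close> has \<open>\<Phi> v\<close> in a neighbourhood isolating
  \<open>\<one>\<close> in \<open>\<Gamma>\<close>, so \<open>\<Phi> v = \<Phi> 0\<close>, and local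
  injectivity gives \<open>v = 0\<close>.\<close>

lemma Gamma_separated: "\<exists>d>0. \<forall>v. (0, v) \<in> H \<longrightarrow> norm v < d \<longrightarrow> v = 0"
proof -
  obtain W where W: "open W" "W \<inter> \<Gamma> = {\<one>}"
    using Gamma_lattice(2) Gamma_closed(3) unfolding discrete_def isolated_in_def by blast
  obtain r where r: "r > 0" "inj_on \<Phi> (ball 0 r)" by (rule Phi_inj_near_0) (rule that; assumption)
  have "open (UNIV \<inter> \<Phi> -` W)" by (rule plot_vimage_open[OF plot_Phi W(1)])
  moreover have "0 \<in> UNIV \<inter> \<Phi> -` W" using W(2) by auto
  ultimately obtain d where d: "d > 0" "ball 0 d \<subseteq> \<Phi> -` W" using openE by (metis Int_UNIV_left)
  have "v = 0" if "(0, v) \<in> H" "norm v < min r d" for v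
  proof -
    have v: "v \<in> V" "ex v \<in> \<Gamma>" using that(1) by (auto simp: H_def)
    have b: "v \<in> ball 0 r" "v \<in> ball 0 d" using that(2) by auto
    have "\<Phi> v \<in> W" using d(2) b(2) by blast
    then have "\<Phi> v = \<Phi> 0" using W(2) v(2) Phi_V[OF v(1)] by auto
    then show ?thesis using inj_onD[OF r(2)] b(1) r(1) by simp
  qed
  then show ?thesis using r(1) d(1) by (intro exI[of _ "min r d"]) auto
qed

lemma lcos_eq_iff: "g <# \<Gamma> = h <# \<Gamma> \<longleftrightarrow> (\<exists>\<gamma>\<in>\<Gamma>. h = g \<otimes> \<gamma>)"
proof
  assume "g <# \<Gamma> = h <# \<Gamma>"
  moreover have "h \<in> h <# \<Gamma>" using Gamma_closed(3) by (auto simp: l_coset_def intro!: bexI[of _ \<one>])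
  ultimately show "\<exists>\<gamma>\<in>\<Gamma>. h = g \<otimes> \<gamma>" by (auto simp: l_coset_def)
next
  assume "\<exists>\<gamma>\<in>\<Gamma>. h = g \<otimes> \<gamma>"
  then obtain \<gamma> where \<gamma>: "\<gamma> \<in> \<Gamma>" "h = g \<otimes> \<gamma>" by blast
  show "g <# \<Gamma> = h <# \<Gamma>"
  proof
    show "g <# \<Gamma> \<subseteq> h <# \<Gamma>"
    proof
      fix x assume "x \<in> g <# \<Gamma>"
      then obtain d where "d \<in> \<Gamma>" "x = g \<otimes> d" by (auto simp: l_coset_def)
      then show "x \<in> h <# \<Gamma>" using \<gamma> Gamma_closed
        by (auto simp: l_coset_def m_assoc intro!: bexI[of _ "inv \<gamma> \<otimes> d"])
    qed
    show "h <# \<Gamma> \<subseteq> g <# \<Gamma>"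
      using \<gamma> Gamma_closed by (auto simp: l_coset_def m_assoc intro!: bexI[of _ "\<gamma> \<otimes> _"])
  qed
qed

text \<open>The sets \<open>P k\<close> increase and cover \<open>G\<close> because
  \<open>\<Phi>\<close> is onto, and compactness of the quotient makes one of them meet every coset.
  A second factor \<open>\<Phi> W\<close> appears because the image of a ball is thickened by a
  neighbourhood of \<open>\<one>\<close> to obtain an open set.\<close>

lemma Gamma_cocompact:
  "\<exists>m. \<forall>g. \<exists>Z W \<gamma>. norm Z \<le> m \<and> norm W \<le> 1 \<and> \<gamma> \<in> \<Gamma> \<and> g = \<Phi> Z \<otimes> \<Phi> W \<otimes> \<gamma>"
proof -
  obtain W where W: "open W" "\<one> \<in> W" "W \<subseteq> \<Phi> ` ball 0 1"
    by (rule Phi_open_at_0[OF zero_less_one]) (rule that; assumption)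
  define P where "P k = {g. \<exists>Z. norm Z \<le> real k \<and> inv (\<Phi> Z) \<otimes> g \<in> W}" for k :: nat
  have P: "open (P k)" for k
  proof -
    have "P k = (\<Union>Z\<in>cball 0 (real k). {g. inv (\<Phi> Z) \<otimes> g \<in> W})" by (auto simp: P_def)
    then show ?thesis using open_translate(1)[OF W(1)] by auto
  qed
  define Q where "Q k = (\<lambda>g. g <# \<Gamma>) ` P k" for k
  have Q: "openin (coset_topology G \<Gamma>) (Q k)" for k
    unfolding openin_coset_topology
  proof
    show "Q k \<subseteq> lcosets \<Gamma>" by (auto simp: Q_def LCOSETS_def)
    have "{g. g <# \<Gamma> \<in> Q k} = (\<Union>\<gamma>\<in>\<Gamma>. {g. g \<otimes> \<gamma> \<in> P k})"
      by (auto simp: Q_def image_iff lcos_eq_iff)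
    then show "open {g. g <# \<Gamma> \<in> Q k}" using open_translate(2)[OF P] by auto
  qed
  have top: "topspace (coset_topology G \<Gamma>) = range (\<lambda>g. g <# \<Gamma>)"
    using quotient_map_coset_topology[of G \<Gamma>] by (auto simp: quotient_map_def)
  have "range (\<lambda>g. g <# \<Gamma>) \<subseteq> \<Union> (range Q)"
  proof clarify
    fix g
    obtain Z where Z: "g = \<Phi> Z" using Phi_surj[OF connected] by blast
    obtain k :: nat where "norm Z \<le> real k" using real_arch_simple by blast
    then have "g \<in> P k" using Z W(2) by (auto simp: P_def)
    then show "g <# \<Gamma> \<in> \<Union> (range Q)" by (auto simp: Q_def)
  qed
  moreover have "compactin (coset_topology G \<Gamma>) (range (\<lambda>g. g <# \<Gamma>))"
    using Gamma_lattice(3) by (simp add: compact_space_def top)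
  moreover have "openin (coset_topology G \<Gamma>) B" if "B \<in> range Q" for B using that Q by auto
  ultimately have "\<exists>\<F>. finite \<F> \<and> \<F> \<subseteq> range Q \<and> range (\<lambda>g. g <# \<Gamma>) \<subseteq> \<Union>\<F>"
    by (intro compactinD)
  then obtain \<F> where \<F>: "finite \<F>" "\<F> \<subseteq> range Q" "range (\<lambda>g. g <# \<Gamma>) \<subseteq> \<Union>\<F>" by (elim exE conjE) (rule that)
  obtain K where K: "finite K" "\<F> = Q ` K" using finite_subset_image[OF \<F>(1,2)] by blast
  obtain m where m: "\<And>k. k \<in> K \<Longrightarrow> k \<le> m"
    using K(1) unfolding finite_nat_set_iff_bounded_le by auto
  have "\<exists>Z W \<gamma>. norm Z \<le> real m \<and> norm W \<le> 1 \<and> \<gamma> \<in> \<Gamma> \<and> g = \<Phi> Z \<otimes> \<Phi> W \<otimes> \<gamma>" for g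
  proof -
    obtain k where k: "k \<in> K" "g <# \<Gamma> \<in> Q k" using \<F>(3) K(2) by blast
    then obtain h where h: "h \<in> P k" "g <# \<Gamma> = h <# \<Gamma>" by (auto simp: Q_def)
    obtain \<gamma> where \<gamma>: "\<gamma> \<in> \<Gamma>" "g = h \<otimes> \<gamma>" using h(2) lcos_eq_iff[of h g] by auto
    obtain Z where Z: "norm Z \<le> real k" "inv (\<Phi> Z) \<otimes> h \<in> W" using h(1) by (auto simp: P_def)
    obtain Y where Y: "Y \<in> ball 0 1" "inv (\<Phi> Z) \<otimes> h = \<Phi> Y" using Z(2) W(3) by blast
    have "h = \<Phi> Z \<otimes> \<Phi> Y" using Y(2) cancel_inv(2)[of "\<Phi> Z" h] by simp
    moreover have "norm Z \<le> real m" using Z(1) m[OF k(1)] by simp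
    ultimately show ?thesis using Y(1) \<gamma> by (intro exI[of _ Z] exI[of _ Y] exI[of _ \<gamma>]) auto
  qed
  then show ?thesis by blast
qed

text \<open>For \<open>g = ex v\<close> the lattice factor is \<open>(-t, v - E t u)\<close> in
  semidirect coordinates, where \<open>(t, u)\<close> is the product of two bounded elements.
  \<open>B1\<close> and \<open>B2\<close> bound the two successive twists by
  \<open>E\<close>.\<close>

lemma H_cocompact_V: "\<exists>C. \<forall>v\<in>V. \<exists>(s, w)\<in>H. \<bar>s\<bar> \<le> C \<and> norm (v - w) \<le> C"
proof -
  obtain m where m: "\<And>g. \<exists>Z W \<gamma>. norm Z \<le> m \<and> norm W \<le> 1 \<and> \<gamma> \<in> \<Gamma> \<and> g = \<Phi> Z \<otimes> \<Phi> W \<otimes> \<gamma>"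
    using Gamma_cocompact by blast
  have in_le: "\<bar>n \<bullet> Z\<bar> \<le> norm Z" for Z using Cauchy_Schwarz_ineq2[of n Z] n by simp
  have pr_le: "norm (pr Z) \<le> 2 * norm Z" for Z
    using norm_triangle_ineq4[of Z "(n \<bullet> Z) *\<^sub>R n"] in_le[of Z] n by simp
  obtain B1 where B1: "\<And>t v. \<bar>t\<bar> \<le> 1 \<Longrightarrow> norm v \<le> 2 * m \<Longrightarrow> norm (E t v) \<le> B1"
    using E_bounded[of 1 "2 * m"] by blast
  obtain B2 where B2: "\<And>t v. \<bar>t\<bar> \<le> m + 1 \<Longrightarrow> norm v \<le> B1 + 2 \<Longrightarrow> norm (E t v) \<le> B2"
    using E_bounded[of "m + 1" "B1 + 2"] by blast
  show ?thesis
  proof (intro exI ballI)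
    fix v assume v: "v \<in> V"
    obtain Z W \<gamma> where *: "norm Z \<le> m" "norm W \<le> 1" "\<gamma> \<in> \<Gamma>" "ex v = \<Phi> Z \<otimes> \<Phi> W \<otimes> \<gamma>"
      using m by blast
    define t where "t = n \<bullet> Z + n \<bullet> W"
    define u where "u = E (- (n \<bullet> W)) (pr Z) + pr W"
    have uV: "u \<in> V" unfolding u_def by (intro subspace_add[OF subspace_V] E_V pr_V)
    have o: "\<Phi> Z \<otimes> \<Phi> W = ex (t *\<^sub>R n) \<otimes> ex u"
      unfolding \<Phi>_def t_def u_def by (rule semidirect_mult[OF pr_V pr_V])
    have "\<gamma> = inv (\<Phi> Z \<otimes> \<Phi> W) \<otimes> ex v" unfolding *(4) by simp
    also have "\<dots> = (ex ((-t) *\<^sub>R n) \<otimes> ex (- E t u)) \<otimes> (ex (0 *\<^sub>R n) \<otimes> ex v)"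
      unfolding o semidirect_inv[OF uV] by simp
    also have "\<dots> = ex ((-t + 0) *\<^sub>R n) \<otimes> ex (E (-0) (- E t u) + v)"
      by (rule semidirect_mult) (use E_V[OF uV] v in auto)
    also have "\<dots> = ex ((-t) *\<^sub>R n) \<otimes> ex (v - E t u)" by (simp add: Ad_one)
    finally have "ex ((-t) *\<^sub>R n) \<otimes> ex (v - E t u) \<in> \<Gamma>" using *(3) by simp
    then have H: "(-t, v - E t u) \<in> H"
      using subspace_diff[OF subspace_V v E_V[OF uV]] by (simp add: H_def)
    have t: "\<bar>t\<bar> \<le> m + 1" using in_le[of Z] in_le[of W] *(1,2) by (auto simp: t_def)
    have "norm (E (- (n \<bullet> W)) (pr Z)) \<le> B1"
      using in_le[of W] pr_le[of Z] *(1,2) by (intro B1) auto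
    then have "norm u \<le> B1 + 2"
      using norm_triangle_ineq[of "E (- (n \<bullet> W)) (pr Z)" "pr W"] pr_le[of W] *(2) by (simp add: u_def)
    then have "norm (E t u) \<le> B2" using B2 t by blast
    then have "\<bar>-t\<bar> \<le> max (m + 1) B2 \<and> norm (v - (v - E t u)) \<le> max (m + 1) B2"
      using t by (auto simp: max_def)
    with H show "\<exists>(s, w)\<in>H. \<bar>s\<bar> \<le> max (m + 1) B2 \<and> norm (v - w) \<le> max (m + 1) B2" by blast
  qed
qed

sublocale flow_lattice T N E V H
proof
  show "subspace V" by (rule subspace_V)
  show "T v \<in> V" if "v \<in> V" for v using T_V that .
  show "v \<in> V" if "(t, v) \<in> H" for t v using that by (simp add: H_def)
  show "(t + s, E (-s) v + w) \<in> H" if "(t, v) \<in> H" "(s, w) \<in> H" for t v s w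
  proof -
    have vw: "v \<in> V" "w \<in> V" and g: "ex (t *\<^sub>R n) \<otimes> ex v \<in> \<Gamma>" "ex (s *\<^sub>R n) \<otimes> ex w \<in> \<Gamma>"
      using that by (auto simp: H_def)
    have "E (-s) v + w \<in> V" by (intro subspace_add[OF subspace_V] E_V vw)
    then show ?thesis using Gamma_closed(1)[OF g] unfolding semidirect_mult[OF vw] by (simp add: H_def)
  qed
  show "(- t, - E t v) \<in> H" if "(t, v) \<in> H" for t v
  proof -
    have v: "v \<in> V" and g: "ex (t *\<^sub>R n) \<otimes> ex v \<in> \<Gamma>" using that by (auto simp: H_def)
    have "- E t v \<in> V" by (intro subspace_neg[OF subspace_V] E_V v)
    then show ?thesis using Gamma_closed(2)[OF g] unfolding semidirect_inv[OF v] by (simp add: H_def)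
  qed
qed (rule Gamma_separated H_cocompact_V)+

lemma log_set_iff: "X \<in> lie_log_set G A \<phi> \<Gamma> \<longleftrightarrow> ex X \<in> \<Gamma>"
  by (simp add: lie_log_set_def ex_def)

text \<open>Rationality is always obtained from lattice logarithms themselves, which lie in their
  rational span.\<close>

lemma rational_subspaceI:
  assumes "subspace \<aa>" "\<aa> \<subseteq> span (\<aa> \<inter> lie_log_set G A \<phi> \<Gamma>)"
  shows "rational_subspace (rational_structure G A \<phi> \<Gamma>) \<aa>"
proof -
  have "lie_log_set G A \<phi> \<Gamma> \<subseteq> rational_structure G A \<phi> \<Gamma>"
    unfolding rational_structure_def by (rule rat.span_superset)
  then have "span (\<aa> \<inter> lie_log_set G A \<phi> \<Gamma>) \<subseteq> span (\<aa> \<inter> rational_structure G A \<phi> \<Gamma>)"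
    by (intro span_mono) blast
  moreover have "span (\<aa> \<inter> rational_structure G A \<phi> \<Gamma>) \<subseteq> \<aa>"
    using assms(1) by (intro span_minimal) auto
  ultimately show ?thesis using assms by (auto simp: rational_subspace_def)
qed

lemma codim_one_hyperplane: "c \<noteq> 0 \<Longrightarrow> codim_one {x::'b. c \<bullet> x = 0}"
  using dim_hyperplane[of c] DIM_positive[where 'a = 'b] by (simp add: codim_one_def)

theorem rational_ideal_exists:
  assumes nonabelian: "\<exists>X Y. br X Y \<noteq> 0"
  shows "\<exists>\<aa>. abelian_ideal br \<aa> \<and> codim_one \<aa> \<and> rational_subspace (rational_structure G A \<phi> \<Gamma>) \<aa>"
proof (cases "\<exists>d>0. \<forall>t v. (t, v) \<in> H \<longrightarrow> \<bar>t\<bar> < d \<longrightarrow> t = 0")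
  case True
  then have "V \<subseteq> span Lam" using Lam_spans_if_discrete_projection by blast
  also have "\<dots> \<subseteq> span (V \<inter> lie_log_set G A \<phi> \<Gamma>)"
    by (rule span_mono) (auto simp: H_def log_set_iff)
  finally have "rational_subspace (rational_structure G A \<phi> \<Gamma>) V"
    by (rule rational_subspaceI[OF subspace_V])
  moreover have "n \<noteq> 0" using n by auto
  ultimately show ?thesis using hyperplane_ideal codim_one_hyperplane by blast
next
  case False
  interpret flow_lattice_dense T N E V H
    by unfold_locales (use False in blast)
  obtain v0 where v0: "v0 \<in> V" "T v0 \<noteq> 0"
  proof -
    obtain X Y where XY: "br X Y \<noteq> 0" using nonabelian by blast
    then have "T (pr X) \<noteq> 0 \<or> T (pr Y) \<noteq> 0" using br_formula[of X Y] T_pr[of X] T_pr[of Y] by auto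
    then show thesis using that pr_V by blast
  qed
  obtain s w b where sw: "(s, w) \<in> H" "s \<noteq> 0" "b \<noteq> 0" and Tb: "\<And>v. v \<in> V \<Longrightarrow> T v \<in> span {b}"
    by (rule T_rank_one[OF v0]) (rule that; assumption)
  have Tb': "T x \<in> span {b}" for x using Tb[OF pr_V] T_pr by metis
  have TT: "T (T x) = 0" for x using T_square_zero[OF pr_V] T_pr by metis
  have T_V': "n \<bullet> T x = 0" for x using T_V[OF pr_V] T_pr[of x] by (metis mem_Collect_eq)
  \<comment> \<open>By \<open>br_formula\<close> this is the bracket of log (s, w) with
    \<open>x\<close>.\<close>
  define f where "f x = s *\<^sub>R T x - (n \<bullet> x) *\<^sub>R T w" for x
  define \<aa> where "\<aa> = {x. s *\<^sub>R T x = (n \<bullet> x) *\<^sub>R T w}"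
  have f_span: "f x \<in> span {b}" for x
    unfolding f_def by (intro span_diff span_scale Tb')
  have linear_f: "linear f"
    unfolding f_def by (auto simp: linear_iff T_simps inner_add_right algebra_simps)
  \<comment> \<open>\<open>c\<close> represents the functional \<open>f x \<bullet> b\<close>. As
    \<open>f\<close> maps into the line through \<open>b\<close>, its kernel is the hyperplane
    orthogonal to \<open>c\<close>.\<close>
  define c where "c = (\<Sum>i\<in>Basis. (f i \<bullet> b) *\<^sub>R i)"
  have c: "c \<bullet> x = f x \<bullet> b" for x
  proof -
    have "f x \<bullet> b = (\<Sum>i\<in>Basis. (x \<bullet> i) * (f i \<bullet> b))"
      by (subst linear_sum_Basis[OF linear_f]) (simp add: inner_sum_left)
    then show ?thesis unfolding c_def inner_sum_left by (simp add: mult.commute inner_commute[of x])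
  qed
  have \<aa>: "\<aa> = {x. c \<bullet> x = 0}"
  proof -
    have "f x = 0 \<longleftrightarrow> f x \<bullet> b = 0" for x
    proof -
      obtain k where "f x = k *\<^sub>R b" using f_span[of x] by (auto simp: span_singleton)
      then show ?thesis using sw(3) by simp
    qed
    then show ?thesis by (auto simp: \<aa>_def c f_def)
  qed
  \<comment> \<open>On \<open>V\<close> the map \<open>f\<close> is \<open>s T\<close>, which does
    not vanish at \<open>v0\<close>.\<close>
  have "c \<noteq> 0"
  proof
    assume "c = 0"
    then have "v0 \<in> \<aa>" by (simp add: \<aa>)
    then show False using v0 sw(2) by (simp add: \<aa>_def)
  qed
  then have codim: "codim_one \<aa>" unfolding \<aa> by (rule codim_one_hyperplane)
  have sub: "subspace \<aa>" unfolding \<aa> by (rule subspace_hyperplane)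
  have "abelian_ideal br \<aa>"
    unfolding abelian_ideal_def
  proof (intro conjI sub allI ballI)
    fix x y assume "y \<in> \<aa>"
    note eq = br_formula[of x y]
    \<comment> \<open>Brackets lie in the image of \<open>T\<close>, which is contained in
      \<open>V\<close> and killed by \<open>T\<close>, so both sides of the equation defining
      \<open>\<aa>\<close> are 0.\<close>
    show "br x y \<in> \<aa>" unfolding eq \<aa>_def
      by (simp add: T_simps TT inner_diff_right T_V')
  next
    fix x y assume "x \<in> \<aa>" "y \<in> \<aa>"
    then have x: "s *\<^sub>R T x = (n \<bullet> x) *\<^sub>R T w" and y: "s *\<^sub>R T y = (n \<bullet> y) *\<^sub>R T w" by (auto simp: \<aa>_def)
    note eq = br_formula[of x y]
    have "s *\<^sub>R br x y = (n \<bullet> x) *\<^sub>R (s *\<^sub>R T y) - (n \<bullet> y) *\<^sub>R (s *\<^sub>R T x)"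
      unfolding eq by (simp add: algebra_simps)
    also have "\<dots> = 0" unfolding x y by (simp add: algebra_simps)
    finally show "br x y = 0" using sw(2) by simp
  qed
  moreover have "rational_subspace (rational_structure G A \<phi> \<Gamma>) \<aa>"
  proof (rule rational_subspaceI[OF sub])
    have "\<aa> \<subseteq> span (\<aa> \<inter> {t *\<^sub>R n + v + (t/2) *\<^sub>R T v | t v. (t, v) \<in> H})"
      unfolding \<aa>_def by (rule centralizer_spanned[OF sw(1,2) n T_n refl])
    also have "\<dots> \<subseteq> span (\<aa> \<inter> lie_log_set G A \<phi> \<Gamma>)"
    proof (intro span_mono Int_mono order_refl subsetI)
      fix x assume "x \<in> {t *\<^sub>R n + v + (t/2) *\<^sub>R T v | t v. (t, v) \<in> H}"
      then obtain t v where x: "x = t *\<^sub>R n + v + (t/2) *\<^sub>R T v" "(t, v) \<in> H" by blast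
      then have "v \<in> V" "ex (t *\<^sub>R n) \<otimes> ex v \<in> \<Gamma>" by (auto simp: H_def)
      then show "x \<in> lie_log_set G A \<phi> \<Gamma>" unfolding log_set_iff x(1) by (simp add: ex_log[OF _ TT])
    qed
    finally show "\<aa> \<subseteq> span (\<aa> \<inter> lie_log_set G A \<phi> \<Gamma>)" .
  qed
  ultimately show ?thesis using codim by blast
qed

end

text \<open>Turns nilpotency of the Lie algebra into nilpotency of each single ad X.\<close>

lemma lower_central_funpow: "(b X ^^ k) v \<in> lower_central b k"
proof (induction k)
  case (Suc k) then show ?case by (auto intro!: span_base)
qed simp

theorem proposition7:
  fixes G :: "'g::{t2_space, second_countable_topology} monoid"
    and A :: "('g, 'e::euclidean_space) chart set"
    and U :: "'g set" and \<phi> :: "'g \<Rightarrow> 'e" and \<Gamma> :: "'g set"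
  assumes "one_parameter_metabelian_nilpotent G A U \<phi>"
    and "discrete_uniform_subgroup G \<Gamma>"
  shows "\<exists>\<aa>. abelian_ideal (lie_bracket G U \<phi>) \<aa> \<and> codim_one \<aa> \<and>
             rational_subspace (rational_structure G A \<phi> \<Gamma>) \<aa>"
proof -
  let ?b = "lie_bracket G U \<phi>"
  have lie: "lie_group G A" "chart_at_identity G A U \<phi>" "connected (UNIV :: 'g set)"
    "nilpotent_bracket ?b" "\<exists>X Y. ?b X Y \<noteq> 0" "\<exists>\<aa>. abelian_ideal ?b \<aa> \<and> codim_one \<aa>"
    using assms(1) unfolding one_parameter_metabelian_nilpotent_def by blast+
  obtain \<aa> where \<aa>: "abelian_ideal ?b \<aa>" "codim_one \<aa>" using lie(6) by blast
  have "dim \<aa> = DIM('e) - 1" using \<aa>(2) by (simp add: codim_one_def)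
  \<comment> \<open>The normal of the given ideal, once scaled to length one, serves as the
    complementary direction \<open>n\<close>.\<close>
  then obtain a where a: "a \<noteq> 0" "span \<aa> = {x. a \<bullet> x = 0}" by (rule lowdim_eq_hyperplane)
  define n where "n = a /\<^sub>R norm a"
  have n: "norm n = 1" using a(1) by (simp add: n_def)
  have "subspace \<aa>" using \<aa>(1) by (simp add: abelian_ideal_def)
  then have hyp: "\<aa> = {v. n \<bullet> v = 0}" using a by (simp add: n_def span_eq_iff[THEN iffD2])
  obtain N where "lower_central ?b N = {0}" using lie(4) by (auto simp: nilpotent_bracket_def)
  then have nil: "(?b n ^^ N) v = 0" for v using lower_central_funpow[where b = ?b and X = n and k = N and v = v] by simp
  have grp: "group G" using lie(1) by (simp add: lie_group_def)
  interpret hyperplane_group_lattice G A U \<phi> n N \<Gamma>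
  proof (intro hyperplane_group_lattice.intro hyperplane_group.intro charted_group.intro
      smooth_group.intro grp smooth_group_axioms.intro charted_group_axioms.intro
      hyperplane_group_axioms.intro hyperplane_group_lattice_axioms.intro)
  qed (use lie assms(2) n nil \<aa>(1) hyp in auto)
  show ?thesis using rational_ideal_exists[OF lie(5)] .
qed

end
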